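(* Let $n\ge 1$, $1<p<3$, $0<\alpha\le 1$, and let $w$ be an $A_p$ weight on $\mathbb R^n$. Then for every $f\in L^p(w)$, \[ \lVert G_\alpha f\rVert_{L^{p,\infty}(w)} \le C\, [w]_{A_p}^{\max\{\frac12,\frac1p\}}\,\phi([w]_{A_p})\,\lVert f\rVert_{L^p(w)}, \] where $\phi(x)=1$ if $1<p<2$ and $\phi(x)=1+\log x$ if $2\le p<3$, and $C$ is a constant depending only on $n,p,\alpha$ (not on $w$ or $f$).
   Context: For $1<p<\infty$, a weight $w$ is in $A_p$ if $w$ has a density $w(x)>0$ a.e. and, with $\sigma(x)=w(x)^{1-\frac{p}{p-1}}$, $[w]_{A_p}:=\sup_Q \frac{w(Q)}{|Q|}\bigl(\frac{\sigma(Q)}{|Q|}\bigr)^{p-1}<\infty$, the supremum over all cubes $Q\subset\mathbb R^n$; here $w(Q)=\int_Q w\,dx$. $L^{p,\infty}(w)$ is the weak $L^p$ space with respect to the measure $w\,dx$, with quasinorm $\sup_{\lambda>0}\lambda\, w\{x:|g(x)|>\lambda\}^{1/p}$. Intrinsic square function: let $C_\alpha$ be the set of functions $\gamma$ on $\mathbb R^n$ supported in the unit ball, with $\int\gamma=0$ and $|\gamma(x)-\gamma(y)|\le|x-y|^\alpha$ for all $x,y$. For $f\in L^1_{\mathrm{loc}}(\mathbb R^n)$, set $A_\alpha f(y,t)=\sup_{\gamma\in C_\alpha}|f*\gamma_t(y)|$ with $\gamma_t(x)=t^{-n}\gamma(x/t)$, and $G_\alpha f(x)=\Bigl(\int_{\Gamma(x)}A_\alpha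 f(y,t)^2\,\frac{dy\,dt}{t^{n+1}}\Bigr)^{1/2}$, where $\Gamma(x)=\{(y,t)\in\mathbb R^n\times(0,\infty): |x-y|<t\}$. *)

theory Defs
  imports "HOL-Analysis.Analysis"
begin

text \<open>Positive real powers of extended nonnegative reals (used only with exponent r > 0):
  infinity to a positive power is infinity.\<close>
definition enn_powr :: "ennreal \<Rightarrow> real \<Rightarrow> ennreal" where
  "enn_powr v r = (if v = top then top else ennreal (enn2real v powr r))"

definition cubes :: "'a::euclidean_space set set" where
  "cubes = {cbox a (a + l *\<^sub>R One) | a l. l > 0}"

definition wmeas :: "('a::euclidean_space \<Rightarrow> real) \<Rightarrow> 'a set \<Rightarrow> ennreal" where
  "wmeas w E = (\<integral>\<^sup>+ x. ennreal (w x) * indicator E x \<partial>lborel)"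

definition dual_weight :: "real \<Rightarrow> ('a::euclidean_space \<Rightarrow> real) \<Rightarrow> 'a \<Rightarrow> real" where
  "dual_weight p w x = w x powr (1 - p / (p - 1))"

definition Ap_quot :: "real \<Rightarrow> ('a::euclidean_space \<Rightarrow> real) \<Rightarrow> 'a set \<Rightarrow> real" where
  "Ap_quot p w Q = (enn2real (wmeas w Q) / measure lborel Q) *
      (enn2real (wmeas (dual_weight p w) Q) / measure lborel Q) powr (p - 1)"

text \<open>w is an A_p weight: measurable density, positive a.e., and the A_p supremum is finite.
  (Finiteness of the supremum forces w(Q) and sigma(Q) to be finite for every cube, since both
  are positive; we record this explicitly so that the real-valued quotient is meaningful.)\<close>
definition Ap_weight :: "real \<Rightarrow> ('a::euclidean_space \<Rightarrow> real) \<Rightarrow> bool" where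
  "Ap_weight p w \<longleftrightarrow> w \<in> borel_measurable lborel \<and> (AE x in lborel. w x > 0) \<and>
     (\<forall>Q\<in>cubes. wmeas w Q < top \<and> wmeas (dual_weight p w) Q < top) \<and>
     bdd_above (Ap_quot p w ` cubes)"

definition Ap_const :: "real \<Rightarrow> ('a::euclidean_space \<Rightarrow> real) \<Rightarrow> real" where
  "Ap_const p w = (SUP Q\<in>cubes. Ap_quot p w Q)"

definition Lp_w_norm :: "real \<Rightarrow> ('a::euclidean_space \<Rightarrow> real) \<Rightarrow> ('a \<Rightarrow> real) \<Rightarrow> ennreal" where
  "Lp_w_norm p w f = enn_powr (\<integral>\<^sup>+ x. ennreal (\<bar>f x\<bar> powr p * w x) \<partial>lborel) (1 / p)"

definition in_Lp_w :: "real \<Rightarrow> ('a::euclidean_space \<Rightarrow> real) \<Rightarrow> ('a \<Rightarrow> real) \<Rightarrow> bool" where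
  "in_Lp_w p w f \<longleftrightarrow> f \<in> borel_measurable lborel \<and> Lp_w_norm p w f < top"

definition weak_Lp_w_norm :: "real \<Rightarrow> ('a::euclidean_space \<Rightarrow> real) \<Rightarrow> ('a \<Rightarrow> ennreal) \<Rightarrow> ennreal" where
  "weak_Lp_w_norm p w g =
     (SUP lam\<in>{0<..}. ennreal lam * enn_powr (wmeas w {x. g x > ennreal lam}) (1 / p))"

definition C_alpha :: "real \<Rightarrow> ('a::euclidean_space \<Rightarrow> real) set" where
  "C_alpha \<alpha> = {\<gamma>. (\<forall>x. \<gamma> x \<noteq> 0 \<longrightarrow> norm x \<le> 1) \<and>
                   integral\<^sup>L lborel \<gamma> = 0 \<and>
                   (\<forall>x y. \<bar>\<gamma> x - \<gamma> y\<bar> \<le> dist x y powr \<alpha>)}"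

definition dilate :: "('a::euclidean_space \<Rightarrow> real) \<Rightarrow> real \<Rightarrow> 'a \<Rightarrow> real" where
  "dilate \<gamma> t x = t powr (- real DIM('a)) * \<gamma> ((1 / t) *\<^sub>R x)"

definition conv :: "('a::euclidean_space \<Rightarrow> real) \<Rightarrow> ('a \<Rightarrow> real) \<Rightarrow> 'a \<Rightarrow> real" where
  "conv f g y = (\<integral>z. f z * g (y - z) \<partial>lborel)"

definition A_alpha :: "real \<Rightarrow> ('a::euclidean_space \<Rightarrow> real) \<Rightarrow> 'a \<Rightarrow> real \<Rightarrow> ennreal" where
  "A_alpha \<alpha> f y t = (SUP \<gamma>\<in>C_alpha \<alpha>. ennreal \<bar>conv f (dilate \<gamma> t) y\<bar>)"

definition cone :: "'a::euclidean_space \<Rightarrow> ('a \<times> real) set" where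
  "cone x = {(y, t). t > 0 \<and> dist x y < t}"

definition G_alpha :: "real \<Rightarrow> ('a::euclidean_space \<Rightarrow> real) \<Rightarrow> 'a \<Rightarrow> ennreal" where
  "G_alpha \<alpha> f x = enn_powr
     (\<integral>\<^sup>+ yt. (A_alpha \<alpha> f (fst yt) (snd yt))\<^sup>2 * ennreal (1 / snd yt ^ (DIM('a) + 1))
               * indicator (cone x) yt \<partial>(lborel \<Otimes>\<^sub>M lborel)) (1 / 2)"

definition phi_p :: "real \<Rightarrow> real \<Rightarrow> real" where
  "phi_p p x = (if p < 2 then 1 else 1 + ln x)"

end

theory Submission
  imports Defs
begin

text \<open>
  For a dyadic cube Q let a(Q) be the supremum of |\<integral> f \<phi>| over the mean zero \<alpha>-Hoelder functions
  \<phi> supported in Q, normalised in L1. By the one-third trick every ball B(x, 2t) lies in a cube of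
  comparable size from one of 2^n shifted dyadic grids, so (G f)(x)^2 is at most a constant times
  the sum of a(Q)^2 over all Q containing x in these grids.

  Expanding f into martingale differences bounds a(Q) by the averages over Q of |D f| at the finer
  levels, damped by (l(P) / l(Q))^\<alpha>. Hence, below a cube R and above the maximal cubes on which the
  average of |f| exceeds 8 times its average A over R, the a(Q)^2 integrate to at most C A^2 |R|.
  Stopping as soon as the average of |f| or the accumulated sum of a(Q)^2 is too large therefore
  produces a sparse family S with \<Sum> a(Q)^2 1_Q \<le> C \<Sum> (average of |f| over Q)^2 1_Q, the second sum
  being over S.

  For the sparse sum at height 1, the cubes on which |f| has average greater than 1 are covered by the
  maximal function bound. The others are grouped by 2^(-l-1) < average \<le> 2^(-l); let N_l count the
  cubes of the l-th group. The A_p condition and sparseness give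
  \<integral> N_l w \<le> C 2^(lp) [w] ||f||^p and \<integral> N_l^2 w \<le> C [w] \<integral> N_l w. Now apply Chebyshev to the events
  N_l > 4^l c_l with \<Sum> c_l \<le> 1. For p < 2 a geometric sequence c_l and the first moment suffice. For
  p \<ge> 2, c_l is constant on the first 1 + log [w] levels, which costs the logarithm, and geometric
  afterwards, where the second moment gives decay.
\<close>

section \<open>Dyadic grids and averages\<close>

text \<open>The exponents come from balancing two moments. The l-th group contributes 2^(lp) y
  min(1, y) with y about [w] / (4^l c_l), the minimum choosing between first and second moment. For
  p < 2 the factor 2^(lp) / 4^l decays and [w] stays linear, which is [w]^(1/p) after the p-th root.
  For p \<ge> 2 the bound y min(1, y) \<le> y^(p/2) cancels 2^(lp) and leaves ([w] / c_l)^(p/2).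
  With about \<Lambda> = 1 + log [w] levels and c_l about 1 / \<Lambda> the total is \<Lambda>^(1 +
  p/2) [w]^(p/2), and 1 + p/2 \<le> p makes its p-th root at most \<Lambda> [w]^(1/2). Dyadic scales
  are infinite in both directions, while the stopping construction needs a first cube and the
  estimates work with finite sums. Each grid is therefore cut off above at level 0, whose cells all
  count as stopping cubes, and below at N. No constant depends on either cut, so monotone
  convergence recovers all scales at the end.\<close>

lemma set_integrable_sum:
  fixes g :: "'i \<Rightarrow> 'b \<Rightarrow> real"
  assumes "\<And>l. l \<in> A \<Longrightarrow> set_integrable M Q (g l)"
  shows "set_integrable M Q (\<lambda>y. \<Sum>l\<in>A. g l y)"
  using assms unfolding set_integrable_def scaleR_sum_right
  by (intro Bochner_Integration.integrable_sum) auto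

lemma set_integral_sum:
  fixes g :: "'i \<Rightarrow> 'b \<Rightarrow> real"
  assumes "\<And>l. l \<in> A \<Longrightarrow> set_integrable M Q (g l)"
  shows "(LINT y:Q|M. \<Sum>l\<in>A. g l y) = (\<Sum>l\<in>A. LINT y:Q|M. g l y)"
  using assms unfolding set_integrable_def set_lebesgue_integral_def scaleR_sum_right
  by (intro Bochner_Integration.integral_sum) auto

text \<open>Level 0 holds the largest cells, of side \<open>r\<close>. A cell is only pinned between
  an open and a closed cube, which suits half-open cubes in any position; the boundary is Lebesgue
  null.\<close>

locale grid =
  fixes cell :: "nat \<Rightarrow> 'a::euclidean_space \<Rightarrow> 'a set" and r :: real
  assumes r_pos: "r > 0"
    and cell_self: "x \<in> cell i x"
    and cell_eq: "y \<in> cell i x \<Longrightarrow> cell i y = cell i x"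
    and cell_Suc: "cell (Suc i) x \<subseteq> cell i x"
    and countable_cells: "countable (range (cell i))"
    and cell_sets: "cell i x \<in> sets borel"
    and cell_box: "\<exists>c. box c (c + (r / 2 ^ i) *\<^sub>R One) \<subseteq> cell i x \<and>
                       cell i x \<subseteq> cbox c (c + (r / 2 ^ i) *\<^sub>R One)"
begin

definition vol :: "nat \<Rightarrow> real" where
  "vol i = (r / 2 ^ i) ^ DIM('a)"

text \<open>Measurability with respect to the level i cells, phrased as constancy so that it makes
  sense for any range type. \<open>En\<close> and \<open>avg\<close> are the corresponding
  conditional expectations.\<close>

definition adapted :: "nat \<Rightarrow> ('a \<Rightarrow> 'b) \<Rightarrow> bool" where
  "adapted i g \<longleftrightarrow> (\<forall>x y. y \<in> cell i x \<longrightarrow> g y = g x)"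

text \<open>The choice depends on the cell alone, so all points of a cell share one
  representative.\<close>

definition rep :: "nat \<Rightarrow> 'a \<Rightarrow> 'a" where
  "rep i x = (SOME y. y \<in> cell i x)"

definition En :: "nat \<Rightarrow> ('a \<Rightarrow> ennreal) \<Rightarrow> 'a \<Rightarrow> ennreal" where
  "En i h x = ennreal (1 / vol i) * (\<integral>\<^sup>+y. h y * indicator (cell i x) y \<partial>lborel)"

lemma vol_pos: "vol i > 0"
  using r_pos by (simp add: vol_def)

lemma vol_Suc: "vol i = 2 ^ DIM('a) * vol (Suc i)"
  by (simp add: vol_def power_divide power_mult_distrib)

lemma cell_sym: "y \<in> cell i x \<longleftrightarrow> x \<in> cell i y"
  using cell_eq cell_self by blast

lemma cell_mono: "i \<le> j \<Longrightarrow> cell j x \<subseteq> cell i x"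
  by (induction rule: dec_induct) (use cell_Suc in blast)+

lemma measurable_cell [measurable]: "cell i x \<in> sets borel"
  by (rule cell_sets)

text \<open>Lying in a common cell is a countable union of squares \<open>Q \<times> Q\<close>.
  Joint measurability is what Fubini needs for averages.\<close>

lemma measurable_cell_pair [measurable]:
  "Measurable.pred (borel \<Otimes>\<^sub>M borel) (\<lambda>z. snd z \<in> cell i (fst z))"
proof -
  have eq: "{z. snd z \<in> cell i (fst z)} = (\<Union>Q\<in>range (cell i). Q \<times> Q)"
  proof (intro set_eqI iffI)
    fix z :: "'a \<times> 'a" assume "z \<in> {z. snd z \<in> cell i (fst z)}"
    then have "z \<in> cell i (fst z) \<times> cell i (fst z)"
      by (cases z) (simp add: cell_self)
    then show "z \<in> (\<Union>Q\<in>range (cell i). Q \<times> Q)" by blast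
  next
    fix z :: "'a \<times> 'a" assume "z \<in> (\<Union>Q\<in>range (cell i). Q \<times> Q)"
    then obtain a where "fst z \<in> cell i a" "snd z \<in> cell i a" by auto
    then show "z \<in> {z. snd z \<in> cell i (fst z)}" by (simp add: cell_eq)
  qed
  have "(\<Union>Q\<in>range (cell i). Q \<times> Q) \<in> sets (borel \<Otimes>\<^sub>M borel)"
    using countable_cells by (intro sets.countable_UN'') auto
  then show ?thesis
    unfolding pred_def eq[symmetric] by (simp add: space_pair_measure)
qed

lemma cell_emeasure: "emeasure lborel (cell i x) = ennreal (vol i)"
proof -
  from cell_box[of i x] obtain c where c: "box c (c + (r / 2 ^ i) *\<^sub>R One) \<subseteq> cell i x"
    "cell i x \<subseteq> cbox c (c + (r / 2 ^ i) *\<^sub>R One)" by blast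
  have le: "\<And>b. b \<in> Basis \<Longrightarrow> c \<bullet> b \<le> (c + (r / 2 ^ i) *\<^sub>R One) \<bullet> b"
    using r_pos by (simp add: inner_simps)
  have m: "(\<Prod>b\<in>Basis. (c + (r / 2 ^ i) *\<^sub>R One - c) \<bullet> b) = vol i"
    by (simp add: vol_def inner_simps)
  have "emeasure lborel (cell i x) \<le> ennreal (vol i)"
    using emeasure_mono[OF c(2), of lborel] emeasure_lborel_cbox[OF le] m by simp
  moreover have "ennreal (vol i) \<le> emeasure lborel (cell i x)"
    using emeasure_mono[OF c(1), of lborel] emeasure_lborel_box[OF le] m by simp
  ultimately show ?thesis by (rule antisym)
qed

lemma cell_dist: "y \<in> cell i x \<Longrightarrow> z \<in> cell i x \<Longrightarrow> dist y z \<le> real DIM('a) * (r / 2 ^ i)"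
proof -
  assume yz: "y \<in> cell i x" "z \<in> cell i x"
  from cell_box[of i x] obtain c where c: "cell i x \<subseteq> cbox c (c + (r / 2 ^ i) *\<^sub>R One)" by blast
  have "\<bar>(y - z) \<bullet> b\<bar> \<le> r / 2 ^ i" if b: "b \<in> Basis" for b
  proof -
    have "y \<in> cbox c (c + (r / 2 ^ i) *\<^sub>R One)" "z \<in> cbox c (c + (r / 2 ^ i) *\<^sub>R One)"
      using yz c by auto
    then have "c \<bullet> b \<le> y \<bullet> b" "y \<bullet> b \<le> c \<bullet> b + r / 2 ^ i" "c \<bullet> b \<le> z \<bullet> b" "z \<bullet> b \<le> c \<bullet> b + r / 2 ^ i"
      using b by (auto simp: mem_box inner_simps)
    then show ?thesis by (simp add: inner_simps)
  qed
  then have "(\<Sum>b\<in>Basis. \<bar>(y - z) \<bullet> b\<bar>) \<le> (\<Sum>b\<in>(Basis::'a set). r / 2 ^ i)"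
    by (intro sum_mono)
  then show ?thesis
    using norm_le_l1[of "y - z"] by (simp add: dist_norm)
qed

lemma adaptedD: "adapted i g \<Longrightarrow> y \<in> cell i x \<Longrightarrow> g y = g x"
  by (auto simp: adapted_def)

lemma adapted_mono: "adapted i g \<Longrightarrow> i \<le> j \<Longrightarrow> adapted j g"
  using cell_mono by (fastforce simp: adapted_def)

lemma adapted_indicator: "i \<le> j \<Longrightarrow> adapted j (indicator (cell i x) :: 'a \<Rightarrow> 'b::zero_neq_one)"
proof -
  assume ij: "i \<le> j"
  have "y \<in> cell i x \<longleftrightarrow> z \<in> cell i x" if "y \<in> cell j z" for y z
  proof -
    have "y \<in> cell i z" using that cell_mono[OF ij] by blast
    then have "cell i y = cell i z" by (rule cell_eq)
    then show ?thesis using cell_sym[of y i x] cell_sym[of z i x] by simp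
  qed
  then show ?thesis by (simp add: adapted_def indicator_def)
qed

lemma rep_in: "rep i x \<in> cell i x"
  unfolding rep_def by (rule someI[of _ x]) (rule cell_self)

lemma measurable_rep: "rep i \<in> measurable borel (count_space (range (rep i)))"
proof -
  have "countable (range (rep i))"
  proof -
    have "range (rep i) = (\<lambda>Q. SOME y. y \<in> Q) ` range (cell i)"
      by (auto simp: rep_def)
    then show ?thesis using countable_cells by simp
  qed
  moreover have "rep i -` {a} \<inter> space borel \<in> sets borel" if "a \<in> range (rep i)" for a
  proof -
    from that obtain z where z: "a = rep i z" by auto
    have "rep i -` {a} = cell i a"
    proof (intro set_eqI iffI)
      fix y assume "y \<in> rep i -` {a}"
      then show "y \<in> cell i a" using rep_in[of i y] cell_sym by auto
    next
      fix y assume "y \<in> cell i a"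
      then have "cell i y = cell i z" using z rep_in cell_eq by metis
      then show "y \<in> rep i -` {a}" by (simp add: z rep_def)
    qed
    then show ?thesis by simp
  qed
  ultimately show ?thesis
    by (subst measurable_count_space_eq_countable) auto
qed

text \<open>An adapted function factors through \<open>rep i\<close>, a measurable map with
  countable range, and on a countable discrete space every function is measurable.\<close>

lemma adapted_measurable:
  assumes "adapted i g" "\<And>x. g x \<in> space N"
  shows "g \<in> measurable borel N"
proof -
  have "g x = g (rep i x)" for x
    using adaptedD[OF assms(1) rep_in] by simp
  moreover have "(\<lambda>x. g (rep i x)) \<in> measurable borel N"
    by (rule measurable_compose[OF measurable_rep]) (use assms(2) in auto)
  ultimately show ?thesis by presburger
qed

lemma adapted_borel: "adapted i (g :: 'a \<Rightarrow> 'b::topological_space) \<Longrightarrow> g \<in> borel_measurable borel"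
  by (rule adapted_measurable) auto

lemma adapted_pred: "adapted i P \<Longrightarrow> Measurable.pred borel P"
  by (rule adapted_measurable) auto

lemma adapted_En: "adapted i (En i h)"
  unfolding adapted_def En_def by (simp add: cell_eq)

lemma measurable_En [measurable]: "En i h \<in> borel_measurable borel"
  by (rule adapted_borel[OF adapted_En])

lemma vol_cancel: "ennreal (1 / vol i) * ennreal (vol i) = 1"
  using vol_pos[of i] by (simp add: ennreal_mult[symmetric])

lemma indicator_cell_sym: "indicator (cell i x) y = (indicator (cell i y) x :: 'b::zero_neq_one)"
  unfolding indicator_def using cell_sym[of x i y] by presburger

lemma measurable_indicator_cell [measurable]:
  "(\<lambda>z. indicator (cell i (fst z)) (snd z) :: ennreal) \<in> borel_measurable (borel \<Otimes>\<^sub>M borel)"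
  unfolding indicator_def by measurable

text \<open>The averaging kernel, the indicator of lying in a common cell divided by
  \<open>vol i\<close>, is symmetric. Tonelli moves it from h to u, and u is its own
  average.\<close>

lemma nn_integral_En:
  assumes [measurable]: "u \<in> borel_measurable borel" "h \<in> borel_measurable borel"
    and ad: "adapted i u"
  shows "(\<integral>\<^sup>+x. u x * En i h x \<partial>lborel) = (\<integral>\<^sup>+x. u x * h x \<partial>lborel)"
proof -
  let ?c = "ennreal (1 / vol i)"
  have [measurable]: "(\<lambda>z. indicator (cell i (snd z)) (fst z) :: ennreal) \<in> borel_measurable (borel \<Otimes>\<^sub>M borel)"
    by (subst indicator_cell_sym) measurable
  have "(\<integral>\<^sup>+x. u x * En i h x \<partial>lborel)
      = (\<integral>\<^sup>+x. (\<integral>\<^sup>+y. u x * (?c * (h y * indicator (cell i x) y)) \<partial>lborel) \<partial>lborel)"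
    unfolding En_def by (intro nn_integral_cong) (simp add: nn_integral_cmult)
  also have "\<dots> = (\<integral>\<^sup>+y. (\<integral>\<^sup>+x. u x * (?c * (h y * indicator (cell i x) y)) \<partial>lborel) \<partial>lborel)"
    by (rule lborel_pair.Fubini') measurable
  also have "\<dots> = (\<integral>\<^sup>+y. (\<integral>\<^sup>+x. (u y * ?c * h y) * indicator (cell i y) x \<partial>lborel) \<partial>lborel)"
  proof (intro nn_integral_cong)
    fix x y
    have "u x = u y" if "y \<in> cell i x"
      using adaptedD[OF ad that] by simp
    then show "u x * (?c * (h y * indicator (cell i x) y)) = u y * ?c * h y * indicator (cell i y) x"
      unfolding indicator_cell_sym[of i y x]
      by (cases "y \<in> cell i x") (simp_all add: mult.assoc mult.left_commute)
  qed
  also have "\<dots> = (\<integral>\<^sup>+y. u y * h y * (?c * ennreal (vol i)) \<partial>lborel)"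
  proof (intro nn_integral_cong)
    fix y
    have "(\<integral>\<^sup>+x. (u y * ?c * h y) * indicator (cell i y) x \<partial>lborel) = u y * ?c * h y * ennreal (vol i)"
      by (subst nn_integral_cmult_indicator) (simp_all add: cell_emeasure)
    then show "(\<integral>\<^sup>+x. (u y * ?c * h y) * indicator (cell i y) x \<partial>lborel) = u y * h y * (?c * ennreal (vol i))"
      by (simp only: mult.assoc mult.left_commute mult.commute)
  qed
  also have "\<dots> = (\<integral>\<^sup>+y. u y * h y \<partial>lborel)"
    unfolding vol_cancel by simp
  finally show ?thesis .
qed

section \<open>Averages of real-valued functions\<close>

definition avg :: "nat \<Rightarrow> ('a \<Rightarrow> real) \<Rightarrow> 'a \<Rightarrow> real" where
  "avg i f x = (LBINT y:cell i x. f y) / vol i"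

lemma adapted_avg: "adapted i (avg i f)"
  unfolding adapted_def avg_def by (simp add: cell_eq)

lemma measurable_avg [measurable]: "avg i f \<in> borel_measurable borel"
  by (rule adapted_borel[OF adapted_avg])

text \<open>The signed version of the same symmetry; \<open>nn_integral_En\<close> applied to
  absolute values supplies the integrability for Fubini.\<close>

lemma avg_selfadjoint:
  assumes [measurable]: "F \<in> borel_measurable borel"
    and ad: "adapted k u" and int: "integrable lborel (\<lambda>x. u x * F x)"
  shows "integrable lborel (\<lambda>x. u x * avg k F x)"
    and "(\<integral>x. u x * avg k F x \<partial>lborel) = (\<integral>x. u x * F x \<partial>lborel)"
proof -
  have [measurable]: "u \<in> borel_measurable borel" by (rule adapted_borel[OF ad])
  have [measurable]: "(\<lambda>z. indicator (cell k (fst z)) (snd z) :: real) \<in> borel_measurable (borel \<Otimes>\<^sub>M borel)"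
    unfolding indicator_def by measurable
  define \<Phi> where "\<Phi> x y = u x * (F y * indicator (cell k x) y) / vol k" for x y
  have \<Phi>_meas: "(\<lambda>(x, y). \<Phi> x y) \<in> borel_measurable (lborel \<Otimes>\<^sub>M lborel)"
    unfolding \<Phi>_def case_prod_beta' by measurable
  have "(\<integral>\<^sup>+z. ennreal (norm (case z of (x, y) \<Rightarrow> \<Phi> x y)) \<partial>(lborel \<Otimes>\<^sub>M lborel))
      = (\<integral>\<^sup>+x. (\<integral>\<^sup>+y. ennreal (norm (\<Phi> x y)) \<partial>lborel) \<partial>lborel)"
    using \<Phi>_meas by (subst lborel.nn_integral_fst[symmetric]) auto
  also have "\<dots> = (\<integral>\<^sup>+x. ennreal \<bar>u x\<bar> * En k (\<lambda>y. ennreal \<bar>F y\<bar>) x \<partial>lborel)"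
  proof (intro nn_integral_cong)
    fix x
    have "(\<integral>\<^sup>+y. ennreal (norm (\<Phi> x y)) \<partial>lborel)
       = (\<integral>\<^sup>+y. ennreal (\<bar>u x\<bar> / vol k) * (ennreal \<bar>F y\<bar> * indicator (cell k x) y) \<partial>lborel)"
      using vol_pos[of k] unfolding \<Phi>_def
      by (intro nn_integral_cong)
         (simp add: abs_mult ennreal_mult'[symmetric] ennreal_indicator[symmetric] field_simps del: ennreal_indicator split: split_indicator)
    also have "\<dots> = ennreal \<bar>u x\<bar> * En k (\<lambda>y. ennreal \<bar>F y\<bar>) x"
      unfolding En_def using vol_pos[of k]
      by (subst nn_integral_cmult) (auto simp: mult.assoc[symmetric] ennreal_mult'[symmetric])
    finally show "(\<integral>\<^sup>+y. ennreal (norm (\<Phi> x y)) \<partial>lborel) = ennreal \<bar>u x\<bar> * En k (\<lambda>y. ennreal \<bar>F y\<bar>) x" .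
  qed
  also have "\<dots> = (\<integral>\<^sup>+x. ennreal \<bar>u x\<bar> * ennreal \<bar>F x\<bar> \<partial>lborel)"
    by (rule nn_integral_En) (use ad in \<open>auto simp: adapted_def\<close>)
  also have "\<dots> < \<infinity>"
    using int by (simp add: integrable_iff_bounded abs_mult ennreal_mult)
  finally have \<Phi>_int: "integrable (lborel \<Otimes>\<^sub>M lborel) (\<lambda>(x, y). \<Phi> x y)"
    using \<Phi>_meas by (intro integrableI_bounded) auto
  have fst: "(\<integral>y. \<Phi> x y \<partial>lborel) = u x * avg k F x" for x
    unfolding \<Phi>_def avg_def set_lebesgue_integral_def by (simp add: mult.commute)
  have snd: "(\<integral>x. \<Phi> x y \<partial>lborel) = u y * F y" for y
  proof -
    have "(\<integral>x. \<Phi> x y \<partial>lborel) = (\<integral>x. (u y * F y / vol k) * indicator (cell k y) x \<partial>lborel)"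
    proof (intro Bochner_Integration.integral_cong refl)
      fix x
      have "u x = u y" if "y \<in> cell k x" using adaptedD[OF ad that] by simp
      then show "\<Phi> x y = (u y * F y / vol k) * indicator (cell k y) x"
        unfolding \<Phi>_def indicator_cell_sym[of k y x] by (cases "y \<in> cell k x") auto
    qed
    also have "\<dots> = u y * F y"
      using vol_pos[of k] by (simp add: measure_def cell_emeasure)
    finally show ?thesis .
  qed
  show "integrable lborel (\<lambda>x. u x * avg k F x)"
    using lborel_pair.integrable_fst'[OF \<Phi>_int] fst by simp
  show "(\<integral>x. u x * avg k F x \<partial>lborel) = (\<integral>x. u x * F x \<partial>lborel)"
    using lborel_pair.Fubini_integral[OF \<Phi>_int] fst snd by simp
qed

definition cellint :: "('a \<Rightarrow> real) \<Rightarrow> bool" where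
  "cellint F \<longleftrightarrow> F \<in> borel_measurable borel \<and> (\<forall>x. set_integrable lborel (cell 0 x) F)"

lemma cellint_measurable: "cellint F \<Longrightarrow> F \<in> borel_measurable borel"
  by (simp add: cellint_def)

lemma cellint_set: "cellint F \<Longrightarrow> set_integrable lborel (cell i x) F"
  unfolding cellint_def using cell_mono[of 0 i x]
  by (auto intro: set_integrable_subset)

lemma cellint_bounded_mult:
  assumes F: "cellint F" and [measurable]: "v \<in> borel_measurable borel"
    and bd: "\<And>y. y \<in> cell i x \<Longrightarrow> \<bar>v y\<bar> \<le> B"
  shows "set_integrable lborel (cell i x) (\<lambda>y. v y * F y)"
proof -
  have [measurable]: "F \<in> borel_measurable borel" using F by (rule cellint_measurable)
  have "set_integrable lborel (cell i x) (\<lambda>y. B * F y)"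
    using cellint_set[OF F] by simp
  then show ?thesis
    unfolding set_integrable_def
  proof (rule Bochner_Integration.integrable_bound)
    show "AE y in lborel. norm (indicator (cell i x) y *\<^sub>R (v y * F y)) \<le> norm (indicator (cell i x) y *\<^sub>R (B * F y))"
    proof (intro AE_I2)
      fix y
      have "\<bar>v y\<bar> * \<bar>F y\<bar> \<le> \<bar>B\<bar> * \<bar>F y\<bar>" if "y \<in> cell i x"
        using bd[OF that] by (intro mult_right_mono) auto
      then show "norm (indicator (cell i x) y *\<^sub>R (v y * F y)) \<le> norm (indicator (cell i x) y *\<^sub>R (B * F y))"
        by (auto simp: indicator_def abs_mult)
    qed
  qed measurable
qed

lemma bounded_set_integrable:
  fixes v :: "'a \<Rightarrow> real"
  assumes "v \<in> borel_measurable borel" "\<And>y. y \<in> cell i x \<Longrightarrow> \<bar>v y\<bar> \<le> B"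
  shows "set_integrable lborel (cell i x) v"
proof -
  have "cellint (\<lambda>_. 1)"
    unfolding cellint_def set_integrable_def by (auto simp: cell_emeasure)
  from cellint_bounded_mult[OF this assms] show ?thesis by simp
qed

lemma measure_cell: "measure lborel (cell i x) = vol i"
  using vol_pos[of i] by (simp add: measure_def cell_emeasure)

lemma set_integral_const_cell: "(LBINT y:cell i x. (c::real)) = c * vol i"
  by (simp add: set_lebesgue_integral_def measure_cell)

text \<open>The indicator of a cell is adapted to all finer levels, so it can be absorbed into the
  multiplier and self-adjointness localises to one cell.\<close>

lemma set_integral_avg:
  assumes F: "cellint F" and "i \<le> k" and ad: "adapted k v"
    and bd: "\<And>y. y \<in> cell i x \<Longrightarrow> \<bar>v y\<bar> \<le> B"
  shows "set_integrable lborel (cell i x) (\<lambda>y. v y * avg k F y)"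
    and "(LBINT y:cell i x. v y * avg k F y) = (LBINT y:cell i x. v y * F y)"
proof -
  have ad': "adapted k (\<lambda>y. indicator (cell i x) y * v y)"
    using adaptedD[OF adapted_indicator[OF \<open>i \<le> k\<close>, of x, where 'b = real]] adaptedD[OF ad]
    unfolding adapted_def by presburger
  have int: "integrable lborel (\<lambda>y. (indicator (cell i x) y * v y) * F y)"
    using cellint_bounded_mult[OF F adapted_borel[OF ad] bd]
    by (simp add: set_integrable_def mult.assoc)
  note * = avg_selfadjoint[OF cellint_measurable[OF F] ad' int]
  show "set_integrable lborel (cell i x) (\<lambda>y. v y * avg k F y)"
    using *(1) by (simp add: set_integrable_def mult.assoc)
  show "(LBINT y:cell i x. v y * avg k F y) = (LBINT y:cell i x. v y * F y)"
    using *(2) by (simp add: set_lebesgue_integral_def mult.assoc)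
qed

lemma cellint_avg: "cellint F \<Longrightarrow> cellint (avg k F)"
  unfolding cellint_def
  using set_integral_avg(1)[of F 0 k "\<lambda>_. 1" _ 1]
  by (auto simp: adapted_def cellint_def)

lemma avg_tower: "cellint F \<Longrightarrow> i \<le> k \<Longrightarrow> avg i (avg k F) x = avg i F x"
  using set_integral_avg(2)[of F i k "\<lambda>_. 1" x 1] by (simp add: avg_def adapted_def)

lemma cellint_abs: "cellint F \<Longrightarrow> cellint (\<lambda>y. \<bar>F y\<bar>)"
  unfolding cellint_def using set_integrable_abs[of lborel] by auto

lemma avg_nonneg: "(\<And>y. 0 \<le> F y) \<Longrightarrow> 0 \<le> avg i F x"
  unfolding avg_def using vol_pos[of i] by (simp add: set_lebesgue_integral_def)

lemma abs_set_integral_le: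
  fixes F :: "'a \<Rightarrow> real"
  shows "\<bar>LBINT y:Q. F y\<bar> \<le> (LBINT y:Q. \<bar>F y\<bar>)"
proof -
  have "\<bar>LBINT y:Q. F y\<bar> \<le> (LINT y|lborel. \<bar>indicator Q y *\<^sub>R F y\<bar>)"
    unfolding set_lebesgue_integral_def by (rule integral_abs_bound)
  then show ?thesis by (simp add: set_lebesgue_integral_def abs_mult)
qed

lemma abs_avg_le: "\<bar>avg i F x\<bar> \<le> avg i (\<lambda>y. \<bar>F y\<bar>) x"
  unfolding avg_def using vol_pos[of i] abs_set_integral_le[of "cell i x" F]
  by (simp add: abs_divide divide_right_mono)

text \<open>Jensen's inequality for the square, read off from the nonnegative variance of q on the
  cell.\<close>

lemma avg_square:
  assumes "q \<in> borel_measurable borel" "\<And>y. y \<in> cell i x \<Longrightarrow> \<bar>q y\<bar> \<le> B"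
  shows "(avg i q x)^2 \<le> avg i (\<lambda>y. (q y)^2) x"
proof -
  define m where "m = avg i q x"
  have [measurable]: "q \<in> borel_measurable borel" by fact
  have i1: "set_integrable lborel (cell i x) q" by (rule bounded_set_integrable) fact+
  have i2: "set_integrable lborel (cell i x) (\<lambda>y. (q y)^2)"
  proof (rule bounded_set_integrable)
    show "\<bar>(q y)^2\<bar> \<le> B^2" if "y \<in> cell i x" for y
      using power_mono[OF assms(2)[OF that], of 2] by simp
  qed measurable
  have i3: "set_integrable lborel (cell i x) (\<lambda>y. c :: real)" for c
    by (rule bounded_set_integrable[of _ _ _ "\<bar>c\<bar>"]) auto
  have "0 \<le> (LBINT y:cell i x. (q y - m)^2)"
    by (simp add: set_lebesgue_integral_def)
  also have "\<dots> = (LBINT y:cell i x. (q y)^2 + (- 2 * m) * q y + m^2)"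
    by (simp add: power2_eq_square algebra_simps)
  also have "\<dots> = (LBINT y:cell i x. (q y)^2) + (-2 * m) * (LBINT y:cell i x. q y) + m^2 * vol i"
    using i1 i2 i3 by (simp add: set_integral_add set_integral_const_cell)
  also have "(LBINT y:cell i x. q y) = m * vol i"
    using vol_pos[of i] by (simp add: m_def avg_def)
  finally have "m^2 * vol i \<le> (LBINT y:cell i x. (q y)^2)"
    by (simp add: power2_eq_square)
  then show ?thesis
    using vol_pos[of i] unfolding m_def[symmetric] by (simp add: avg_def field_simps)
qed

lemma avg_Suc_le:
  assumes "cellint F" "\<And>y. 0 \<le> F y"
  shows "avg (Suc i) F x \<le> 2 ^ DIM('a) * avg i F x"
proof -
  have "(LBINT y:cell (Suc i) x. F y) \<le> (LBINT y:cell i x. F y)"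
    unfolding set_lebesgue_integral_def
    using assms cell_Suc[of i x] cellint_set[OF assms(1)]
    by (intro integral_mono) (auto simp: set_integrable_def indicator_def)
  then show ?thesis
    using vol_pos[of "Suc i"] vol_Suc[of i] by (simp add: avg_def field_simps)
qed

lemma En_eq_avg:
  assumes F: "cellint F" and nn: "\<And>y. 0 \<le> F y"
  shows "En i (\<lambda>y. ennreal (F y)) x = ennreal (avg i F x)"
proof -
  have "(\<integral>\<^sup>+y. ennreal (F y) * indicator (cell i x) y \<partial>lborel) = (\<integral>\<^sup>+y. ennreal (indicator (cell i x) y *\<^sub>R F y) \<partial>lborel)"
    by (intro nn_integral_cong) (simp add: indicator_def)
  also have "\<dots> = ennreal (LBINT y:cell i x. F y)"
    unfolding set_lebesgue_integral_def
    using cellint_set[OF F, of i x] nn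
    by (intro nn_integral_eq_integral) (auto simp: set_integrable_def)
  finally show ?thesis
    unfolding En_def avg_def using vol_pos[of i] nn
    by (simp add: ennreal_mult[symmetric] set_lebesgue_integral_def)
qed

end

section \<open>Pairings with Hoelder test functions\<close>

text \<open>Supplies measurability for test functions, whose definition contains a Hoelder bound but
  no measurability.\<close>

lemma Hoelder_borel_measurable:
  fixes \<phi> :: "'a::euclidean_space \<Rightarrow> real"
  assumes h: "\<And>y z. \<bar>\<phi> y - \<phi> z\<bar> \<le> L * dist y z powr \<alpha>" and "\<alpha> > 0"
  shows "\<phi> \<in> borel_measurable borel"
proof (rule borel_measurable_continuous_onI, unfold continuous_on_iff, intro ballI allI impI)
  fix y :: 'a and e :: real assume e: "e > 0"
  \<comment> \<open>Chosen so that (|L| + 1) d^\<alpha> = e; the added 1 covers L = 0.\<close>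
  define d where "d = (e / (\<bar>L\<bar> + 1)) powr (1 / \<alpha>)"
  have "d > 0" unfolding d_def using e by (intro powr_gt_zero[THEN iffD2]) (auto intro!: less_imp_neq[THEN not_sym] divide_pos_pos)
  moreover have "dist (\<phi> z) (\<phi> y) < e" if "dist z y < d" for z
  proof -
    have "dist z y powr \<alpha> < d powr \<alpha>"
      using that \<open>\<alpha> > 0\<close> by (intro powr_less_mono2) auto
    also have "d powr \<alpha> = e / (\<bar>L\<bar> + 1)"
      unfolding d_def powr_powr using \<open>\<alpha> > 0\<close> e by simp
    finally have *: "(\<bar>L\<bar> + 1) * dist z y powr \<alpha> < e"
      by (simp add: field_simps add_pos_nonneg)
    have "\<bar>\<phi> z - \<phi> y\<bar> \<le> L * dist z y powr \<alpha>" by (rule h)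
    also have "\<dots> \<le> (\<bar>L\<bar> + 1) * dist z y powr \<alpha>" by (intro mult_right_mono) auto
    finally show ?thesis using * by (simp add: dist_real_def)
  qed
  ultimately show "\<exists>d>0. \<forall>x'\<in>UNIV. dist x' y < d \<longrightarrow> dist (\<phi> x') (\<phi> y) < e" by blast
qed

lemma sum_power_inj_le:
  fixes \<theta> :: real
  assumes "0 \<le> \<theta>" "\<theta> < 1" "finite S" "inj_on g S"
  shows "(\<Sum>s\<in>S. \<theta> ^ g s) \<le> 1 / (1 - \<theta>)"
proof -
  have "(\<Sum>s\<in>S. \<theta> ^ g s) = (\<Sum>k\<in>g ` S. \<theta> ^ k)"
    using assms by (simp add: sum.reindex)
  also have "\<dots> \<le> (\<Sum>k. \<theta> ^ k)"
    using assms by (intro sum_le_suminf summable_geometric) auto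
  also have "\<dots> = 1 / (1 - \<theta>)"
    using assms by (simp add: suminf_geometric)
  finally show ?thesis .
qed

lemma weighted_sum_square:
  fixes a b :: "'i \<Rightarrow> real"
  assumes "\<And>l. l \<in> S \<Longrightarrow> 0 \<le> a l"
  shows "(\<Sum>l\<in>S. a l * b l)^2 \<le> (\<Sum>l\<in>S. a l) * (\<Sum>l\<in>S. a l * (b l)^2)"
proof -
  have "(\<Sum>l\<in>S. a l * b l)^2 = (\<Sum>l\<in>S. sqrt (a l) * (sqrt (a l) * b l))^2"
    using assms by (simp add: mult.assoc[symmetric])
  also have "\<dots> \<le> (\<Sum>l\<in>S. (sqrt (a l))^2) * (\<Sum>l\<in>S. (sqrt (a l) * b l)^2)"
    by (rule Cauchy_Schwarz_ineq_sum)
  also have "\<dots> = (\<Sum>l\<in>S. a l) * (\<Sum>l\<in>S. a l * (b l)^2)"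
    using assms by (simp add: power_mult_distrib)
  finally show ?thesis .
qed

section \<open>Test functions on cells and their pairings with f\<close>

locale grid_pairing = grid cell r for cell :: "nat \<Rightarrow> 'a::euclidean_space \<Rightarrow> 'a set" and r :: real +
  fixes f :: "'a \<Rightarrow> real" and \<alpha> H :: real
  assumes f: "cellint f" and \<alpha>_pos: "\<alpha> > 0" and H_pos: "H > 0"
begin

text \<open>\<open>2 ^ i / r\<close> is the reciprocal side length of the cell. This power of it
  makes the class invariant under rescaling and forces the sup norm of a member to be of order
  \<open>1 / vol i\<close>, the L1 normalisation.\<close>

definition Phi :: "nat \<Rightarrow> 'a \<Rightarrow> ('a \<Rightarrow> real) set" where
  "Phi i x = {\<phi>. (\<forall>y. \<phi> y \<noteq> 0 \<longrightarrow> y \<in> cell i x) \<and> (\<integral>y. \<phi> y \<partial>lborel) = 0 \<and>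
     (\<forall>y z. \<bar>\<phi> y - \<phi> z\<bar> \<le> H * (2 ^ i / r) powr (real DIM('a) + \<alpha>) * dist y z powr \<alpha>)}"

definition psup :: "nat \<Rightarrow> 'a \<Rightarrow> real" where
  "psup i x = (SUP \<phi>\<in>Phi i x. \<bar>\<integral>y. f y * \<phi> y \<partial>lborel\<bar>)"

abbreviation mean :: "nat \<Rightarrow> 'a \<Rightarrow> real" where
  "mean i \<equiv> avg i (\<lambda>y. \<bar>f y\<bar>)"

text \<open>Hoelder bounds over distances of n and 2n side lengths, n being the dimension:
  \<open>c0\<close> measures the oscillation on a cell, \<open>c1\<close> the sup norm, and
  \<open>\<theta>\<close> is the gain for each halving of the scale.\<close>

definition c0 :: real where "c0 = H * real DIM('a) powr \<alpha>"
definition c1 :: real where "c1 = H * (2 * real DIM('a)) powr \<alpha>"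
definition \<theta> :: real where "\<theta> = 2 powr (- \<alpha>)"

lemma constants_pos: "c0 > 0" "c1 > 0" "0 < \<theta>" "\<theta> < 1"
  using H_pos \<alpha>_pos unfolding c0_def c1_def \<theta>_def
  by (auto intro!: mult_pos_pos simp: powr_less_one)

lemma zero_in_Phi: "(\<lambda>_. 0) \<in> Phi i x"
  using H_pos by (auto simp: Phi_def)

lemma Phi_measurable: "\<phi> \<in> Phi i x \<Longrightarrow> \<phi> \<in> borel_measurable borel"
  using \<alpha>_pos by (intro Hoelder_borel_measurable[where L = "H * (2 ^ i / r) powr (real DIM('a) + \<alpha>)" and \<alpha> = \<alpha>])
    (auto simp: Phi_def)

lemma scale_powr:
  assumes "c \<ge> 0"
  shows "H * (2 ^ i / r) powr (real DIM('a) + \<alpha>) * (c * (r / 2 ^ i)) powr \<alpha> = H * c powr \<alpha> / vol i"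
proof -
  let ?s = "2 ^ i / r"
  have s: "?s > 0" using r_pos by simp
  have "?s powr (real DIM('a) + \<alpha>) = ?s ^ DIM('a) * ?s powr \<alpha>"
    using s by (simp add: powr_add powr_realpow)
  moreover have "?s powr \<alpha> * (c * (r / 2 ^ i)) powr \<alpha> = c powr \<alpha>"
    using r_pos assms by (subst powr_mult[symmetric]) auto
  moreover have "?s ^ DIM('a) = 1 / vol i"
    using r_pos by (simp add: vol_def power_divide)
  ultimately show ?thesis by (simp add: mult_ac)
qed

lemma Phi_osc:
  assumes \<phi>: "\<phi> \<in> Phi i x" and "i \<le> k" "y \<in> cell k w" "z \<in> cell k w"
  shows "\<bar>\<phi> y - \<phi> z\<bar> \<le> c0 * \<theta> ^ (k - i) / vol i"
proof -
  let ?L = "H * (2 ^ i / r) powr (real DIM('a) + \<alpha>)"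
  define d where "d = k - i"
  have k: "k = d + i" using \<open>i \<le> k\<close> by (simp add: d_def)
  have "\<bar>\<phi> y - \<phi> z\<bar> \<le> ?L * dist y z powr \<alpha>" using \<phi> by (simp add: Phi_def)
  also have "\<dots> \<le> ?L * (real DIM('a) * (r / 2 ^ k)) powr \<alpha>"
    using cell_dist[OF assms(3,4)] H_pos \<alpha>_pos by (intro mult_left_mono powr_mono2) auto
  also have "real DIM('a) * (r / 2 ^ k) = (real DIM('a) / 2 ^ d) * (r / 2 ^ i)"
    by (simp add: k power_add)
  also have "?L * \<dots> powr \<alpha> = H * (real DIM('a) / 2 ^ d) powr \<alpha> / vol i"
    by (rule scale_powr) simp
  also have "(real DIM('a) / 2 ^ d) powr \<alpha> = real DIM('a) powr \<alpha> * \<theta> ^ d"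
  proof -
    have "(2 ^ d) powr \<alpha> = (2 powr \<alpha>) ^ d"
      by (simp add: powr_realpow[symmetric] powr_powr mult.commute)
    moreover have "(real DIM('a) / 2 ^ d) powr \<alpha> = real DIM('a) powr \<alpha> / (2 ^ d) powr \<alpha>"
      by (rule powr_divide)
    ultimately show ?thesis
      by (simp add: \<theta>_def powr_minus power_inverse divide_inverse)
  qed
  finally show ?thesis by (simp add: c0_def d_def mult_ac)
qed

text \<open>A point at distance 2n side lengths lies outside the cell, where \<phi> vanishes, so the
  Hoelder bound over this distance controls \<phi> itself.\<close>

lemma Phi_bound:
  assumes \<phi>: "\<phi> \<in> Phi i x"
  shows "\<bar>\<phi> y\<bar> \<le> c1 / vol i"
proof (cases "y \<in> cell i x")
  case False
  then have "\<phi> y = 0" using \<phi> by (auto simp: Phi_def)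
  then show ?thesis using constants_pos vol_pos[of i] by simp
next
  case True
  obtain b :: 'a where b: "b \<in> Basis" using nonempty_Basis by blast
  define t where "t = (2 * real DIM('a)) * (r / 2 ^ i)"
  have t: "real DIM('a) * (r / 2 ^ i) < t"
    using r_pos unfolding t_def by (intro mult_strict_right_mono) (auto simp: DIM_positive)
  then have t0: "t > 0" using r_pos by (smt (verit) of_nat_0_le_iff divide_nonneg_pos mult_nonneg_nonneg zero_less_power)
  have d: "dist y (y + t *\<^sub>R b) = t" using b t0 by (simp add: dist_norm)
  then have "y + t *\<^sub>R b \<notin> cell i x" using cell_dist[OF True] t by force
  then have "\<phi> (y + t *\<^sub>R b) = 0" using \<phi> by (auto simp: Phi_def)
  moreover have "\<bar>\<phi> y - \<phi> (y + t *\<^sub>R b)\<bar> \<le> H * (2 ^ i / r) powr (real DIM('a) + \<alpha>) * dist y (y + t *\<^sub>R b) powr \<alpha>"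
    using \<phi> unfolding Phi_def by blast
  ultimately show ?thesis
    using scale_powr[of "2 * real DIM('a)" i] unfolding d unfolding t_def c1_def by simp
qed

lemma pairing_set_integral:
  assumes "\<phi> \<in> Phi i x"
  shows "(\<integral>y. f y * \<phi> y \<partial>lborel) = (LBINT y:cell i x. \<phi> y * f y)"
  unfolding set_lebesgue_integral_def
  by (rule Bochner_Integration.integral_cong) (use assms in \<open>auto simp: Phi_def indicator_def\<close>)

lemma pairing_le:
  assumes \<phi>: "\<phi> \<in> Phi i x"
  shows "\<bar>\<integral>y. f y * \<phi> y \<partial>lborel\<bar> \<le> c1 * mean i x"
proof -
  have "\<bar>\<integral>y. f y * \<phi> y \<partial>lborel\<bar> \<le> (LBINT y:cell i x. \<bar>\<phi> y * f y\<bar>)"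
    unfolding pairing_set_integral[OF \<phi>] by (rule abs_set_integral_le)
  also have "\<dots> \<le> (LBINT y:cell i x. (c1 / vol i) * \<bar>f y\<bar>)"
  proof (rule set_integral_mono)
    show "set_integrable lborel (cell i x) (\<lambda>y. \<bar>\<phi> y * f y\<bar>)"
      by (rule set_integrable_abs[OF cellint_bounded_mult[OF f Phi_measurable[OF \<phi>] Phi_bound[OF \<phi>]]])
    show "set_integrable lborel (cell i x) (\<lambda>y. (c1 / vol i) * \<bar>f y\<bar>)"
      using cellint_set[OF cellint_abs[OF f]] by simp
    show "\<bar>\<phi> y * f y\<bar> \<le> c1 / vol i * \<bar>f y\<bar>" for y
      unfolding abs_mult by (intro mult_right_mono Phi_bound[OF \<phi>]) auto
  qed
  also have "\<dots> = c1 * mean i x" by (simp add: avg_def)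
  finally show ?thesis .
qed

lemma pairing_le_psup: "\<phi> \<in> Phi i x \<Longrightarrow> \<bar>\<integral>y. f y * \<phi> y \<partial>lborel\<bar> \<le> psup i x"
  unfolding psup_def by (rule cSUP_upper) (auto intro!: bdd_aboveI2 pairing_le)

lemma psup_least: "(\<And>\<phi>. \<phi> \<in> Phi i x \<Longrightarrow> \<bar>\<integral>y. f y * \<phi> y \<partial>lborel\<bar> \<le> C) \<Longrightarrow> psup i x \<le> C"
  unfolding psup_def using zero_in_Phi by (intro cSUP_least) auto

lemma psup_nonneg: "0 \<le> psup i x"
  using pairing_le_psup[OF zero_in_Phi] by simp

lemma psup_le: "psup i x \<le> c1 * mean i x"
  by (rule psup_least) (rule pairing_le)

lemma adapted_psup: "adapted i (psup i)"
  unfolding adapted_def psup_def Phi_def by (simp add: cell_eq)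

lemma psup_measurable [measurable]: "psup i \<in> borel_measurable borel"
  by (rule adapted_borel[OF adapted_psup])

lemma mean_nonneg: "0 \<le> mean i x"
  by (rule avg_nonneg) simp

lemma cellint_diff: "cellint F \<Longrightarrow> cellint G \<Longrightarrow> cellint (\<lambda>y. F y - G y)"
  by (auto simp: cellint_def)

text \<open>\<open>F - avg k F\<close> has mean zero on each level k cell and u is constant there.
  So \<phi> may be replaced by its difference from its value at the representative point, which is
  an oscillation at scale k.\<close>

lemma osc_pairing:
  assumes \<phi>: "\<phi> \<in> Phi i x" and ik: "i \<le> k" and F: "cellint F"
    and u: "adapted k u" and B: "\<And>y. \<bar>u y\<bar> \<le> B"
  shows "\<bar>LBINT y:cell i x. (u y * \<phi> y) * (F y - avg k F y)\<bar>
    \<le> c0 * \<theta> ^ (k - i) / vol i * (LBINT y:cell i x. \<bar>u y\<bar> * \<bar>F y - avg k F y\<bar>)"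
proof -
  let ?Q = "cell i x" and ?c = "c0 * \<theta> ^ (k - i) / vol i"
  define D where "D = (\<lambda>y. F y - avg k F y)"
  have D: "cellint D" unfolding D_def by (intro cellint_diff F cellint_avg)
  define \<psi> where "\<psi> y = \<phi> (rep k y)" for y
  have [measurable]: "\<phi> \<in> borel_measurable borel" "u \<in> borel_measurable borel"
    using Phi_measurable[OF \<phi>] adapted_borel[OF u] by auto
  have \<psi>_ad: "adapted k \<psi>" unfolding adapted_def \<psi>_def rep_def by (simp add: cell_eq)
  have [measurable]: "\<psi> \<in> borel_measurable borel" by (rule adapted_borel[OF \<psi>_ad])
  have u\<psi>_ad: "adapted k (\<lambda>y. u y * \<psi> y)" using u \<psi>_ad unfolding adapted_def by presburger
  have B0: "0 \<le> B" using B[of x] by simp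
  have bd1: "\<bar>u y * \<psi> y\<bar> \<le> B * (c1 / vol i)" for y
    unfolding abs_mult \<psi>_def using B0 by (intro mult_mono B Phi_bound[OF \<phi>]) auto
  have bd2: "\<bar>u y * \<phi> y\<bar> \<le> B * (c1 / vol i)" for y
    unfolding abs_mult using B0 by (intro mult_mono B Phi_bound[OF \<phi>]) auto
  have "(LBINT y:?Q. (u y * \<psi> y) * D y) =
    (LBINT y:?Q. (u y * \<psi> y) * F y) - (LBINT y:?Q. (u y * \<psi> y) * avg k F y)"
    unfolding D_def right_diff_distrib
    by (intro set_integral_diff cellint_bounded_mult[OF F _ bd1] set_integral_avg(1)[OF F ik u\<psi>_ad bd1]) measurable
  also have "\<dots> = 0"
    using set_integral_avg(2)[OF F ik u\<psi>_ad bd1] by simp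
  finally have z: "(LBINT y:?Q. (u y * \<psi> y) * D y) = 0" .
  have "(LBINT y:?Q. (u y * \<phi> y) * D y)
      = (LBINT y:?Q. (u y * \<phi> y) * D y) - (LBINT y:?Q. (u y * \<psi> y) * D y)"
    using z by simp
  also have "\<dots> = (LBINT y:?Q. (u y * \<phi> y) * D y - (u y * \<psi> y) * D y)"
    by (intro set_integral_diff(2)[symmetric] cellint_bounded_mult[OF D _ bd1] cellint_bounded_mult[OF D _ bd2]) measurable
  finally have eq: "(LBINT y:?Q. (u y * \<phi> y) * D y) = (LBINT y:?Q. (u y * \<phi> y) * D y - (u y * \<psi> y) * D y)" .
  have "\<bar>LBINT y:?Q. (u y * \<phi> y) * D y\<bar> \<le> (LBINT y:?Q. \<bar>(u y * \<phi> y) * D y - (u y * \<psi> y) * D y\<bar>)"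
    unfolding eq by (rule abs_set_integral_le)
  also have "\<dots> \<le> (LBINT y:?Q. ?c * (\<bar>u y\<bar> * \<bar>D y\<bar>))"
  proof (rule set_integral_mono)
    show "set_integrable lborel ?Q (\<lambda>y. \<bar>(u y * \<phi> y) * D y - (u y * \<psi> y) * D y\<bar>)"
      by (intro set_integrable_abs set_integral_diff(1) cellint_bounded_mult[OF D _ bd1] cellint_bounded_mult[OF D _ bd2]) measurable
    have "set_integrable lborel ?Q (\<lambda>y. \<bar>u y\<bar> * \<bar>D y\<bar>)"
      by (rule cellint_bounded_mult[OF cellint_abs[OF D], where B = B]) (use B in auto)
    then show "set_integrable lborel ?Q (\<lambda>y. ?c * (\<bar>u y\<bar> * \<bar>D y\<bar>))" by simp
    fix y assume "y \<in> ?Q"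
    have "(u y * \<phi> y) * D y - (u y * \<psi> y) * D y = (\<phi> y - \<psi> y) * (u y * D y)"
      by (simp add: algebra_simps)
    then have "\<bar>(u y * \<phi> y) * D y - (u y * \<psi> y) * D y\<bar> = \<bar>\<phi> y - \<psi> y\<bar> * (\<bar>u y\<bar> * \<bar>D y\<bar>)"
      by (simp add: abs_mult)
    also have "\<dots> \<le> ?c * (\<bar>u y\<bar> * \<bar>D y\<bar>)"
      unfolding \<psi>_def by (intro mult_right_mono Phi_osc[OF \<phi> ik cell_self rep_in]) auto
    finally show "\<bar>(u y * \<phi> y) * D y - (u y * \<psi> y) * D y\<bar> \<le> ?c * (\<bar>u y\<bar> * \<bar>D y\<bar>)" .
  qed
  also have "\<dots> = ?c * (LBINT y:?Q. \<bar>u y\<bar> * \<bar>D y\<bar>)" by simp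
  finally show ?thesis by (simp add: D_def)
qed

section \<open>Energy below a cell\<close>

text \<open>
  The stopping time below the cell of x0 at level j is the first level l > j at which the average
  of |f| exceeds 8 times the one over that cell: alive l y says that it has not occurred before l,
  halts l y that it equals l. It is forced to be at most T, so that f need only be compared with
  averages at finitely many levels and no differentiation theorem is used.
\<close>

context
  fixes j T :: nat and x0 :: 'a
begin

definition alive :: "nat \<Rightarrow> 'a \<Rightarrow> bool" where
  "alive l y \<longleftrightarrow> (\<forall>m. j < m \<and> m < l \<longrightarrow> mean m y \<le> 8 * mean j x0)"

definition halts :: "nat \<Rightarrow> 'a \<Rightarrow> bool" where
  "halts l y \<longleftrightarrow> alive l y \<and> (l = T \<or> 8 * mean j x0 < mean l y)"

text \<open>The average over a halting cell exceeds the threshold, unless the halt is forced, but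
  the average over its parent does not. Passing to a child costs at most the factor 2^n.\<close>

definition beta :: real where
  "beta = 8 * 2 ^ DIM('a) * mean j x0"

text \<open>The last term stands for \<open>f - avg l f\<close> on a halting cell. That function is
  controlled in L1 only, with average at most 2 \<open>beta\<close>; replacing it by the constant
  makes \<open>incr\<close> bounded below the cell of x0, hence square integrable.\<close>

definition incr :: "nat \<Rightarrow> 'a \<Rightarrow> real" where
  "incr l y = of_bool (alive l y) * \<bar>avg l f y - avg (l - 1) f y\<bar> + of_bool (halts l y) * (2 * beta)"

lemma alive_Suc: "j < l \<Longrightarrow> alive (Suc l) y \<longleftrightarrow> alive l y \<and> mean l y \<le> 8 * mean j x0"
  unfolding alive_def using less_Suc_eq by auto

lemma alive_antimono: "alive l y \<Longrightarrow> k \<le> l \<Longrightarrow> alive k y"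
  by (auto simp: alive_def)

text \<open>\<open>alive (Suc l)\<close> inspects levels up to l only. This predictability allows
  the martingale difference at level l + 1 to be tested against functions constant on level l
  cells.\<close>

lemma adapted_alive: "adapted l (alive (Suc l))"
proof -
  have "mean m y = mean m z" if "m \<le> l" "y \<in> cell l z" for m y z
    using adaptedD[OF adapted_mono[OF adapted_avg that(1)] that(2)] .
  then show ?thesis by (auto simp: adapted_def alive_def less_Suc_eq_le)
qed

lemma adapted_alive': "adapted l (alive l)"
proof (cases l)
  case 0
  then show ?thesis by (simp add: adapted_def alive_def)
next
  case (Suc k)
  then show ?thesis using adapted_mono[OF adapted_alive, of k l] by simp
qed

lemma adapted_halts: "adapted l (halts l)"
  using adaptedD[OF adapted_alive'] adaptedD[OF adapted_avg]
  unfolding adapted_def halts_def by metis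

lemma alive_measurable [measurable]: "Measurable.pred borel (alive l)"
  by (rule adapted_pred[OF adapted_alive'])

lemma halts_measurable [measurable]: "Measurable.pred borel (halts l)"
  by (rule adapted_pred[OF adapted_halts])

lemma incr_measurable [measurable]: "incr l \<in> borel_measurable borel"
  unfolding incr_def by measurable

lemma mean_alive:
  assumes "y \<in> cell j x0" "j \<le> l" "alive (Suc l) y"
  shows "mean l y \<le> 8 * mean j x0"
proof (cases "l = j")
  case True
  then show ?thesis using adaptedD[OF adapted_avg assms(1)] mean_nonneg[of j x0] by simp
next
  case False
  then show ?thesis using assms alive_Suc by auto
qed

lemma mean_beta:
  assumes "y \<in> cell j x0" "j < l" "alive l y"
  shows "mean l y \<le> beta"
proof -
  obtain k where k: "l = Suc k" "j \<le> k" using assms(2) by (cases l) auto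
  have "mean l y \<le> 2 ^ DIM('a) * mean k y"
    unfolding k by (rule avg_Suc_le[OF cellint_abs[OF f]]) auto
  also have "\<dots> \<le> 2 ^ DIM('a) * (8 * mean j x0)"
    using mean_alive[OF assms(1) k(2)] assms(3) k by (intro mult_left_mono) auto
  finally show ?thesis by (simp add: beta_def)
qed

lemma beta_ge: "8 * mean j x0 \<le> beta"
proof -
  have "1 * (8 * mean j x0) \<le> 2 ^ DIM('a) * (8 * mean j x0)"
    using mean_nonneg[of j x0] by (intro mult_right_mono) auto
  then show ?thesis by (simp add: beta_def)
qed

lemma beta_nonneg: "0 \<le> beta"
  using mean_nonneg[of j x0] by (simp add: beta_def)

lemma diff_bound:
  assumes "y \<in> cell j x0" "j < l"
  shows "\<bar>of_bool (alive l y) * (avg l f y - avg (l - 1) f y)\<bar> \<le> 2 * beta"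
proof (cases "alive l y")
  case True
  obtain k where k: "l = Suc k" "j \<le> k" using assms(2) by (cases l) auto
  have "\<bar>avg l f y\<bar> \<le> beta"
    using abs_avg_le[of l f y] mean_beta[OF assms True] by linarith
  moreover have "\<bar>avg k f y\<bar> \<le> beta"
    using abs_avg_le[of k f y] mean_alive[OF assms(1) k(2)] True beta_ge unfolding k by linarith
  ultimately show ?thesis using True k by simp
qed (use beta_nonneg in simp)

lemma incr_bound:
  assumes "y \<in> cell j x0" "j < l"
  shows "\<bar>incr l y\<bar> \<le> 4 * beta"
  using diff_bound[OF assms] beta_nonneg by (auto simp: incr_def)

lemma incr_nonneg: "0 \<le> incr l y"
  using beta_nonneg by (simp add: incr_def)

text \<open>The martingale expansion of f, stopped at the halting level. The forced halt at T closes
  it with a finite sum and an exact remainder.\<close>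

lemma decomposition:
  assumes "j \<le> i" "i < T" "alive (Suc i) y"
  shows "f y = avg i f y + (\<Sum>l=Suc i..T. of_bool (alive l y) * (avg l f y - avg (l - 1) f y))
      + (\<Sum>l=Suc i..T. of_bool (halts l y) * (f y - avg l f y))"
proof -
  \<comment> \<open>Cut at L, the expansion leaves the remainder \<open>f - avg L f\<close> where y
    is alive past L. At the next level this splits off one martingale difference, and the rest
    either halts or is carried on.\<close>
  have *: "L < T \<Longrightarrow> f y = avg i f y + (\<Sum>l=Suc i..L. of_bool (alive l y) * (avg l f y - avg (l - 1) f y))
      + (\<Sum>l=Suc i..L. of_bool (halts l y) * (f y - avg l f y))
      + of_bool (alive (Suc L) y) * (f y - avg L f y)" if "i \<le> L" for L
    using that
  proof (induction L rule: dec_induct)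
    case base
    then show ?case using assms by simp
  next
    case (step L)
    have halts: "halts (Suc L) y \<longleftrightarrow> alive (Suc L) y \<and> \<not> alive (Suc (Suc L)) y"
      using step assms(1) alive_Suc[of "Suc L" y] by (auto simp: halts_def)
    have mono: "alive (Suc (Suc L)) y \<Longrightarrow> alive (Suc L) y"
      by (erule alive_antimono) simp
    show ?case
      using step by (cases "alive (Suc (Suc L)) y") (auto simp: halts mono algebra_simps)
  qed
  obtain S where S: "T = Suc S" "i \<le> S" using assms(2) by (cases T) auto
  have fT: "halts T y = alive T y" by (simp add: halts_def)
  have split: "(\<Sum>l=Suc i..T. g l) = (\<Sum>l=Suc i..S. g l) + g T" for g :: "nat \<Rightarrow> real"
    using S by simp
  have "f y = avg i f y + (\<Sum>l=Suc i..S. of_bool (alive l y) * (avg l f y - avg (l - 1) f y))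
      + (\<Sum>l=Suc i..S. of_bool (halts l y) * (f y - avg l f y))
      + of_bool (alive T y) * (f y - avg (T - 1) f y)"
    using *[OF S(2)] S by simp
  then show ?thesis
    unfolding split fT by (simp add: algebra_simps)
qed

text \<open>Pair \<phi> with the expansion. The first term drops out because \<phi> has mean zero;
  every other term has mean zero on small cells, so \<open>osc_pairing\<close> gains a power of
  \<theta>.\<close>

lemma psup_le_sum:
  assumes x: "x \<in> cell j x0" and "j \<le> i" "i < T" and on: "alive (Suc i) x"
  shows "psup i x \<le> c0 / \<theta> * (\<Sum>l=Suc i..T. \<theta> ^ (l - i) * avg i (incr l) x)"
proof (rule psup_least)
  fix \<phi> assume \<phi>: "\<phi> \<in> Phi i x"
  let ?Q = "cell i x"
  have [measurable]: "\<phi> \<in> borel_measurable borel" by (rule Phi_measurable[OF \<phi>])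
  have Q: "?Q \<subseteq> cell j x0"
    using cell_mono[OF \<open>j \<le> i\<close>] x cell_eq by metis
  have onQ: "alive (Suc i) y" if "y \<in> ?Q" for y
    using adaptedD[OF adapted_alive that] on by simp
  define D where "D l y = of_bool (alive l y) * \<phi> y * (avg l f y - avg (l - 1) f y)" for l y
  define E where "E l y = of_bool (halts l y) * \<phi> y * (f y - avg l f y)" for l y
  have Dint: "set_integrable lborel ?Q (D l)" for l
    unfolding D_def
    by (rule cellint_bounded_mult[where B = "c1 / vol i"])
       (use cellint_diff[OF cellint_avg[OF f] cellint_avg[OF f]] Phi_bound[OF \<phi>] constants_pos vol_pos[of i] in \<open>auto simp: abs_mult\<close>)
  have Eint: "set_integrable lborel ?Q (E l)" for l
    unfolding E_def
    by (rule cellint_bounded_mult[where B = "c1 / vol i"])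
       (use cellint_diff[OF f cellint_avg[OF f]] Phi_bound[OF \<phi>] constants_pos vol_pos[of i] in \<open>auto simp: abs_mult\<close>)
  have \<phi>0: "(LBINT y:?Q. \<phi> y) = 0"
  proof -
    have "(LBINT y:?Q. \<phi> y) = (\<integral>y. \<phi> y \<partial>lborel)"
      unfolding set_lebesgue_integral_def
      by (rule Bochner_Integration.integral_cong) (use \<phi> in \<open>auto simp: Phi_def indicator_def\<close>)
    then show ?thesis using \<phi> by (simp add: Phi_def)
  qed
  have \<phi>int: "set_integrable lborel ?Q (\<lambda>y. avg i f x * \<phi> y)"
    by (rule set_integrable_mult_right) (rule bounded_set_integrable[OF Phi_measurable[OF \<phi>] Phi_bound[OF \<phi>]])
  have "(\<integral>y. f y * \<phi> y \<partial>lborel) = (LBINT y:?Q. \<phi> y * f y)"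
    by (rule pairing_set_integral[OF \<phi>])
  also have "\<dots> = (LBINT y:?Q. avg i f x * \<phi> y + (\<Sum>l=Suc i..T. D l y + E l y))"
  proof (rule set_lebesgue_integral_cong)
    show "\<forall>y. y \<in> ?Q \<longrightarrow> \<phi> y * f y = avg i f x * \<phi> y + (\<Sum>l=Suc i..T. D l y + E l y)"
    proof (intro allI impI)
      fix y assume y: "y \<in> ?Q"
      have av: "avg i f y = avg i f x" by (rule adaptedD[OF adapted_avg y])
      show "\<phi> y * f y = avg i f x * \<phi> y + (\<Sum>l=Suc i..T. D l y + E l y)"
        by (subst decomposition[OF \<open>j \<le> i\<close> \<open>i < T\<close> onQ[OF y]])
           (simp only: D_def E_def av distrib_left sum.distrib sum_distrib_left mult.commute mult.left_commute mult.assoc add.assoc)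
    qed
  qed simp
  also have "\<dots> = (\<Sum>l=Suc i..T. (LBINT y:?Q. D l y) + (LBINT y:?Q. E l y))"
  proof -
    have i: "set_integrable lborel ?Q (\<lambda>y. \<Sum>l=Suc i..T. D l y + E l y)"
      by (intro set_integrable_sum set_integral_add(1) Dint Eint)
    have s: "(LBINT y:?Q. \<Sum>l=Suc i..T. D l y + E l y) = (\<Sum>l=Suc i..T. (LBINT y:?Q. D l y + E l y))"
      by (intro set_integral_sum set_integral_add(1) Dint Eint)
    show ?thesis
      by (subst set_integral_add(2)[OF \<phi>int i]) (simp add: \<phi>0 s set_integral_add(2)[OF Dint Eint])
  qed
  finally have eq: "(\<integral>y. f y * \<phi> y \<partial>lborel) = (\<Sum>l=Suc i..T. (LBINT y:?Q. D l y) + (LBINT y:?Q. E l y))" .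
  have est: "\<bar>(LBINT y:?Q. D l y) + (LBINT y:?Q. E l y)\<bar> \<le> c0 / \<theta> * (\<theta> ^ (l - i) * avg i (incr l) x)"
    if l: "l \<in> {Suc i..T}" for l
  proof -
    obtain k where k: "l = Suc k" "i \<le> k" using l by (cases l) auto
    have jl: "j < l" "i \<le> l" using l \<open>j \<le> i\<close> by auto
    let ?d = "\<lambda>y. of_bool (alive l y) * \<bar>avg l f y - avg (l - 1) f y\<bar>"
    let ?e = "\<lambda>y. of_bool (halts l y) * \<bar>f y - avg l f y\<bar>"
    let ?c = "c0 / \<theta> * \<theta> ^ (l - i) / vol i"
    have cpos: "0 \<le> ?c" using constants_pos vol_pos[of i] by simp
    have tow: "avg k (avg l f) = avg k f" using avg_tower[OF f, of k l] k by (intro ext) simp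
    have ad_on: "adapted k (\<lambda>y. of_bool (alive l y) :: real)"
      using adapted_alive[of k] k by (simp add: adapted_def)
    have ad_halts: "adapted l (\<lambda>y. of_bool (halts l y) :: real)"
      using adapted_halts[of l] by (simp add: adapted_def)
    \<comment> \<open>The difference of levels l and l - 1 has mean zero only on cells of level l -
      1, so one power of \<theta> is lost. This is the origin of
      \<open>c0 / \<theta>\<close>.\<close>
    have th: "c0 * \<theta> ^ (k - i) = c0 / \<theta> * \<theta> ^ (l - i)"
      using constants_pos k by (simp add: Suc_diff_le)
    have th': "c0 * \<theta> ^ (l - i) \<le> c0 / \<theta> * \<theta> ^ (l - i)"
      using constants_pos by (intro mult_right_mono) (auto simp: field_simps)
    have d_int: "set_integrable lborel ?Q ?d"
      using diff_bound[of _ l] Q jl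
      by (intro bounded_set_integrable[where B = "2 * beta"]) (auto simp: abs_mult subset_iff)
    have e_int: "set_integrable lborel ?Q ?e"
      by (rule cellint_bounded_mult[OF cellint_abs[OF cellint_diff[OF f cellint_avg[OF f]]], where B = 1]) auto
    have f_int: "set_integrable lborel ?Q (\<lambda>y. of_bool (halts l y) * (2 * beta))"
      using beta_nonneg by (intro bounded_set_integrable[where B = "2 * beta"]) auto
    \<comment> \<open>Halting at l is decided by level l cells, so |f| may be exchanged for its
      average there, which \<open>mean_beta\<close> bounds; |avg l f| obeys the same bound, and the
      two add up to 2 \<open>beta\<close>.\<close>
    have ei: "(LBINT y:?Q. ?e y) \<le> (LBINT y:?Q. of_bool (halts l y) * (2 * beta))"
    proof -
      have "(LBINT y:?Q. ?e y) \<le> (LBINT y:?Q. of_bool (halts l y) * \<bar>f y\<bar> + of_bool (halts l y) * mean l y)"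
      proof (rule set_integral_mono[OF e_int])
        show "set_integrable lborel ?Q (\<lambda>y. of_bool (halts l y) * \<bar>f y\<bar> + of_bool (halts l y) * mean l y)"
          by (intro set_integral_add(1) cellint_bounded_mult[OF cellint_abs[OF f], where B = 1]
              cellint_bounded_mult[OF cellint_avg[OF cellint_abs[OF f]], where B = 1]) auto
        show "?e y \<le> of_bool (halts l y) * \<bar>f y\<bar> + of_bool (halts l y) * mean l y" for y
          using abs_avg_le[of l f y] by (cases "halts l y") auto
      qed
      also have "\<dots> = (LBINT y:?Q. of_bool (halts l y) * \<bar>f y\<bar>) + (LBINT y:?Q. of_bool (halts l y) * mean l y)"
        by (intro set_integral_add(2) cellint_bounded_mult[OF cellint_abs[OF f], where B = 1]
              cellint_bounded_mult[OF cellint_avg[OF cellint_abs[OF f]], where B = 1]) auto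
      finally have e1: "(LBINT y:?Q. ?e y) \<le> (LBINT y:?Q. of_bool (halts l y) * \<bar>f y\<bar>) + (LBINT y:?Q. of_bool (halts l y) * mean l y)" .
      have e2: "(LBINT y:?Q. of_bool (halts l y) * \<bar>f y\<bar>) = (LBINT y:?Q. of_bool (halts l y) * mean l y)"
        by (rule set_integral_avg(2)[OF cellint_abs[OF f] jl(2) ad_halts, where B = 1, symmetric]) auto
      have e3: "(LBINT y:?Q. of_bool (halts l y) * mean l y) \<le> (LBINT y:?Q. of_bool (halts l y) * beta)"
      proof (rule set_integral_mono)
        show "set_integrable lborel ?Q (\<lambda>y. of_bool (halts l y) * mean l y)"
          by (rule cellint_bounded_mult[OF cellint_avg[OF cellint_abs[OF f]], where B = 1]) auto
        show "set_integrable lborel ?Q (\<lambda>y. of_bool (halts l y) * beta)"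
          using beta_nonneg by (intro bounded_set_integrable[where B = beta]) auto
        show "of_bool (halts l y) * mean l y \<le> of_bool (halts l y) * beta" if "y \<in> ?Q" for y
          using mean_beta[OF _ jl(1), of y] Q that by (auto simp: halts_def)
      qed
      have e4: "(LBINT y:?Q. of_bool (halts l y) * (2 * beta)) = 2 * (LBINT y:?Q. of_bool (halts l y) * beta)"
        by (simp only: set_integral_mult_right[symmetric] mult.left_commute[of 2])
      show ?thesis using e1 e2 e3 e4 by linarith
    qed
    have "\<bar>LBINT y:?Q. D l y\<bar> \<le> ?c * (LBINT y:?Q. ?d y)"
      using osc_pairing[OF \<phi> k(2) cellint_avg[OF f, of l] ad_on, of 1]
      unfolding D_def th tow using k by simp
    moreover have "\<bar>LBINT y:?Q. E l y\<bar> \<le> ?c * (LBINT y:?Q. of_bool (halts l y) * (2 * beta))"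
    proof -
      have "\<bar>LBINT y:?Q. E l y\<bar> \<le> c0 * \<theta> ^ (l - i) / vol i * (LBINT y:?Q. ?e y)"
        using osc_pairing[OF \<phi> jl(2) f ad_halts, of 1] unfolding E_def by simp
      also have "\<dots> \<le> ?c * (LBINT y:?Q. ?e y)"
      proof (rule mult_right_mono)
        show "c0 * \<theta> ^ (l - i) / vol i \<le> ?c"
          using th' vol_pos[of i] by (intro divide_right_mono) auto
      qed (simp add: set_lebesgue_integral_def)
      also have "\<dots> \<le> ?c * (LBINT y:?Q. of_bool (halts l y) * (2 * beta))"
        by (rule mult_left_mono[OF ei cpos])
      finally show ?thesis .
    qed
    ultimately have "\<bar>(LBINT y:?Q. D l y) + (LBINT y:?Q. E l y)\<bar>
      \<le> ?c * ((LBINT y:?Q. ?d y) + (LBINT y:?Q. of_bool (halts l y) * (2 * beta)))"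
      by (simp only: distrib_left)
    also have "\<dots> = ?c * (LBINT y:?Q. incr l y)"
      unfolding incr_def using set_integral_add(2)[OF d_int f_int] by simp
    finally show ?thesis by (simp add: avg_def)
  qed
  show "\<bar>\<integral>y. f y * \<phi> y \<partial>lborel\<bar> \<le> c0 / \<theta> * (\<Sum>l=Suc i..T. \<theta> ^ (l - i) * avg i (incr l) x)"
    unfolding eq sum_distrib_left by (rule order_trans[OF sum_abs]) (rule sum_mono[OF est])
qed

text \<open>Orthogonality: the square of a martingale difference and the difference of the squares
  have the same integral, since they differ by the martingale difference times a predictable factor.
  The differences of squares telescope pointwise up to the halting level.\<close>

lemma energy_le:
  "(\<Sum>l=Suc j..T. LBINT y:cell j x0. of_bool (alive l y) * (avg l f y - avg (l - 1) f y)^2) \<le> beta^2 * vol j"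
proof -
  let ?R = "cell j x0"
  define g where "g l y = of_bool (alive l y) * ((avg l f y)^2 - (avg (l - 1) f y)^2)" for l y
  have [measurable]: "g l \<in> borel_measurable borel" for l unfolding g_def by measurable
  have b1: "\<bar>avg l f y\<bar> \<le> beta" if "y \<in> ?R" "j < l" "alive l y" for l y
    using abs_avg_le[of l f y] mean_beta[OF that] by linarith
  have b2: "\<bar>avg (l - 1) f y\<bar> \<le> beta" if y: "y \<in> ?R" "j < l" "alive l y" for l y
  proof -
    obtain k where k: "l = Suc k" "j \<le> k" using y(2) by (cases l) auto
    then show ?thesis using abs_avg_le[of k f y] mean_alive[OF y(1) k(2)] y(3) beta_ge by auto
  qed
  have sq: "x^2 \<le> beta^2" if "\<bar>x\<bar> \<le> beta" for x
    using that by (metis abs_ge_zero power2_abs power_mono)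
  have gb: "\<bar>g l y\<bar> \<le> 2 * beta^2" if "y \<in> ?R" "j < l" for l y
  proof (cases "alive l y")
    case True
    have "\<bar>a - b\<bar> \<le> 2 * B" if "0 \<le> a" "a \<le> B" "0 \<le> b" "b \<le> B" for a b B :: real
      using that by linarith
    from this[OF _ sq[OF b1[OF that True]] _ sq[OF b2[OF that True]]] show ?thesis
      using True by (simp add: g_def)
  qed (simp add: g_def)
  have gint: "set_integrable lborel ?R (g l)" if "j < l" for l
    by (rule bounded_set_integrable[where B = "2 * beta^2"]) (use gb that in auto)
  have eq: "(LBINT y:?R. of_bool (alive l y) * (avg l f y - avg (l - 1) f y)^2) = (LBINT y:?R. g l y)"
    if l: "j < l" for l
  proof -
    obtain k where k: "l = Suc k" "j \<le> k" using l by (cases l) auto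
    \<comment> \<open>With a and b the averages at levels l and k, a^2 - b^2 - (a - b)^2 = 2 b (a -
      b); v is the factor 2 b, cut off where y is no longer alive.\<close>
    define v where "v y = 2 * (of_bool (alive l y) * avg k f y)" for y
    have v_ad: "adapted k v"
      using adaptedD[OF adapted_alive[of k]] adaptedD[OF adapted_avg] unfolding adapted_def v_def k by presburger
    have [measurable]: "v \<in> borel_measurable borel" by (rule adapted_borel[OF v_ad])
    have vb: "\<bar>v y\<bar> \<le> 2 * beta" if "y \<in> ?R" for y
      using b2[OF that l] beta_nonneg k by (cases "alive l y") (auto simp: v_def)
    have tow: "avg k (avg l f) = avg k f" using avg_tower[OF f, of k l] k by (intro ext) simp
    note * = set_integral_avg[OF cellint_avg[OF f, of l] k(2) v_ad vb, unfolded tow]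
    have i1: "set_integrable lborel ?R (\<lambda>y. v y * avg l f y)"
      by (rule cellint_bounded_mult[OF cellint_avg[OF f] _ vb]) auto
    have "(LBINT y:?R. of_bool (alive l y) * (avg l f y - avg (l - 1) f y)^2)
        = (LBINT y:?R. g l y - (v y * avg l f y - v y * avg k f y))"
      by (rule set_lebesgue_integral_cong)
         (auto simp: g_def v_def k power2_eq_square algebra_simps)
    also have "\<dots> = (LBINT y:?R. g l y)"
      using *(1) *(2) i1 gint[OF l] by (simp add: set_integral_diff)
    finally show ?thesis .
  qed
  have "(\<Sum>l=Suc j..T. LBINT y:?R. of_bool (alive l y) * (avg l f y - avg (l - 1) f y)^2) = (\<Sum>l=Suc j..T. LBINT y:?R. g l y)"
    by (intro sum.cong refl eq) auto
  also have "\<dots> = (LBINT y:?R. \<Sum>l=Suc j..T. g l y)"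
    by (rule set_integral_sum[symmetric]) (use gint in auto)
  also have "\<dots> \<le> (LBINT y:?R. beta^2)"
  proof (rule set_integral_mono)
    show "set_integrable lborel ?R (\<lambda>y. \<Sum>l=Suc j..T. g l y)"
      by (rule set_integrable_sum) (use gint in auto)
    show "set_integrable lborel ?R (\<lambda>y. beta^2)"
      by (rule bounded_set_integrable[where B = "beta^2"]) auto
    fix y assume y: "y \<in> ?R"
    \<comment> \<open>Two claims at once: the exact telescoped value while alive, needed to reach
      the halting level, and the bound, which persists afterwards because later terms
      vanish.\<close>
    have "(\<Sum>l=Suc j..t. g l y) \<le> beta^2 \<and> (alive (Suc t) y \<longrightarrow> (\<Sum>l=Suc j..t. g l y) = (avg t f y)^2 - (avg j f y)^2)"
      if "j \<le> t" for t
      using that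
    proof (induction t rule: dec_induct)
      case base
      then show ?case by simp
    next
      case (step t)
      show ?case
      proof (cases "alive (Suc t) y")
        case True
        then have "(\<Sum>l=Suc j..Suc t. g l y) = (avg (Suc t) f y)^2 - (avg j f y)^2"
          using step by (simp add: g_def)
        moreover have "(avg (Suc t) f y)^2 \<le> beta^2"
          using sq[OF b1[OF y _ True]] step by simp
        ultimately show ?thesis by (smt (verit) zero_le_power2)
      next
        case False
        then have "\<not> alive (Suc (Suc t)) y" using alive_antimono[of "Suc (Suc t)" y "Suc t"] by auto
        then show ?thesis using False step by (simp add: g_def)
      qed
    qed
    then show "(\<Sum>l=Suc j..T. g l y) \<le> beta^2"
      by (cases "j \<le> T") auto
  qed
  also have "\<dots> = beta^2 * vol j" by (rule set_integral_const_cell)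
  finally show ?thesis .
qed

lemma halts_sum_le_1: "(\<Sum>l=Suc j..T. of_bool (halts l y) :: real) \<le> 1"
proof -
  have less: False if "halts l y" "halts l' y" "l < l'" "j < l" "l' \<le> T" for l l'
    using that by (auto simp: halts_def alive_def)
  have "card ({Suc j..T} \<inter> {l. halts l y}) \<le> Suc 0"
  proof (subst card_le_Suc0_iff_eq)
    show "\<forall>a\<in>{Suc j..T} \<inter> {l. halts l y}. \<forall>b\<in>{Suc j..T} \<inter> {l. halts l y}. a = b"
    proof (intro ballI)
      fix a b assume "a \<in> {Suc j..T} \<inter> {l. halts l y}" "b \<in> {Suc j..T} \<inter> {l. halts l y}"
      then show "a = b" using less[of a b] less[of b a] by (cases a b rule: linorder_cases) auto
    qed
  qed auto
  then show ?thesis by simp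
qed

lemma halts_count:
  "(\<Sum>l=Suc j..T. LBINT y:cell j x0. of_bool (halts l y) :: real) \<le> vol j"
proof -
  let ?R = "cell j x0"
  have int: "set_integrable lborel ?R (\<lambda>y. of_bool (halts l y) :: real)" for l
    by (rule bounded_set_integrable[where B = 1]) auto
  have "(\<Sum>l=Suc j..T. LBINT y:?R. of_bool (halts l y) :: real) = (LBINT y:?R. \<Sum>l=Suc j..T. of_bool (halts l y) :: real)"
    by (rule set_integral_sum[symmetric]) (use int in auto)
  also have "\<dots> \<le> (LBINT y:?R. 1 :: real)"
  proof (rule set_integral_mono)
    show "set_integrable lborel ?R (\<lambda>y. \<Sum>l=Suc j..T. of_bool (halts l y) :: real)"
      by (rule set_integrable_sum) (use int in auto)
    show "set_integrable lborel ?R (\<lambda>y. 1 :: real)"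
      by (rule bounded_set_integrable[where B = 1]) auto
    show "(\<Sum>l=Suc j..T. of_bool (halts l y) :: real) \<le> 1" for y by (rule halts_sum_le_1)
  qed
  also have "\<dots> = vol j" using set_integral_const_cell[of j x0 1] by simp
  finally show ?thesis .
qed

lemma psup_alive_integrable:
  assumes i: "j \<le> i"
  shows "set_integrable lborel (cell j x0) (\<lambda>y. of_bool (alive (Suc i) y) * (psup i y)^2)"
proof (rule bounded_set_integrable[where B = "(c1 * (8 * mean j x0))^2"])
  fix y assume y: "y \<in> cell j x0"
  show "\<bar>of_bool (alive (Suc i) y) * (psup i y)^2\<bar> \<le> (c1 * (8 * mean j x0))^2"
  proof (cases "alive (Suc i) y")
    case True
    have "psup i y \<le> c1 * mean i y" by (rule psup_le)
    also have "\<dots> \<le> c1 * (8 * mean j x0)"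
      using mean_alive[OF y i True] constants_pos by (intro mult_left_mono) auto
    finally have "(psup i y)^2 \<le> (c1 * (8 * mean j x0))^2" using psup_nonneg by (intro power_mono) auto
    then show ?thesis using True by simp
  qed simp
qed measurable

text \<open>Cauchy-Schwarz against the geometric weights and Jensen turn \<open>psup_le_sum\<close>
  into a bound for squares; exchanging the sums over i and l costs a second geometric series. What
  remains is the energy and the count of halting cells.\<close>

lemma corona:
  "(\<Sum>i=Suc j..<T. LBINT y:cell j x0. of_bool (alive (Suc i) y) * (psup i y)^2)
    \<le> (c0 / \<theta>)^2 / (1 - \<theta>)^2 * (10 * beta^2) * vol j"
proof -
  let ?R = "cell j x0"
  let ?C = "(c0 / \<theta>)^2 / (1 - \<theta>)"
  have C: "0 \<le> ?C" using constants_pos by simp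
  have \<theta>: "0 \<le> \<theta>" "\<theta> < 1" using constants_pos by auto
  \<comment> \<open>\<open>cellint\<close> asks for integrability on all top cells, while
    \<open>incr\<close> is controlled only on the cell of x0; hence the indicator.\<close>
  define F where "F l y = indicator ?R y * (incr l y)^2" for l y
  have [measurable]: "F l \<in> borel_measurable borel" for l unfolding F_def by measurable
  have Fnn: "0 \<le> F l y" for l y by (simp add: F_def)
  have Fb: "\<bar>F l y\<bar> \<le> (4 * beta)^2" if "j < l" for l y
  proof (cases "y \<in> ?R")
    case True
    have "(incr l y)^2 \<le> (4 * beta)^2"
      using incr_bound[OF True that] incr_nonneg[of l y] by (intro power_mono) auto
    then show ?thesis using True by (simp add: F_def)
  qed (simp add: F_def)
  have Fc: "cellint (F l)" if "j < l" for l
    unfolding cellint_def using bounded_set_integrable[of "F l" _ _ "(4 * beta)^2"] Fb[OF that] by simp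
  have sub: "cell i y \<subseteq> ?R" if "y \<in> ?R" "j \<le> i" for i y
    using cell_mono[OF that(2), of y] cell_eq[OF that(1)] by simp
  have pt: "of_bool (alive (Suc i) y) * (psup i y)^2 \<le> ?C * (\<Sum>l=Suc i..T. \<theta> ^ (l - i) * avg i (F l) y)"
    if y: "y \<in> ?R" and i: "i \<in> {Suc j..<T}" for i y
  proof (cases "alive (Suc i) y")
    case False
    have "0 \<le> (\<Sum>l=Suc i..T. \<theta> ^ (l - i) * avg i (F l) y)"
      using \<theta> by (intro sum_nonneg mult_nonneg_nonneg avg_nonneg Fnn) auto
    then have "0 \<le> ?C * (\<Sum>l=Suc i..T. \<theta> ^ (l - i) * avg i (F l) y)"
      by (intro mult_nonneg_nonneg C)
    then show ?thesis using False by simp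
  next
    case True
    have "(psup i y)^2 \<le> (c0 / \<theta> * (\<Sum>l=Suc i..T. \<theta> ^ (l - i) * avg i (incr l) y))^2"
      using psup_le_sum[OF y _ _ True] i psup_nonneg[of i y] by (intro power_mono) auto
    also have "\<dots> = (c0 / \<theta>)^2 * (\<Sum>l=Suc i..T. \<theta> ^ (l - i) * avg i (incr l) y)^2"
      by (rule power_mult_distrib)
    also have "\<dots> \<le> (c0 / \<theta>)^2 * ((\<Sum>l=Suc i..T. \<theta> ^ (l - i)) * (\<Sum>l=Suc i..T. \<theta> ^ (l - i) * (avg i (incr l) y)^2))"
      using \<theta> by (intro mult_left_mono weighted_sum_square) auto
    also have "\<dots> \<le> (c0 / \<theta>)^2 * (1 / (1 - \<theta>) * (\<Sum>l=Suc i..T. \<theta> ^ (l - i) * avg i (F l) y))"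
    proof (intro mult_left_mono mult_mono sum_mono)
      show "(\<Sum>l=Suc i..T. \<theta> ^ (l - i)) \<le> 1 / (1 - \<theta>)"
        using \<theta> by (intro sum_power_inj_le) (auto simp: inj_on_def)
      fix l assume l: "l \<in> {Suc i..T}"
      have jl: "j < l" "j \<le> i" using l i by auto
      have "(avg i (incr l) y)^2 \<le> avg i (\<lambda>z. (incr l z)^2) y"
        using incr_bound[OF _ jl(1)] sub[OF y jl(2)] by (intro avg_square[where B = "4 * beta"]) auto
      also have "\<dots> = avg i (F l) y"
        unfolding avg_def
        using sub[OF y jl(2)]
        by (intro arg_cong[where f = "\<lambda>t. t / vol i"] set_lebesgue_integral_cong) (auto simp: F_def indicator_def)
      finally show "(avg i (incr l) y)^2 \<le> avg i (F l) y" .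
    qed (use \<theta> in \<open>auto intro!: sum_nonneg\<close>)
    finally show ?thesis using True by simp
  qed
  have "(\<Sum>i=Suc j..<T. LBINT y:?R. of_bool (alive (Suc i) y) * (psup i y)^2)
      \<le> (\<Sum>i=Suc j..<T. ?C * (\<Sum>l=Suc i..T. \<theta> ^ (l - i) * (LBINT y:?R. F l y)))"
  proof (rule sum_mono)
    fix i assume i: "i \<in> {Suc j..<T}"
    have intl: "set_integrable lborel ?R (\<lambda>y. \<theta> ^ (l - i) * avg i (F l) y)" if "l \<in> {Suc i..T}" for l
      using cellint_set[OF cellint_avg[OF Fc[of l]], of j x0 i] i that by simp
    have ints: "set_integrable lborel ?R (\<lambda>y. \<Sum>l=Suc i..T. \<theta> ^ (l - i) * avg i (F l) y)"
      by (rule set_integrable_sum) (use intl in auto)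
    have "(LBINT y:?R. of_bool (alive (Suc i) y) * (psup i y)^2)
        \<le> (LBINT y:?R. ?C * (\<Sum>l=Suc i..T. \<theta> ^ (l - i) * avg i (F l) y))"
    proof (rule set_integral_mono)
      show "set_integrable lborel ?R (\<lambda>y. of_bool (alive (Suc i) y) * (psup i y)^2)"
        by (rule psup_alive_integrable) (use i in simp)
      show "set_integrable lborel ?R (\<lambda>y. ?C * (\<Sum>l=Suc i..T. \<theta> ^ (l - i) * avg i (F l) y))"
        by (rule set_integrable_mult_right) (rule ints)
    qed (rule pt[OF _ i])
    also have "\<dots> = ?C * (\<Sum>l=Suc i..T. LBINT y:?R. \<theta> ^ (l - i) * avg i (F l) y)"
    proof -
      have "(LBINT y:?R. \<Sum>l=Suc i..T. \<theta> ^ (l - i) * avg i (F l) y) = (\<Sum>l=Suc i..T. LBINT y:?R. \<theta> ^ (l - i) * avg i (F l) y)"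
        by (rule set_integral_sum) (use intl in auto)
      then show ?thesis by (simp only: set_integral_mult_right)
    qed
    also have "\<dots> = ?C * (\<Sum>l=Suc i..T. \<theta> ^ (l - i) * (LBINT y:?R. F l y))"
    proof -
      have "(LBINT y:?R. avg i (F l) y) = (LBINT y:?R. F l y)" if "l \<in> {Suc i..T}" for l
        using set_integral_avg(2)[OF Fc[of l], of j i "\<lambda>_. 1" x0 1] i that by (simp add: adapted_def)
      then show ?thesis by simp
    qed
    finally show "(LBINT y:?R. of_bool (alive (Suc i) y) * (psup i y)^2)
        \<le> ?C * (\<Sum>l=Suc i..T. \<theta> ^ (l - i) * (LBINT y:?R. F l y))" .
  qed
  also have "\<dots> = ?C * (\<Sum>l=Suc j..T. (\<Sum>i=Suc j..<l. \<theta> ^ (l - i)) * (LBINT y:?R. F l y))"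
  proof -
    have "(\<Sum>i=Suc j..<T. \<Sum>l=Suc i..T. \<theta> ^ (l - i) * (LBINT y:?R. F l y))
        = (\<Sum>l=Suc j..T. \<Sum>i=Suc j..<l. \<theta> ^ (l - i) * (LBINT y:?R. F l y))"
      unfolding sum.Sigma[OF finite_atLeastLessThan ballI[OF finite_atLeastAtMost]]
        sum.Sigma[OF finite_atLeastAtMost ballI[OF finite_atLeastLessThan]]
      by (rule sum.reindex_bij_witness[where i = "\<lambda>(l, i). (i, l)" and j = "\<lambda>(i, l). (l, i)"]) auto
    then show ?thesis unfolding sum_distrib_left[symmetric] sum_distrib_right by (rule arg_cong)
  qed
  also have "\<dots> \<le> ?C * (\<Sum>l=Suc j..T. 1 / (1 - \<theta>) * (LBINT y:?R. F l y))"
  proof (intro mult_left_mono sum_mono mult_right_mono C)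
    show "(\<Sum>i=Suc j..<l. \<theta> ^ (l - i)) \<le> 1 / (1 - \<theta>)" for l
      using \<theta> by (intro sum_power_inj_le) (auto simp: inj_on_def)
  qed (simp add: set_lebesgue_integral_def F_def)
  also have "\<dots> = ?C / (1 - \<theta>) * (\<Sum>l=Suc j..T. LBINT y:?R. F l y)"
    by (simp add: sum_distrib_left mult.assoc)
  \<comment> \<open>(a + b)^2 \<le> 2 a^2 + 2 b^2 with b = 2 \<open>beta\<close> yields the 8; with
    the 2 of the energy term this makes the 10 of the statement.\<close>
  also have "\<dots> \<le> ?C / (1 - \<theta>) * (\<Sum>l=Suc j..T. 2 * (LBINT y:?R. of_bool (alive l y) * (avg l f y - avg (l - 1) f y)^2)
      + 8 * beta^2 * (LBINT y:?R. of_bool (halts l y)))"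
  proof (intro mult_left_mono sum_mono)
    fix l assume "l \<in> {Suc j..T}"
    then have jl: "j < l" by simp
    have i1: "set_integrable lborel ?R (\<lambda>y. of_bool (alive l y) * (avg l f y - avg (l - 1) f y)^2)"
    proof (rule bounded_set_integrable[where B = "(2 * beta)^2"])
      fix y assume y: "y \<in> ?R"
      have "\<bar>of_bool (alive l y) * (avg l f y - avg (l - 1) f y)\<bar>^2 \<le> (2 * beta)^2"
        by (intro power_mono diff_bound[OF y jl]) auto
      then show "\<bar>of_bool (alive l y) * (avg l f y - avg (l - 1) f y)^2\<bar> \<le> (2 * beta)^2"
        by (cases "alive l y") auto
    qed measurable
    have i2: "set_integrable lborel ?R (\<lambda>y. of_bool (halts l y) :: real)"
      by (rule bounded_set_integrable[where B = 1]) auto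
    have "(LBINT y:?R. F l y) \<le> (LBINT y:?R. 2 * (of_bool (alive l y) * (avg l f y - avg (l - 1) f y)^2)
        + 8 * beta^2 * of_bool (halts l y))"
    proof (rule set_integral_mono)
      show "set_integrable lborel ?R (F l)" by (rule cellint_set[OF Fc[OF jl]])
      show "set_integrable lborel ?R (\<lambda>y. 2 * (of_bool (alive l y) * (avg l f y - avg (l - 1) f y)^2)
        + 8 * beta^2 * of_bool (halts l y))"
        by (intro set_integral_add(1) set_integrable_mult_right i1 i2)
      fix y assume y: "y \<in> ?R"
      have "(a + b)^2 \<le> 2 * a^2 + 2 * b^2" for a b :: real
        using zero_le_power2[of "a - b"] by (simp add: power2_eq_square algebra_simps)
      from this[of "of_bool (alive l y) * \<bar>avg l f y - avg (l - 1) f y\<bar>" "of_bool (halts l y) * (2 * beta)"]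
      show "F l y \<le> 2 * (of_bool (alive l y) * (avg l f y - avg (l - 1) f y)^2) + 8 * beta^2 * of_bool (halts l y)"
        using y by (cases "alive l y"; cases "halts l y") (simp_all add: F_def incr_def power_mult_distrib)
    qed
    also have "\<dots> = 2 * (LBINT y:?R. of_bool (alive l y) * (avg l f y - avg (l - 1) f y)^2)
      + 8 * beta^2 * (LBINT y:?R. of_bool (halts l y))"
      using set_integral_add(2)[OF set_integrable_mult_right[OF i1, of 2] set_integrable_mult_right[OF i2, of "8 * beta^2"]]
      by (simp only: set_integral_mult_right)
    finally show "(LBINT y:?R. F l y) \<le> 2 * (LBINT y:?R. of_bool (alive l y) * (avg l f y - avg (l - 1) f y)^2)
      + 8 * beta^2 * (LBINT y:?R. of_bool (halts l y))" .
  qed (use C \<theta> in auto)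
  also have "\<dots> \<le> ?C / (1 - \<theta>) * (2 * (beta^2 * vol j) + 8 * beta^2 * vol j)"
    unfolding sum.distrib sum_distrib_left[symmetric]
    using C \<theta> energy_le halts_count by (intro mult_left_mono add_mono) auto
  also have "\<dots> = (c0 / \<theta>)^2 / (1 - \<theta>)^2 * (10 * beta^2) * vol j"
    by (simp add: power2_eq_square mult_ac)
  finally show ?thesis .
qed

end

section \<open>Sparse domination\<close>

text \<open>The constant of \<open>corona\<close> after writing \<open>beta\<close> as 8 2^n times
  the average over the starting cell: the energy below that cell is at most \<open>Kc\<close> times
  the squared average times its volume.\<close>

definition Kc :: real where
  "Kc = (c0 / \<theta>)^2 / (1 - \<theta>)^2 * (10 * (8 * 2 ^ DIM('a))^2)"

text \<open>The factors 8 are chosen so that each criterion is responsible for at most one eighth of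
  a stopping cube, by Markov's inequality for |f| and for the energy respectively.\<close>

definition stops :: "real \<times> real \<Rightarrow> nat \<Rightarrow> 'a \<Rightarrow> bool" where
  "stops s i x \<longleftrightarrow> 8 * fst s < mean i x \<or> 8 * Kc * (fst s)^2 < snd s + (psup i x)^2"

text \<open>
  The first component is the average of |f| over the last stopping cube, the second one the sum of
  the squared pairings since then.
\<close>
primrec state :: "nat \<Rightarrow> 'a \<Rightarrow> real \<times> real" where
  "state 0 x = (mean 0 x, 0)"
| "state (Suc i) x = (if stops (state i x) (Suc i) x then (mean (Suc i) x, 0)
     else (fst (state i x), snd (state i x) + (psup (Suc i) x)^2))"

definition stop :: "nat \<Rightarrow> 'a \<Rightarrow> bool" where
  "stop i x \<longleftrightarrow> (case i of 0 \<Rightarrow> True | Suc k \<Rightarrow> stops (state k x) i x)"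

lemma Kc_pos: "Kc > 0"
  using constants_pos by (simp add: Kc_def)

lemma adapted_state: "adapted i (state i)"
proof (induction i)
  case 0
  then show ?case using adapted_avg[of 0] by (simp add: adapted_def)
next
  case (Suc i)
  show ?case unfolding adapted_def
  proof (intro allI impI)
    fix x y assume y: "y \<in> cell (Suc i) x"
    then have "y \<in> cell i x" using cell_Suc by blast
    from adaptedD[OF Suc this] show "state (Suc i) y = state (Suc i) x"
      by (simp add: stops_def adaptedD[OF adapted_avg y] adaptedD[OF adapted_psup y])
  qed
qed

lemma adapted_stop: "adapted i (stop i)"
proof (cases i)
  case 0
  then show ?thesis by (simp add: adapted_def stop_def)
next
  case (Suc k)
  show ?thesis unfolding adapted_def
  proof (intro allI impI)
    fix x y assume y: "y \<in> cell i x"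
    then have "y \<in> cell k x" using cell_Suc Suc by blast
    from adaptedD[OF adapted_state this] show "stop i y = stop i x"
      by (simp add: Suc stop_def stops_def adaptedD[OF adapted_avg y[unfolded Suc]] adaptedD[OF adapted_psup y[unfolded Suc]])
  qed
qed

lemma state_stop: "stop i x \<Longrightarrow> state i x = (mean i x, 0)"
  by (cases i) (auto simp: stop_def)

lemma state_inv: "0 \<le> snd (state i x) \<and> snd (state i x) \<le> 8 * Kc * (fst (state i x))^2"
  using Kc_pos by (induction i) (auto simp: stops_def)

text \<open>A budget argument. Each stopping cube deposits 8 \<open>Kc\<close> times its squared
  average and pays for its own pairing through \<open>psup_le\<close>. The pairings after it are
  paid from the deposit, until the second criterion prevents an overdraft.\<close>

lemma square_sum_le_stops:
  "(\<Sum>i\<le>n. (psup i x)^2) \<le> (c1^2 + 8 * Kc) * (\<Sum>i\<le>n. of_bool (stop i x) * (mean i x)^2)"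
proof -
  have aM: "(psup i x)^2 \<le> c1^2 * (mean i x)^2" for i
    using power_mono[OF psup_le psup_nonneg, of i x 2] by (simp add: power_mult_distrib)
  \<comment> \<open>The unspent part of the current deposit is added to the left side; with it the
    induction closes.\<close>
  have "(\<Sum>i\<le>n. (psup i x)^2) + 8 * Kc * (fst (state n x))^2 - snd (state n x)
     \<le> (c1^2 + 8 * Kc) * (\<Sum>i\<le>n. of_bool (stop i x) * (mean i x)^2)"
  proof (induction n)
    case 0
    then show ?case using aM[of 0] by (simp add: stop_def algebra_simps)
  next
    case (Suc n)
    have st: "stop (Suc n) x = stops (state n x) (Suc n) x" by (simp add: stop_def)
    show ?case
    proof (cases "stops (state n x) (Suc n) x")
      case True
      then show ?thesis
        using Suc aM[of "Suc n"] state_inv[of n x] by (simp add: st algebra_simps)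
    next
      case False
      then show ?thesis using Suc by (simp add: st algebra_simps)
    qed
  qed
  then show ?thesis using state_inv[of n x] by linarith
qed

text \<open>Follow y down to the first stopping cube. Until then the state is the average over the
  starting cube and the plain sum of squares, so the violated criterion can be read off as one of
  two events about y.\<close>

lemma stop_cases:
  assumes "stop j x0" "y \<in> cell j x0" "j < k" "k \<le> N" "stop k y"
  shows "(\<exists>m. j < m \<and> m \<le> N \<and> 8 * mean j x0 < mean m y) \<or>
    8 * Kc * (mean j x0)^2 < (\<Sum>i=Suc j..<Suc N. of_bool (alive j x0 (Suc i) y) * (psup i y)^2)"
proof (rule disj_imp[THEN iffD2], rule impI)
  assume "\<not> (\<exists>m. j < m \<and> m \<le> N \<and> 8 * mean j x0 < mean m y)"
  then have no: "\<And>m. j < m \<Longrightarrow> m \<le> N \<Longrightarrow> mean m y \<le> 8 * mean j x0" by force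
  define t where "t = (LEAST k. j < k \<and> stop k y)"
  have t: "j < t" "stop t y" and tk: "t \<le> k" and least: "\<And>m. j < m \<Longrightarrow> m < t \<Longrightarrow> \<not> stop m y"
  proof -
    have "j < t \<and> stop t y" unfolding t_def by (rule LeastI[of _ k]) (use assms in simp)
    then show "j < t" "stop t y" by auto
    show "t \<le> k" unfolding t_def by (rule Least_le) (use assms in simp)
    show "\<not> stop m y" if "j < m" "m < t" for m
      using not_less_Least[of m "\<lambda>k. j < k \<and> stop k y"] that unfolding t_def by blast
  qed
  have st: "state m y = (mean j x0, \<Sum>i=Suc j..m. (psup i y)^2)" if "j \<le> m" "m < t" for m
    using that
  proof (induction m rule: dec_induct)
    case base
    have "stop j y" using adaptedD[OF adapted_stop assms(2)] assms(1) by simp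
    from state_stop[OF this] show ?case using adaptedD[OF adapted_avg assms(2)] by simp
  next
    case (step m)
    have "\<not> stops (state m y) (Suc m) y"
      using least[of "Suc m"] step by (simp add: stop_def)
    then show ?case using step by simp
  qed
  obtain m where m: "t = Suc m" "j \<le> m" using t(1) by (cases t) auto
  have "stops (state m y) t y" using t(2) m by (simp add: stop_def)
  then have "8 * Kc * (mean j x0)^2 < (\<Sum>i=Suc j..m. (psup i y)^2) + (psup t y)^2"
    using st[OF m(2)] m no[of t] t tk assms(4) by (auto simp: stops_def)
  also have "\<dots> = (\<Sum>i=Suc j..<Suc t. (psup i y)^2)"
    using m by (simp add: atLeastLessThanSuc_atLeastAtMost)
  \<comment> \<open>No average up to level N is high, so these indicators equal 1; they are inserted
    to match the integrand of \<open>corona\<close>.\<close>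
  also have "\<dots> = (\<Sum>i=Suc j..<Suc t. of_bool (alive j x0 (Suc i) y) * (psup i y)^2)"
    using no tk assms(4) by (intro sum.cong) (auto simp: alive_def)
  also have "\<dots> \<le> (\<Sum>i=Suc j..<Suc N. of_bool (alive j x0 (Suc i) y) * (psup i y)^2)"
    using tk assms(4) by (intro sum_mono2) auto
  finally show "8 * Kc * (mean j x0)^2 < (\<Sum>i=Suc j..<Suc N. of_bool (alive j x0 (Suc i) y) * (psup i y)^2)" .
qed

lemma stop_measurable [measurable]: "Measurable.pred borel (stop i)"
  by (rule adapted_pred[OF adapted_stop])

text \<open>Serves the degenerate case of \<open>sparse\<close>, where one cannot divide by the
  average.\<close>

lemma mean_zero:
  assumes "mean j x0 = 0" "y \<in> cell j x0" "j \<le> k"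
  shows "mean k y = 0"
proof -
  have sub: "cell k y \<subseteq> cell j x0" using cell_mono[OF assms(3), of y] cell_eq[OF assms(2)] by simp
  have "(LINT z:cell k y|lborel. \<bar>f z\<bar>) \<le> (LINT z:cell j x0|lborel. \<bar>f z\<bar>)"
    unfolding set_lebesgue_integral_def
    using sub cellint_set[OF cellint_abs[OF f]]
    by (intro integral_mono) (auto simp: set_integrable_def indicator_def)
  also have "\<dots> = 0" using assms(1) vol_pos[of j] by (simp add: avg_def)
  finally have "mean k y \<le> 0" using vol_pos[of k] by (simp add: avg_def divide_nonpos_pos)
  then show ?thesis using mean_nonneg[of k y] by simp
qed

lemma sparse:
  assumes st: "stop j x0"
  shows "(LBINT y:cell j x0. of_bool (\<exists>k. j < k \<and> k \<le> N \<and> stop k y)) \<le> vol j / 4"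
proof (cases "mean j x0 = 0")
  case True
  have "of_bool (\<exists>k. j < k \<and> k \<le> N \<and> stop k y) = (0::real)" if y: "y \<in> cell j x0" for y
  proof -
    have M0: "mean k y = 0" if "j \<le> k" for k by (rule mean_zero[OF True y that])
    have "psup k y = 0" if "j \<le> k" for k using psup_le[of k y] psup_nonneg[of k y] M0[OF that] by simp
    then have "\<not> (j < k \<and> k \<le> N \<and> stop k y)" for k
      using stop_cases[OF st y, of k N] M0 True by auto
    then show ?thesis by simp
  qed
  then have "(LBINT y:cell j x0. of_bool (\<exists>k. j < k \<and> k \<le> N \<and> stop k y)) = (LBINT y:cell j x0. (0::real))"
    by (intro set_lebesgue_integral_cong) auto
  then show ?thesis using vol_pos[of j] by simp
next
  case False
  define A where "A = mean j x0"
  have A: "A > 0" using False mean_nonneg[of j x0] by (simp add: A_def)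
  let ?R = "cell j x0"
  \<comment> \<open>The forced halt falls at level N + 1, beyond the levels summed in
    \<open>U1\<close>, so \<open>U1\<close> counts genuine halts only, while \<open>corona\<close>
    still covers the levels up to N.\<close>
  let ?T = "Suc N"
  define u where "u l y = (of_bool (halts j ?T x0 l y) :: real)" for l y
  define S where "S y = (\<Sum>i=Suc j..<?T. of_bool (alive j x0 (Suc i) y) * (psup i y)^2)" for y
  define U1 where "U1 y = (\<Sum>l=Suc j..N. u l y)" for y
  have u_ad: "adapted l (u l)" for l
    using adapted_halts[of l] unfolding u_def adapted_def by simp
  have [measurable]: "u l \<in> borel_measurable borel" for l by (rule adapted_borel[OF u_ad])
  have [measurable]: "S \<in> borel_measurable borel" unfolding S_def
    using alive_measurable[of j] by measurable
  have ub: "\<bar>u l y\<bar> \<le> 1" for l y by (simp add: u_def)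
  have uint: "set_integrable lborel ?R (u l)" for l
    by (rule bounded_set_integrable[OF _ ub]) measurable
  have U1int: "set_integrable lborel ?R U1"
    unfolding U1_def by (rule set_integrable_sum) (use uint in auto)
  have U2int: "set_integrable lborel ?R (\<lambda>y. of_bool (8 * Kc * A^2 < S y) :: real)"
    by (rule bounded_set_integrable[where B = 1]) auto
  have Sint: "set_integrable lborel ?R (\<lambda>y. of_bool (alive j x0 (Suc i) y) * (psup i y)^2)" if i: "j < i" for i
    using i by (intro psup_alive_integrable) simp
  have "(LBINT y:?R. of_bool (\<exists>k. j < k \<and> k \<le> N \<and> stop k y)) \<le> (LBINT y:?R. U1 y + of_bool (8 * Kc * A^2 < S y))"
  proof (rule set_integral_mono)
    show "set_integrable lborel ?R (\<lambda>y. of_bool (\<exists>k. j < k \<and> k \<le> N \<and> stop k y) :: real)"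
      by (rule bounded_set_integrable[where B = 1]) auto
    show "set_integrable lborel ?R (\<lambda>y. U1 y + of_bool (8 * Kc * A^2 < S y))"
      by (intro set_integral_add(1) U1int U2int)
    fix y assume y: "y \<in> ?R"
    have U1nn: "0 \<le> U1 y" by (simp add: U1_def u_def sum_nonneg)
    have U1: "1 \<le> U1 y" if "\<exists>m. j < m \<and> m \<le> N \<and> 8 * A < mean m y"
    proof -
      define t where "t = (LEAST m. j < m \<and> m \<le> N \<and> 8 * A < mean m y)"
      have t: "j < t \<and> t \<le> N \<and> 8 * A < mean t y"
        unfolding t_def using that by (rule LeastI_ex)
      have "\<not> 8 * A < mean m y" if "j < m" "m < t" for m
        using not_less_Least[of m "\<lambda>m. j < m \<and> m \<le> N \<and> 8 * A < mean m y"] that t unfolding t_def[symmetric] by auto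
      then have "u t y = 1" using t unfolding u_def halts_def alive_def A_def by force
      moreover have "u t y \<le> U1 y" unfolding U1_def
        by (rule member_le_sum) (use t in \<open>auto simp: u_def\<close>)
      ultimately show ?thesis by simp
    qed
    show "of_bool (\<exists>k. j < k \<and> k \<le> N \<and> stop k y) \<le> U1 y + of_bool (8 * Kc * A^2 < S y)"
    proof (cases "\<exists>k. j < k \<and> k \<le> N \<and> stop k y")
      case True
      then obtain k where "j < k" "k \<le> N" "stop k y" by blast
      from stop_cases[OF st y this] show ?thesis
        using U1 U1nn unfolding A_def S_def by auto
    qed (use U1nn in auto)
  qed
  also have "\<dots> = (LBINT y:?R. U1 y) + (LBINT y:?R. of_bool (8 * Kc * A^2 < S y))"
    by (intro set_integral_add(2) U1int U2int)
  \<comment> \<open>Markov's inequality on the maximal cells of large average: they are disjoint,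
    and |f| has integral at most A \<open>vol j\<close> over them.\<close>
  also have "(LBINT y:?R. U1 y) \<le> vol j / 8"
  proof -
    have le: "8 * A * (LBINT y:?R. u l y) \<le> (LBINT y:?R. u l y * \<bar>f y\<bar>)" if l: "l \<in> {Suc j..N}" for l
    proof -
      have "8 * A * (LBINT y:?R. u l y) = (LBINT y:?R. 8 * A * u l y)" by simp
      also have "\<dots> \<le> (LBINT y:?R. u l y * mean l y)"
      proof (rule set_integral_mono)
        show "set_integrable lborel ?R (\<lambda>y. 8 * A * u l y)" using uint by simp
        show "set_integrable lborel ?R (\<lambda>y. u l y * mean l y)"
          by (rule cellint_bounded_mult[OF cellint_avg[OF cellint_abs[OF f]] _ ub]) measurable
        show "8 * A * u l y \<le> u l y * mean l y" for y
          using l by (auto simp: u_def halts_def A_def)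
      qed
      also have "\<dots> = (LBINT y:?R. u l y * \<bar>f y\<bar>)"
        by (rule set_integral_avg(2)[OF cellint_abs[OF f] _ u_ad ub]) (use l in simp)
      finally show ?thesis .
    qed
    have fint: "set_integrable lborel ?R (\<lambda>y. u l y * \<bar>f y\<bar>)" for l
      by (rule cellint_bounded_mult[OF cellint_abs[OF f] _ ub]) measurable
    have "8 * A * (LBINT y:?R. U1 y) = (\<Sum>l=Suc j..N. 8 * A * (LBINT y:?R. u l y))"
    proof -
      have "(LBINT y:?R. U1 y) = (\<Sum>l=Suc j..N. LBINT y:?R. u l y)"
        unfolding U1_def by (rule set_integral_sum) (use uint in auto)
      then show ?thesis by (simp add: sum_distrib_left)
    qed
    also have "\<dots> \<le> (\<Sum>l=Suc j..N. LBINT y:?R. u l y * \<bar>f y\<bar>)" by (rule sum_mono[OF le])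
    also have "\<dots> = (LBINT y:?R. \<Sum>l=Suc j..N. u l y * \<bar>f y\<bar>)"
      by (rule set_integral_sum[symmetric]) (use fint in auto)
    also have "\<dots> \<le> (LBINT y:?R. \<bar>f y\<bar>)"
    proof (rule set_integral_mono)
      show "set_integrable lborel ?R (\<lambda>y. \<Sum>l=Suc j..N. u l y * \<bar>f y\<bar>)"
        by (rule set_integrable_sum) (use fint in auto)
      show "set_integrable lborel ?R (\<lambda>y. \<bar>f y\<bar>)" by (rule cellint_set[OF cellint_abs[OF f]])
      fix y
      have "U1 y \<le> (\<Sum>l=Suc j..?T. of_bool (halts j ?T x0 l y))"
        unfolding U1_def u_def by (intro sum_mono2) auto
      also have "\<dots> \<le> 1" by (rule halts_sum_le_1)
      finally have "U1 y \<le> 1" .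
      then have "U1 y * \<bar>f y\<bar> \<le> 1 * \<bar>f y\<bar>" by (intro mult_right_mono) auto
      then show "(\<Sum>l=Suc j..N. u l y * \<bar>f y\<bar>) \<le> \<bar>f y\<bar>"
        unfolding U1_def sum_distrib_right by simp
    qed
    also have "\<dots> = A * vol j" using vol_pos[of j] by (simp add: A_def avg_def)
    finally show ?thesis using A by (simp add: field_simps)
  qed
  \<comment> \<open>Markov's inequality for the accumulated energy, whose integral is bounded by
    \<open>corona\<close>.\<close>
  also have "(LBINT y:?R. of_bool (8 * Kc * A^2 < S y)) \<le> vol j / 8"
  proof -
    have KA: "0 < Kc * A^2" using A Kc_pos by simp
    have "8 * Kc * A^2 * (LBINT y:?R. of_bool (8 * Kc * A^2 < S y)) = (LBINT y:?R. 8 * Kc * A^2 * of_bool (8 * Kc * A^2 < S y))"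
      by (rule set_integral_mult_right[symmetric])
    also have "\<dots> \<le> (LBINT y:?R. S y)"
    proof (rule set_integral_mono)
      show "set_integrable lborel ?R (\<lambda>y. 8 * Kc * A^2 * of_bool (8 * Kc * A^2 < S y))"
        by (rule set_integrable_mult_right) (rule U2int)
      show "set_integrable lborel ?R S"
        unfolding S_def by (rule set_integrable_sum) (use Sint in auto)
      have "0 \<le> S y" for y unfolding S_def by (intro sum_nonneg) simp
      then show "8 * Kc * A^2 * of_bool (8 * Kc * A^2 < S y) \<le> S y" for y by simp
    qed
    also have "\<dots> = (\<Sum>i=Suc j..<?T. LBINT y:?R. of_bool (alive j x0 (Suc i) y) * (psup i y)^2)"
      unfolding S_def by (rule set_integral_sum) (use Sint in auto)
    also have "\<dots> \<le> Kc * A^2 * vol j"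
      using corona[where j = j and T = ?T and ?x0.0 = x0]
      by (simp add: Kc_def beta_def A_def power_mult_distrib mult_ac)
    finally have "Kc * A^2 * (8 * (LBINT y:?R. of_bool (8 * Kc * A^2 < S y))) \<le> Kc * A^2 * vol j"
      by (simp only: mult_ac)
    then show ?thesis using KA by (simp only: mult_le_cancel_left_pos)
  qed
  finally show ?thesis by simp
qed

end

section \<open>Weights on a grid\<close>

lemma wmeas_emeasure:
  assumes [measurable]: "v \<in> borel_measurable borel" "E \<in> sets borel"
  shows "wmeas v E = emeasure (density lborel (\<lambda>x. ennreal (v x))) E"
  unfolding wmeas_def by (subst emeasure_density) auto

lemma wmeas_mono: "E \<subseteq> F \<Longrightarrow> wmeas v E \<le> wmeas v F"
  unfolding wmeas_def by (intro nn_integral_mono) (auto simp: indicator_def)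

lemma wmeas_disjoint_sum:
  assumes v: "v \<in> borel_measurable borel" and "finite A" and E: "\<And>i. i \<in> A \<Longrightarrow> E i \<in> sets borel"
    and F: "F \<in> sets borel" "\<And>i. i \<in> A \<Longrightarrow> E i \<subseteq> F" and disj: "disjoint_family_on E A"
  shows "(\<Sum>i\<in>A. wmeas v (E i)) \<le> wmeas v F"
proof -
  let ?M = "density lborel (\<lambda>x. ennreal (v x))"
  have "(\<Sum>i\<in>A. wmeas v (E i)) = (\<Sum>i\<in>A. emeasure ?M (E i))"
    by (intro sum.cong refl wmeas_emeasure v E)
  also have "\<dots> = emeasure ?M (\<Union>i\<in>A. E i)"
    by (rule sum_emeasure) (use E disj \<open>finite A\<close> in auto)
  also have "\<dots> \<le> emeasure ?M F"
    by (rule emeasure_mono) (use F in auto)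
  also have "\<dots> = wmeas v F" using wmeas_emeasure[OF v F(1)] by simp
  finally show ?thesis .
qed

text \<open>Hoelder's inequality after inserting w^(1/p) w^(-1/p), derived from Young's inequality
  with a free scaling parameter s.\<close>

lemma nn_Hoelder_dual_weight:
  fixes g w :: "'a::euclidean_space \<Rightarrow> real"
  assumes p: "1 < p" and [measurable]: "g \<in> borel_measurable borel" "w \<in> borel_measurable borel" "Q \<in> sets borel"
    and g: "\<And>y. 0 \<le> g y" and w: "AE y in lborel. w y > 0"
    and P: "wmeas (\<lambda>y. g y powr p * w y) Q = ennreal P" "P \<ge> 0"
    and S: "wmeas (dual_weight p w) Q = ennreal S" "S \<ge> 0"
  shows "(\<integral>\<^sup>+y. ennreal (g y) * indicator Q y \<partial>lborel) \<le> ennreal (P powr (1 / p) * S powr ((p - 1) / p))"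
proof -
  define q where "q = p / (p - 1)"
  have q: "q > 1" "1 / p + 1 / q = 1" "1 / q = (p - 1) / p" and pq: "p + q = p * q"
    using p by (auto simp: q_def field_simps)
  let ?\<sigma> = "dual_weight p w"
  have [measurable]: "?\<sigma> \<in> borel_measurable borel" unfolding dual_weight_def by measurable
  have young: "(\<integral>\<^sup>+y. ennreal (g y) * indicator Q y \<partial>lborel) \<le> ennreal (s powr p * P / p + s powr (- q) * S / q)"
    if s: "s > 0" for s
  proof -
    have "(\<integral>\<^sup>+y. ennreal (g y) * indicator Q y \<partial>lborel)
      \<le> (\<integral>\<^sup>+y. ennreal (s powr p / p) * (ennreal (g y powr p * w y) * indicator Q y)
            + ennreal (s powr (- q) / q) * (ennreal (?\<sigma> y) * indicator Q y) \<partial>lborel)"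
    proof (rule nn_integral_mono_AE, use w in eventually_elim)
      case (elim y)
      have e1: "(s * g y * w y powr (1 / p)) powr p = s powr p * (g y powr p * w y)"
        using s g elim p by (simp add: powr_mult powr_powr)
      have e2: "(w y powr ((1 - q) / q) / s) powr q = s powr (- q) * ?\<sigma> y"
      proof -
        have "(w y powr ((1 - q) / q) / s) powr q = w y powr ((1 - q) / q * q) / s powr q"
          by (simp only: powr_divide powr_powr)
        also have "(1 - q) / q * q = 1 - q" using q by simp
        also have "w y powr (1 - q) = ?\<sigma> y" by (simp add: dual_weight_def q_def)
        finally show ?thesis by (simp add: powr_minus divide_inverse mult.commute)
      qed
      have "w y powr (1 / p) * w y powr ((1 - q) / q) = w y powr (1 / p + (1 - q) / q)"
        by (rule powr_add[symmetric])
      also have "1 / p + (1 - q) / q = 0" using q by (simp add: diff_divide_distrib)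
      finally have "g y = (s * g y * w y powr (1 / p)) * (w y powr ((1 - q) / q) / s)"
        using s elim by (simp add: field_simps)
      also have "\<dots> \<le> (s * g y * w y powr (1 / p)) powr p / p + (w y powr ((1 - q) / q) / s) powr q / q"
        by (rule Youngs_inequality) (use s g p q in auto)
      also have "\<dots> = s powr p / p * (g y powr p * w y) + s powr (- q) / q * ?\<sigma> y"
        unfolding e1 e2 by simp
      finally have "ennreal (g y) \<le> ennreal (s powr p / p * (g y powr p * w y) + s powr (- q) / q * ?\<sigma> y)"
        by (rule ennreal_leI)
      also have "\<dots> = ennreal (s powr p / p) * ennreal (g y powr p * w y) + ennreal (s powr (- q) / q) * ennreal (?\<sigma> y)"
      proof -
        have n: "0 \<le> s powr p / p" "0 \<le> g y powr p * w y" "0 \<le> s powr (- q) / q" "0 \<le> ?\<sigma> y"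
          using elim p q by (auto simp: dual_weight_def)
        show ?thesis
          by (simp only: ennreal_plus[OF mult_nonneg_nonneg[OF n(1,2)] mult_nonneg_nonneg[OF n(3,4)]]
              ennreal_mult[OF n(1,2)] ennreal_mult[OF n(3,4)])
      qed
      finally show ?case by (simp add: indicator_def)
    qed
    also have "\<dots> = ennreal (s powr p / p) * ennreal P + ennreal (s powr (- q) / q) * ennreal S"
      unfolding P(1)[symmetric] S(1)[symmetric] wmeas_def
      by (subst nn_integral_add) (auto simp: nn_integral_cmult)
    also have "\<dots> = ennreal (s powr p * P / p + s powr (- q) * S / q)"
      using P S p q by (simp add: ennreal_plus ennreal_mult'[symmetric])
    finally show ?thesis .
  qed
  consider "P = 0" | "S = 0" | "P > 0" "S > 0" using P S by linarith
  then show ?thesis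
  proof cases
    case 1
    then have "AE y in lborel. ennreal (g y powr p * w y) * indicator Q y = 0"
      using P(1) unfolding wmeas_def by (subst nn_integral_0_iff_AE[symmetric]) auto
    then have "AE y in lborel. ennreal (g y) * indicator Q y = 0"
      using w
    proof eventually_elim
      case (elim y)
      then show ?case using g[of y] by (auto simp: indicator_def ennreal_eq_0_iff mult_le_0_iff split: if_splits)
    qed
    then have "(\<integral>\<^sup>+y. ennreal (g y) * indicator Q y \<partial>lborel) = 0"
      by (subst nn_integral_0_iff_AE) auto
    then show ?thesis by simp
  next
    case 2
    then have "AE y in lborel. ennreal (?\<sigma> y) * indicator Q y = 0"
      using S(1) unfolding wmeas_def by (subst nn_integral_0_iff_AE[symmetric]) auto
    then have "AE y in lborel. ennreal (g y) * indicator Q y = 0"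
      using w
    proof eventually_elim
      case (elim y)
      then show ?case by (auto simp: indicator_def ennreal_eq_0_iff dual_weight_def split: if_splits)
    qed
    then have "(\<integral>\<^sup>+y. ennreal (g y) * indicator Q y \<partial>lborel) = 0"
      by (subst nn_integral_0_iff_AE) auto
    then show ?thesis by simp
  next
    case 3
    \<comment> \<open>This s equalises s^p P and s^(-q) S; it degenerates when P or S vanishes,
      hence the case distinction.\<close>
    define s where "s = (S / P) powr (1 / (p + q))"
    have s: "s > 0" using 3 by (simp add: s_def)
    have h: "1 - 1 / q = 1 / p" "1 - 1 / p = 1 / q" using q(2) by linarith+
    have pq1: "p / (p + q) = 1 / q" "q / (p + q) = 1 / p"
      unfolding pq using p q by auto
    have "s powr p * P = (S / P) powr (1 / q) * P"
      unfolding s_def powr_powr using pq1 by simp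
    also have "\<dots> = S powr (1 / q) * P powr (1 - 1 / q)"
      using 3 by (simp add: powr_divide powr_diff)
    finally have e1: "s powr p * P = P powr (1 / p) * S powr (1 / q)"
      unfolding h by (simp only: mult.commute)
    have "s powr (- q) * S = (S / P) powr (- (1 / p)) * S"
      unfolding s_def powr_powr using pq1 by simp
    also have "\<dots> = P powr (1 / p) * S powr (1 - 1 / p)"
      using 3 by (simp add: powr_divide powr_diff powr_minus field_simps)
    finally have e2: "s powr (- q) * S = P powr (1 / p) * S powr (1 / q)"
      unfolding h .
    have "s powr p * P / p + s powr (- q) * S / q = P powr (1 / p) * S powr (1 / q) * (1 / p + 1 / q)"
      unfolding e1 e2 by (simp add: distrib_left)
    then show ?thesis using young[OF s] q by simp
  qed
qed

locale weighted_grid = grid cell r for cell :: "nat \<Rightarrow> 'a::euclidean_space \<Rightarrow> 'a set" and r :: real +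
  fixes p :: real and w :: "'a \<Rightarrow> real" and X :: real
  assumes p: "1 < p" and w_measurable [measurable]: "w \<in> borel_measurable borel"
    and w_pos: "AE x in lborel. w x > 0"
    and w_fin: "wmeas w (cell i x) < top" and dual_fin: "wmeas (dual_weight p w) (cell i x) < top"
    and Ap: "enn2real (wmeas w (cell i x)) / vol i * (enn2real (wmeas (dual_weight p w) (cell i x)) / vol i) powr (p - 1) \<le> X"
begin

abbreviation hw :: "('a \<Rightarrow> real) \<Rightarrow> 'a set \<Rightarrow> ennreal" where
  "hw h \<equiv> wmeas (\<lambda>y. h y powr p * w y)"

text \<open>Hoelder bounds c |Q| by the weighted p-norm of g on Q and the dual mass of Q. Raising to
  the power p and multiplying by w(Q) produces the A_p quotient, which costs one factor X.\<close>

lemma Ap_Hoelder: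
  fixes g :: "'a \<Rightarrow> real"
  assumes [measurable]: "g \<in> borel_measurable borel" and g: "\<And>y. 0 \<le> g y" and c: "0 \<le> c"
    and P: "wmeas (\<lambda>y. g y powr p * w y) (cell k x) = ennreal P" "0 \<le> P"
    and le: "ennreal c \<le> En k (\<lambda>y. ennreal (g y)) x"
  shows "c powr p * enn2real (wmeas w (cell k x)) \<le> X * P"
proof -
  let ?Q = "cell k x"
  define S where "S = enn2real (wmeas (dual_weight p w) ?Q)"
  have S: "wmeas (dual_weight p w) ?Q = ennreal S" "0 \<le> S"
    using dual_fin[of k x] by (simp_all add: S_def)
  define V where "V = vol k"
  have V: "V > 0" by (simp add: V_def vol_pos)
  have "ennreal (c * V) = ennreal c * ennreal V" using c V by (simp add: ennreal_mult)
  also have "\<dots> \<le> En k (\<lambda>y. ennreal (g y)) x * ennreal V" by (intro mult_right_mono le) simp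
  also have "\<dots> = (\<integral>\<^sup>+y. ennreal (g y) * indicator ?Q y \<partial>lborel) * (ennreal (1 / vol k) * ennreal (vol k))"
    by (simp only: En_def V_def mult.assoc mult.commute mult.left_commute)
  also have "\<dots> \<le> ennreal (P powr (1 / p) * S powr ((p - 1) / p))"
    unfolding vol_cancel mult_1_right
    by (rule nn_Hoelder_dual_weight[OF p _ w_measurable _ g w_pos P S]) auto
  finally have "c * V \<le> P powr (1 / p) * S powr ((p - 1) / p)"
    by (subst (asm) ennreal_le_iff) auto
  then have "(c * V) powr p \<le> (P powr (1 / p) * S powr ((p - 1) / p)) powr p"
    using c V p by (intro powr_mono2) auto
  also have "\<dots> = P * S powr (p - 1)"
    using p P S by (simp add: powr_mult powr_powr)
  finally have *: "c powr p * V powr p \<le> P * S powr (p - 1)"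
    using c V by (simp add: powr_mult)
  have A: "enn2real (wmeas w ?Q) * S powr (p - 1) \<le> X * V powr p"
  proof -
    have e1: "S powr (p - 1) = (S / V) powr (p - 1) * V powr (p - 1)"
      using V by (simp add: powr_divide)
    have e2: "V powr p = V * V powr (p - 1)" using V by (simp add: powr_diff)
    have "enn2real (wmeas w ?Q) * S powr (p - 1)
        = (enn2real (wmeas w ?Q) / V * (S / V) powr (p - 1)) * (V * V powr (p - 1))"
      unfolding e1 using V by simp
    also have "\<dots> \<le> X * (V * V powr (p - 1))"
      using Ap[of k x] V unfolding S_def V_def by (intro mult_right_mono) auto
    finally show ?thesis unfolding e2 .
  qed
  have "(c powr p * enn2real (wmeas w ?Q)) * V powr p = enn2real (wmeas w ?Q) * (c powr p * V powr p)"
    by simp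
  also have "\<dots> \<le> enn2real (wmeas w ?Q) * (P * S powr (p - 1))"
    by (intro mult_left_mono *) simp
  also have "\<dots> = P * (enn2real (wmeas w ?Q) * S powr (p - 1))" by simp
  also have "\<dots> \<le> P * (X * V powr p)" by (intro mult_left_mono A P)
  also have "\<dots> = (X * P) * V powr p" by simp
  finally show ?thesis using V by (simp add: mult_le_cancel_right)
qed

lemma wmeas_cell_pos: "0 < enn2real (wmeas w (cell i x))"
proof -
  have "wmeas w (cell i x) \<noteq> 0"
  proof
    assume "wmeas w (cell i x) = 0"
    then have "AE y in lborel. ennreal (w y) * indicator (cell i x) y = 0"
      unfolding wmeas_def by (subst (asm) nn_integral_0_iff_AE) auto
    then have "AE y in lborel. y \<notin> cell i x"
      using w_pos by eventually_elim (auto simp: indicator_def ennreal_eq_0_iff split: if_splits)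
    then have "emeasure lborel (cell i x) = 0"
      by (subst (asm) AE_iff_measurable[of "cell i x"]) auto
    then show False using vol_pos[of i] by (simp add: cell_emeasure)
  qed
  then show ?thesis using w_fin[of i x] by (simp add: enn2real_positive_iff zero_less_iff_neq_zero)
qed

text \<open>Take g = 1 in \<open>Ap_Hoelder\<close> and divide by w(Q), which is positive and
  finite.\<close>

lemma X_ge_1: "1 \<le> X"
proof -
  have E1: "En 0 (\<lambda>y. 1) x = 1" for x
    using vol_cancel[of 0] by (simp add: En_def cell_emeasure)
  have "1 powr p * enn2real (wmeas w (cell 0 0)) \<le> X * enn2real (wmeas w (cell 0 0))"
    by (rule Ap_Hoelder[of "\<lambda>_. 1" 1 0]) (use w_fin[of 0 0] E1 in auto)
  then show ?thesis using wmeas_cell_pos[of 0 0] by simp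
qed

lemma Ap_average_le:
  fixes g :: "'a \<Rightarrow> real"
  assumes [measurable]: "g \<in> borel_measurable borel" and g: "\<And>y. 0 \<le> g y" and c: "0 \<le> c"
    and le: "ennreal c \<le> En k (\<lambda>y. ennreal (g y)) x"
  shows "ennreal (c powr p) * En k (\<lambda>y. ennreal (w y)) x \<le> ennreal X * En k (\<lambda>y. ennreal (g y powr p * w y)) x"
proof -
  let ?v = "\<lambda>y. g y powr p * w y"
  have E: "En k (\<lambda>y. ennreal (u y)) x = ennreal (1 / vol k) * wmeas u (cell k x)" for u :: "'a \<Rightarrow> real"
    by (simp add: En_def wmeas_def)
  have "ennreal (c powr p) * wmeas w (cell k x) \<le> ennreal X * wmeas ?v (cell k x)"
  proof (cases "wmeas ?v (cell k x) = top")
    case True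
    then show ?thesis using X_ge_1 by (simp add: ennreal_mult_top)
  next
    case False
    then obtain P where P: "wmeas ?v (cell k x) = ennreal P" "0 \<le> P"
      by (cases "wmeas ?v (cell k x)") auto
    from Ap_Hoelder[OF assms(1) g c P le]
    have "ennreal (c powr p * enn2real (wmeas w (cell k x))) \<le> ennreal (X * P)" by (rule ennreal_leI)
    then show ?thesis using w_fin[of k x] P X_ge_1 by (simp add: ennreal_mult)
  qed
  then have "ennreal (1 / vol k) * (ennreal (c powr p) * wmeas w (cell k x)) \<le> ennreal (1 / vol k) * (ennreal X * wmeas ?v (cell k x))"
    by (rule mult_left_mono) simp
  then show ?thesis unfolding E by (simp only: mult.left_commute)
qed

text \<open>The sum of \<open>Ap_Hoelder\<close> over the level k cells that make up U, carried out
  by integrating level k averages over U.\<close>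

lemma Ap_stopping_le:
  fixes g :: "'a \<Rightarrow> real"
  assumes [measurable]: "g \<in> borel_measurable borel" and g: "\<And>y. 0 \<le> g y" and c: "0 \<le> c"
    and U: "adapted k U" and le: "\<And>x. U x \<Longrightarrow> ennreal c \<le> En k (\<lambda>y. ennreal (g y)) x"
  shows "ennreal (c powr p) * wmeas w {x. U x} \<le> ennreal X * wmeas (\<lambda>y. g y powr p * w y) {x. U x}"
proof -
  let ?u = "indicator {x. U x} :: 'a \<Rightarrow> ennreal"
  have u_ad: "adapted k ?u" using U by (auto simp: adapted_def indicator_def)
  have [measurable]: "Measurable.pred borel U" by (rule adapted_pred[OF U])
  have wm: "wmeas v {x. U x} = (\<integral>\<^sup>+x. ?u x * En k (\<lambda>y. ennreal (v y)) x \<partial>lborel)"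
    if [measurable]: "v \<in> borel_measurable borel" for v :: "'a \<Rightarrow> real"
    unfolding wmeas_def by (subst nn_integral_En) (auto simp: u_ad mult.commute)
  have "ennreal (c powr p) * wmeas w {x. U x} = (\<integral>\<^sup>+x. ennreal (c powr p) * (?u x * En k (\<lambda>y. ennreal (w y)) x) \<partial>lborel)"
    by (subst nn_integral_cmult) (auto simp: wm)
  also have "\<dots> \<le> (\<integral>\<^sup>+x. ennreal X * (?u x * En k (\<lambda>y. ennreal (g y powr p * w y)) x) \<partial>lborel)"
    using Ap_average_le[OF _ g c le]
    by (intro nn_integral_mono) (auto simp: indicator_def)
  also have "\<dots> = ennreal X * wmeas (\<lambda>y. g y powr p * w y) {x. U x}"
    by (subst nn_integral_cmult) (auto simp: wm)
  finally show ?thesis .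
qed

end

section \<open>Counting functions of sparse families\<close>

lemma ennreal_divide_le:
  assumes "0 < c" "ennreal c * A \<le> B"
  shows "A \<le> ennreal (1 / c) * B"
proof -
  have "A = ennreal (1 / c) * (ennreal c * A)"
    using assms(1) by (simp add: mult.assoc[symmetric] ennreal_mult[symmetric])
  also have "\<dots> \<le> ennreal (1 / c) * B" by (intro mult_left_mono assms(2)) simp
  finally show ?thesis .
qed

text \<open>One group of sparse cubes, those on which h has average comparable to \<kappa>.
  Comparability within a factor 2 is what lets sparseness pass from Lebesgue measure to h.\<close>

locale sparse_family = weighted_grid cell r p w X
  for cell :: "nat \<Rightarrow> 'a::euclidean_space \<Rightarrow> 'a set" and r p w X +
  fixes h :: "'a \<Rightarrow> real" and L :: "nat \<Rightarrow> 'a \<Rightarrow> bool" and N :: nat and \<kappa> :: real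
  assumes h: "cellint h" and h_nonneg: "0 \<le> h y" and L_adapted: "adapted i (L i)" and \<kappa>: "\<kappa> > 0"
    and L_avg: "L i x \<Longrightarrow> \<kappa> / 2 < avg i h x \<and> avg i h x \<le> \<kappa>"
    and L_sparse: "L j x \<Longrightarrow> (LBINT y:cell j x. of_bool (\<exists>k. j < k \<and> k \<le> N \<and> L k y)) \<le> vol j / 4"
begin

definition later :: "nat \<Rightarrow> 'a \<Rightarrow> bool" where
  "later i y \<longleftrightarrow> (\<exists>k. i < k \<and> k \<le> N \<and> L k y)"

text \<open>For i < k: the level k cell of y is a maximal member below level i. For k \<le> N these
  cells partition the set where \<open>later i\<close> holds.\<close>

definition first :: "nat \<Rightarrow> nat \<Rightarrow> 'a \<Rightarrow> bool" where
  "first i k y \<longleftrightarrow> L k y \<and> (\<forall>m. i < m \<and> m < k \<longrightarrow> \<not> L m y)"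

definition count :: "'a \<Rightarrow> real" where
  "count x = (\<Sum>i\<le>N. of_bool (L i x))"

lemma L_measurable [measurable]: "Measurable.pred borel (L i)"
  by (rule adapted_pred[OF L_adapted])

lemma h_measurable [measurable]: "h \<in> borel_measurable borel"
  by (rule cellint_measurable[OF h])

lemma later_measurable [measurable]: "Measurable.pred borel (later i)"
  unfolding later_def by measurable

lemma first_measurable [measurable]: "Measurable.pred borel (first i k)"
  unfolding first_def by measurable

lemma adapted_first: "adapted k (\<lambda>y. of_bool (first i k y) :: real)"
proof -
  have "L m y = L m z" if "m \<le> k" "y \<in> cell k z" for m y z
    using adaptedD[OF adapted_mono[OF L_adapted that(1)] that(2)] .
  then have "first i k y = first i k z" if "y \<in> cell k z" for y z
    using that unfolding first_def by auto
  then show ?thesis unfolding adapted_def by auto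
qed

lemma later_eq_sum: "(of_bool (later i y) :: real) = (\<Sum>k=Suc i..N. of_bool (first i k y))"
proof (cases "later i y")
  case True
  then have ex: "\<exists>k. i < k \<and> L k y" unfolding later_def by blast
  define t where "t = (LEAST k. i < k \<and> L k y)"
  have t: "i < t" "L t y" using LeastI_ex[OF ex] unfolding t_def by auto
  have lt: "\<not> L m y" if "i < m" "m < t" for m
    using not_less_Least[of m "\<lambda>k. i < k \<and> L k y"] that unfolding t_def by blast
  have tN: "t \<le> N"
  proof -
    obtain k where "i < k" "k \<le> N" "L k y" using True unfolding later_def by blast
    then show ?thesis using lt by (meson leI le_trans)
  qed
  have "first i k y \<longleftrightarrow> k = t" if "i < k" for k
    using t lt that unfolding first_def by (metis linorder_neqE_nat)
  then have "(\<Sum>k=Suc i..N. of_bool (first i k y) :: real) = (\<Sum>k=Suc i..N. of_bool (k = t))"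
    by (intro sum.cong) auto
  also have "\<dots> = 1"
  proof -
    have "{Suc i..N} \<inter> {k. k = t} = {t}" using t tN by auto
    then show ?thesis by simp
  qed
  finally show ?thesis using True by simp
next
  case False
  then have "(\<Sum>k=Suc i..N. of_bool (first i k y) :: real) = 0"
    unfolding later_def first_def by (intro sum.neutral) auto
  then show ?thesis using False by simp
qed

lemma not_later_average:
  assumes L: "L i x"
  shows "ennreal (3 / 4) \<le> En i (\<lambda>y. ennreal (of_bool (\<not> later i y))) x"
proof -
  have c: "cellint (\<lambda>y. of_bool (\<not> later i y))"
    unfolding cellint_def by (auto intro!: bounded_set_integrable[where B = 1])
  have i1: "set_integrable lborel (cell i x) (\<lambda>_. 1::real)"
    by (rule bounded_set_integrable[where B = 1]) auto
  have i2: "set_integrable lborel (cell i x) (\<lambda>y. of_bool (later i y) :: real)"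
    by (rule bounded_set_integrable[where B = 1]) auto
  have "(LBINT y:cell i x. of_bool (\<not> later i y) :: real) = (LBINT y:cell i x. 1 - of_bool (later i y))"
    by (rule set_lebesgue_integral_cong) auto
  also have "\<dots> = vol i - (LBINT y:cell i x. of_bool (later i y))"
    using set_integral_diff(2)[OF i1 i2] set_integral_const_cell[of i x 1] by simp
  also have "\<dots> \<ge> vol i - vol i / 4"
    using L_sparse[OF L] unfolding later_def by (intro diff_left_mono)
  finally have "3 / 4 \<le> avg i (\<lambda>y. of_bool (\<not> later i y)) x"
    using vol_pos[of i] by (simp add: avg_def field_simps)
  then show ?thesis by (subst En_eq_avg[OF c]) auto
qed

text \<open>The later cells are covered by maximal ones of total volume at most a quarter, each with
  average at most \<kappa>. They remove at most \<kappa> / 4 from an average above \<kappa> /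
  2.\<close>

lemma h_not_later_average:
  assumes L: "L i x"
  shows "ennreal (\<kappa> / 4) \<le> En i (\<lambda>y. ennreal (h y * of_bool (\<not> later i y))) x"
proof -
  let ?Q = "cell i x"
  have hb: "set_integrable lborel (cell j z) (\<lambda>y. of_bool (P y) * h y)"
    if [measurable]: "Measurable.pred borel P" for P j z
    by (rule cellint_bounded_mult[OF h, where B = 1]) auto
  have c: "cellint (\<lambda>y. h y * of_bool (\<not> later i y))"
    unfolding cellint_def using hb[of "\<lambda>y. \<not> later i y" 0] by (simp add: mult.commute)
  have "(LBINT y:?Q. of_bool (later i y) * h y) = (LBINT y:?Q. \<Sum>k=Suc i..N. of_bool (first i k y) * h y)"
    by (simp only: later_eq_sum sum_distrib_right)
  also have "\<dots> = (\<Sum>k=Suc i..N. LBINT y:?Q. of_bool (first i k y) * h y)"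
    by (intro set_integral_sum hb) measurable
  also have "\<dots> \<le> (\<Sum>k=Suc i..N. LBINT y:?Q. \<kappa> * of_bool (first i k y))"
  proof (rule sum_mono)
    fix k assume k: "k \<in> {Suc i..N}"
    have b: "\<bar>of_bool (first i k y) :: real\<bar> \<le> 1" for y by simp
    have ik: "i \<le> k" using k by simp
    have "(LBINT y:?Q. of_bool (first i k y) * h y) = (LBINT y:?Q. of_bool (first i k y) * avg k h y)"
      by (rule set_integral_avg(2)[OF h ik adapted_first b, symmetric])
    also have "\<dots> \<le> (LBINT y:?Q. \<kappa> * of_bool (first i k y))"
    proof (rule set_integral_mono)
      show "set_integrable lborel ?Q (\<lambda>y. of_bool (first i k y) * avg k h y)"
        by (rule set_integral_avg(1)[OF h ik adapted_first b])
      show "set_integrable lborel ?Q (\<lambda>y. \<kappa> * of_bool (first i k y))"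
        by (rule bounded_set_integrable[where B = \<kappa>]) (use \<kappa> in auto)
      show "of_bool (first i k y) * avg k h y \<le> \<kappa> * of_bool (first i k y)" for y
        using L_avg[of k y] by (auto simp: first_def)
    qed
    finally show "(LBINT y:?Q. of_bool (first i k y) * h y) \<le> (LBINT y:?Q. \<kappa> * of_bool (first i k y))" .
  qed
  also have "\<dots> = \<kappa> * (LBINT y:?Q. of_bool (later i y))"
  proof -
    have "(LBINT y:?Q. of_bool (later i y) :: real) = (\<Sum>k=Suc i..N. LBINT y:?Q. of_bool (first i k y))"
      unfolding later_eq_sum by (intro set_integral_sum bounded_set_integrable[where B = 1]) auto
    then show ?thesis by (simp add: sum_distrib_left)
  qed
  also have "\<dots> \<le> \<kappa> * (vol i / 4)"
    using L_sparse[OF L] \<kappa> unfolding later_def by (intro mult_left_mono) auto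
  finally have up: "(LBINT y:?Q. of_bool (later i y) * h y) \<le> \<kappa> * vol i / 4" by simp
  have low: "\<kappa> / 2 * vol i \<le> (LBINT y:?Q. h y)"
    using L_avg[OF L] vol_pos[of i] by (simp add: avg_def field_simps)
  have "(LBINT y:?Q. h y * of_bool (\<not> later i y)) = (LBINT y:?Q. h y - of_bool (later i y) * h y)"
    by (rule set_lebesgue_integral_cong) auto
  also have "\<dots> = (LBINT y:?Q. h y) - (LBINT y:?Q. of_bool (later i y) * h y)"
    using cellint_set[OF h] hb by (intro set_integral_diff(2)) auto
  also have "\<dots> \<ge> \<kappa> / 4 * vol i" using up low by linarith
  finally have "\<kappa> / 4 \<le> avg i (\<lambda>y. h y * of_bool (\<not> later i y)) x"
    using vol_pos[of i] by (simp add: avg_def field_simps)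
  then have "ennreal (\<kappa> / 4) \<le> ennreal (avg i (\<lambda>y. h y * of_bool (\<not> later i y)) x)"
    by (rule ennreal_leI)
  then show ?thesis by (subst En_eq_avg[OF c]) (auto simp: h_nonneg)
qed

text \<open>Only the part of h outside the later cells enters on the right. These parts are disjoint
  for different levels, so summing over i produces no overlap.\<close>

lemma family_Ap_h:
  "wmeas w {x. L i x} \<le> ennreal ((4 / \<kappa>) powr p * X) * hw h {x. L i x \<and> \<not> later i x}"
proof -
  have "ennreal ((\<kappa> / 4) powr p) * wmeas w {x. L i x} \<le> ennreal X * wmeas (\<lambda>y. (h y * of_bool (\<not> later i y)) powr p * w y) {x. L i x}"
    using \<kappa> by (intro Ap_stopping_le[OF _ _ _ L_adapted h_not_later_average]) (auto simp: h_nonneg)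
  also have "wmeas (\<lambda>y. (h y * of_bool (\<not> later i y)) powr p * w y) {x. L i x} = hw h {x. L i x \<and> \<not> later i x}"
    unfolding wmeas_def by (intro nn_integral_cong) (auto simp: indicator_def)
  finally have "wmeas w {x. L i x} \<le> ennreal (1 / (\<kappa> / 4) powr p) * (ennreal X * hw h {x. L i x \<and> \<not> later i x})"
    using \<kappa> by (intro ennreal_divide_le) auto
  also have "1 / (\<kappa> / 4) powr p = (4 / \<kappa>) powr p" by (simp add: powr_divide)
  finally show ?thesis using X_ge_1 by (simp add: ennreal_mult mult.assoc)
qed

text \<open>The same argument with 1 in place of h. Since \<open>i \<le> k\<close>, the intersection
  is a union of level k cells.\<close>

lemma family_Ap_self:
  assumes "i \<le> k"
  shows "wmeas w {x. L i x \<and> L k x} \<le> ennreal ((4 / 3) powr p * X) * wmeas w {x. L i x \<and> L k x \<and> \<not> later k x}"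
proof -
  have ad: "adapted k (\<lambda>x. L i x \<and> L k x)"
    using adaptedD[OF adapted_mono[OF L_adapted assms]] adaptedD[OF L_adapted] unfolding adapted_def by blast
  have "ennreal ((3 / 4) powr p) * wmeas w {x. L i x \<and> L k x} \<le> ennreal X * wmeas (\<lambda>y. of_bool (\<not> later k y) powr p * w y) {x. L i x \<and> L k x}"
    by (rule Ap_stopping_le[OF _ _ _ ad not_later_average]) auto
  also have "wmeas (\<lambda>y. of_bool (\<not> later k y) powr p * w y) {x. L i x \<and> L k x} = wmeas w {x. L i x \<and> L k x \<and> \<not> later k x}"
    unfolding wmeas_def by (intro nn_integral_cong) (auto simp: indicator_def)
  finally have "wmeas w {x. L i x \<and> L k x} \<le> ennreal (1 / (3 / 4) powr p) * (ennreal X * wmeas w {x. L i x \<and> L k x \<and> \<not> later k x})"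
    by (intro ennreal_divide_le) auto
  also have "1 / (3 / 4) powr p = (4 / 3) powr p" by (simp add: powr_divide)
  finally show ?thesis using X_ge_1 by (simp add: ennreal_mult mult.assoc)
qed

text \<open>\<open>\<not> later k x\<close> singles out the last member level at x, so the sets are
  disjoint.\<close>

lemma sum_last_le:
  assumes [measurable]: "v \<in> borel_measurable borel" "Measurable.pred borel P"
  shows "(\<Sum>k=a..N. wmeas v {x. P x \<and> L k x \<and> \<not> later k x}) \<le> wmeas v {x. P x}"
proof (rule wmeas_disjoint_sum)
  have no: False if "L k x" "\<not> later m x" "m < k" "k \<le> N" for k m x
    using that unfolding later_def by blast
  show "disjoint_family_on (\<lambda>k. {x. P x \<and> L k x \<and> \<not> later k x}) {a..N}"
    unfolding disjoint_family_on_def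
  proof (intro ballI impI, rule ccontr)
    fix m k assume "m \<in> {a..N}" "k \<in> {a..N}" "m \<noteq> k"
      "{x. P x \<and> L m x \<and> \<not> later m x} \<inter> {x. P x \<and> L k x \<and> \<not> later k x} \<noteq> {}"
    then show False using no[of k _ m] no[of m _ k] by (cases m k rule: linorder_cases) auto
  qed
qed auto

lemma first_moment:
  "(\<Sum>i\<le>N. wmeas w {x. L i x}) \<le> ennreal ((4 / \<kappa>) powr p * X) * hw h UNIV"
proof -
  have "(\<Sum>i\<le>N. wmeas w {x. L i x}) \<le> (\<Sum>i=0..N. ennreal ((4 / \<kappa>) powr p * X) * hw h {x. True \<and> L i x \<and> \<not> later i x})"
    unfolding atMost_atLeast0 by (intro sum_mono) (simp add: family_Ap_h)
  also have "\<dots> \<le> ennreal ((4 / \<kappa>) powr p * X) * hw h {x. True}"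
    unfolding sum_distrib_left[symmetric] by (intro mult_left_mono sum_last_le) auto
  finally show ?thesis by simp
qed

text \<open>For fixed i the sum over k collapses, by \<open>family_Ap_self\<close> and disjointness,
  to the measure of the i-th set: squaring the counting function costs one more factor X.\<close>

lemma second_moment:
  "(\<Sum>i\<le>N. \<Sum>k=i..N. wmeas w {x. L i x \<and> L k x}) \<le> ennreal ((4 / 3) powr p * X) * (\<Sum>i\<le>N. wmeas w {x. L i x})"
  unfolding sum_distrib_left
proof (rule sum_mono)
  fix i
  have "(\<Sum>k=i..N. wmeas w {x. L i x \<and> L k x}) \<le> (\<Sum>k=i..N. ennreal ((4 / 3) powr p * X) * wmeas w {x. L i x \<and> L k x \<and> \<not> later k x})"
    by (intro sum_mono family_Ap_self) auto
  also have "\<dots> \<le> ennreal ((4 / 3) powr p * X) * wmeas w {x. L i x}"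
    unfolding sum_distrib_left[symmetric] by (intro mult_left_mono sum_last_le) auto
  finally show "(\<Sum>k=i..N. wmeas w {x. L i x \<and> L k x}) \<le> ennreal ((4 / 3) powr p * X) * wmeas w {x. L i x}" .
qed

section \<open>Distribution of the counting function from its moments\<close>

lemma sum_wmeas_eq:
  assumes "\<And>a. a \<in> A \<Longrightarrow> Measurable.pred borel (P a)"
  shows "(\<Sum>a\<in>A. wmeas w {x. P a x}) = (\<integral>\<^sup>+x. ennreal (w x) * ennreal (\<Sum>a\<in>A. of_bool (P a x)) \<partial>lborel)"
proof -
  have "(\<Sum>a\<in>A. wmeas w {x. P a x}) = (\<integral>\<^sup>+x. (\<Sum>a\<in>A. ennreal (w x) * indicator {x. P a x} x) \<partial>lborel)"
    unfolding wmeas_def by (rule nn_integral_sum[symmetric]) (use assms in \<open>auto simp: pred_def\<close>)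
  also have "\<dots> = (\<integral>\<^sup>+x. ennreal (w x) * ennreal (\<Sum>a\<in>A. of_bool (P a x)) \<partial>lborel)"
  proof (intro nn_integral_cong)
    fix x
    have "ennreal (\<Sum>a\<in>A. of_bool (P a x)) = (\<Sum>a\<in>A. indicator {x. P a x} x)"
      by (subst sum_ennreal[symmetric], simp, intro sum.cong refl) (simp add: indicator_def)
    then show "(\<Sum>a\<in>A. ennreal (w x) * indicator {x. P a x} x) = ennreal (w x) * ennreal (\<Sum>a\<in>A. of_bool (P a x))"
      by (simp only: sum_distrib_left)
  qed
  finally show ?thesis .
qed

lemma wmeas_Markov:
  assumes [measurable]: "Measurable.pred borel P" and "\<And>x. P x \<Longrightarrow> s \<le> u x"
  shows "ennreal s * wmeas w {x. P x} \<le> (\<integral>\<^sup>+x. ennreal (w x) * ennreal (u x) \<partial>lborel)"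
proof -
  have "ennreal s * wmeas w {x. P x} = (\<integral>\<^sup>+x. ennreal s * (ennreal (w x) * indicator {x. P x} x) \<partial>lborel)"
    unfolding wmeas_def by (rule nn_integral_cmult[symmetric]) auto
  also have "\<dots> \<le> (\<integral>\<^sup>+x. ennreal (w x) * ennreal (u x) \<partial>lborel)"
  proof (intro nn_integral_mono)
    fix x
    have "ennreal s * ennreal (w x) \<le> ennreal (u x) * ennreal (w x)" if "P x"
      by (intro mult_right_mono ennreal_leI assms(2) that) simp
    then show "ennreal s * (ennreal (w x) * indicator {x. P x} x) \<le> ennreal (w x) * ennreal (u x)"
      by (cases "P x") (simp_all add: mult.commute)
  qed
  finally show ?thesis .
qed

lemma count_measurable [measurable]: "count \<in> borel_measurable borel"
  unfolding count_def by measurable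

lemma count_square_le: "(count x)^2 \<le> 2 * (\<Sum>z\<in>(SIGMA i:{..N}. {i..N}). of_bool (L (fst z) x \<and> L (snd z) x))"
proof -
  let ?b = "\<lambda>i. of_bool (L i x) :: real"
  have "(count x)^2 = (\<Sum>i\<le>N. \<Sum>k\<le>N. ?b i * ?b k)"
    by (simp only: count_def power2_eq_square sum_product)
  also have "\<dots> \<le> (\<Sum>i\<le>N. \<Sum>k\<le>N. of_bool (i \<le> k) * (?b i * ?b k) + of_bool (k \<le> i) * (?b i * ?b k))"
    by (intro sum_mono) auto
  also have "\<dots> = (\<Sum>i\<le>N. \<Sum>k\<le>N. of_bool (i \<le> k) * (?b i * ?b k)) + (\<Sum>i\<le>N. \<Sum>k\<le>N. of_bool (k \<le> i) * (?b i * ?b k))"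
    by (simp only: sum.distrib)
  also have "(\<Sum>i\<le>N. \<Sum>k\<le>N. of_bool (k \<le> i) * (?b i * ?b k)) = (\<Sum>i\<le>N. \<Sum>k\<le>N. of_bool (i \<le> k) * (?b i * ?b k))"
    by (subst sum.swap) (simp only: mult.commute)
  also have "(\<Sum>i\<le>N. \<Sum>k\<le>N. of_bool (i \<le> k) * (?b i * ?b k)) = (\<Sum>i\<le>N. \<Sum>k=i..N. ?b i * ?b k)"
  proof (rule sum.cong[OF refl])
    fix i
    show "(\<Sum>k\<le>N. of_bool (i \<le> k) * (?b i * ?b k)) = (\<Sum>k=i..N. ?b i * ?b k)"
      by (rule sum.mono_neutral_cong_right) auto
  qed
  also have "\<dots> = (\<Sum>z\<in>(SIGMA i:{..N}. {i..N}). of_bool (L (fst z) x \<and> L (snd z) x))"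
    by (subst sum.Sigma, simp, simp, intro sum.cong refl) (simp only: split_beta of_bool_conj)
  finally show ?thesis by simp
qed

text \<open>Chebyshev with the first or the second moment, whichever is better at t. The constant
  \<open>2 * 4 powr p\<close> serves both: it absorbs the 2 from ordering pairs and dominates
  \<open>(4 / 3) powr p\<close>.\<close>

lemma count_weak:
  assumes t: "0 < t"
  shows "wmeas w {x. t < count x}
    \<le> ennreal (2 * 4 powr p * \<kappa> powr (- p) * X / t * min 1 (2 * 4 powr p * X / t)) * hw h UNIV"
proof -
  let ?I = "hw h UNIV" and ?E = "wmeas w {x. t < count x}"
  let ?c = "(4 / \<kappa>) powr p * X" and ?d = "(4 / 3) powr p * X"
  have c: "0 \<le> ?c" "0 \<le> ?d" using X_ge_1 by auto
  have ceq: "(4 / \<kappa>) powr p = 4 powr p * \<kappa> powr (- p)"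
    unfolding powr_divide powr_minus by (rule divide_inverse)
  have "ennreal t * ?E \<le> (\<Sum>i\<le>N. wmeas w {x. L i x})"
    by (subst sum_wmeas_eq, simp, rule wmeas_Markov) (use t in \<open>auto simp: count_def\<close>)
  also note first_moment
  finally have 1: "?E \<le> ennreal (1 / t) * (ennreal ?c * ?I)" using t by (intro ennreal_divide_le)
  have "ennreal (t^2 / 2) * ?E \<le> (\<Sum>z\<in>(SIGMA i:{..N}. {i..N}). wmeas w {x. L (fst z) x \<and> L (snd z) x})"
  proof (subst sum_wmeas_eq, simp, rule wmeas_Markov)
    fix x assume "t < count x"
    then have "t^2 \<le> (count x)^2" using t by (intro power_mono) auto
    then show "t^2 / 2 \<le> (\<Sum>z\<in>(SIGMA i:{..N}. {i..N}). of_bool (L (fst z) x \<and> L (snd z) x))"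
      using count_square_le[of x] by linarith
  qed auto
  also have "\<dots> = (\<Sum>i\<le>N. \<Sum>k=i..N. wmeas w {x. L i x \<and> L k x})"
    by (subst sum.Sigma) (auto simp: case_prod_beta')
  also have "\<dots> \<le> ennreal ?d * (ennreal ?c * ?I)"
    by (rule order_trans[OF second_moment]) (intro mult_left_mono first_moment, simp)
  finally have 2: "?E \<le> ennreal (1 / (t^2 / 2)) * (ennreal ?d * (ennreal ?c * ?I))"
    using t by (intro ennreal_divide_le) auto
  have c1: "1 / t * ?c \<le> 2 * 4 powr p * \<kappa> powr (- p) * X / t"
    unfolding ceq using X_ge_1 t \<kappa> by (simp add: field_simps)
  have c2: "1 / (t^2 / 2) * (?d * ?c) \<le> 2 * 4 powr p * \<kappa> powr (- p) * X / t * (2 * 4 powr p * X / t)"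
  proof -
    have "(4 / 3) powr p \<le> 2 * 4 powr p"
    proof -
      have "(4 / 3 :: real) powr p \<le> 4 powr p" using p by (intro powr_mono2) auto
      then show ?thesis using powr_ge_zero[of "4 :: real" p] by linarith
    qed
    then have "?d \<le> 2 * 4 powr p * X" using X_ge_1 by (intro mult_right_mono) auto
    then have "?d * ?c \<le> (2 * 4 powr p * X) * ?c" by (rule mult_right_mono) (rule c)
    then have "1 / (t^2 / 2) * (?d * ?c) \<le> 1 / (t^2 / 2) * ((2 * 4 powr p * X) * ?c)"
      by (rule mult_left_mono) simp
    also have "\<dots> = 2 * 4 powr p * \<kappa> powr (- p) * X / t * (2 * 4 powr p * X / t)"
      unfolding ceq by (simp add: power2_eq_square field_simps)
    finally show ?thesis .
  qed
  show ?thesis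
  proof (cases "1 \<le> 2 * 4 powr p * X / t")
    case True
    have "ennreal (1 / t) * (ennreal ?c * ?I) = ennreal (1 / t * ?c) * ?I"
      using t by (subst ennreal_mult'[of "1 / t"]) (simp_all add: mult.assoc)
    also have "\<dots> \<le> ennreal (2 * 4 powr p * \<kappa> powr (- p) * X / t * min 1 (2 * 4 powr p * X / t)) * ?I"
      using True c1 by (intro mult_right_mono ennreal_leI) auto
    finally show ?thesis using 1 by (rule order_trans[rotated])
  next
    case False
    have "ennreal (1 / (t^2 / 2)) * (ennreal ?d * (ennreal ?c * ?I)) = ennreal (1 / (t^2 / 2) * (?d * ?c)) * ?I"
      using c by (subst ennreal_mult'[of "1 / (t^2 / 2)"], simp, subst ennreal_mult'[of ?d], simp) (simp only: mult.assoc)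
    also have "\<dots> \<le> ennreal (2 * 4 powr p * \<kappa> powr (- p) * X / t * min 1 (2 * 4 powr p * X / t)) * ?I"
      using False c2 by (intro mult_right_mono ennreal_leI) auto
    finally show ?thesis using 2 by (rule order_trans[rotated])
  qed
qed

end

section \<open>Choice of thresholds\<close>

text \<open>The bound for the l-th counting function that results from averages of size 2^(-l) and threshold 4^l c(l).\<close>
definition level_bound :: "real \<Rightarrow> real \<Rightarrow> (nat \<Rightarrow> real) \<Rightarrow> nat \<Rightarrow> real" where
  "level_bound p X c l = 2 * 4 powr p * (1 / 2 ^ l) powr (- p) * X / (4 ^ l * c l) * min 1 (2 * 4 powr p * X / (4 ^ l * c l))"

lemma two_powr_mult: "(2 powr (a * real l) :: real) = (2 powr a) ^ l"
  by (simp add: powr_powr[symmetric] powr_realpow)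

lemma level_bound_eq:
  "level_bound p X c l = (2 powr p) ^ l * (2 * 4 powr p * X / (4 ^ l * c l) * min 1 (2 * 4 powr p * X / (4 ^ l * c l)))"
proof -
  have "(1 / 2 ^ l) powr (- p) = (2 powr p) ^ l"
  proof -
    have "(1 / 2 ^ l :: real) = 2 powr (- real l)" by (simp add: powr_minus powr_realpow divide_inverse)
    then show ?thesis using two_powr_mult[of p l] by (simp add: powr_powr mult.commute)
  qed
  then show ?thesis by (simp add: level_bound_def)
qed

text \<open>\<open>\<tau>\<close>^2 = 2^p / 4 is the decay of the first moment bound before division
  by c. One factor \<tau> per level is spent on making c summable, the other sums the
  bounds.\<close>

lemma thresholds_subcritical:
  fixes p X :: real
  assumes p: "1 < p" "p < 2" and X: "1 \<le> X"
  defines "\<tau> \<equiv> 2 powr (- (2 - p) / 2)"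
  shows "\<exists>c. (\<forall>l. 0 < c l) \<and> (\<forall>F. finite F \<longrightarrow> sum c F \<le> 1) \<and>
    (\<forall>n. (\<Sum>l<n. level_bound p X c l) \<le> 2 * 4 powr p / (1 - \<tau>)^2 * X)"
proof (intro exI conjI allI impI)
  have \<tau>: "0 < \<tau>" "\<tau> < 1" using p by (auto simp: \<tau>_def powr_less_one)
  define c where "c l = (1 - \<tau>) * \<tau> ^ l" for l :: nat
  show c0: "0 < c l" for l using \<tau> by (simp add: c_def)
  show "sum c F \<le> 1" if "finite F" for F
  proof -
    have "sum c F = (1 - \<tau>) * (\<Sum>l\<in>F. \<tau> ^ l)" unfolding c_def sum_distrib_left ..
    also have "\<dots> \<le> (1 - \<tau>) * (1 / (1 - \<tau>))"
      using sum_power_inj_le[of \<tau> F id] \<tau> that by (intro mult_left_mono) auto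
    finally show ?thesis using \<tau> by simp
  qed
  let ?D = "2 * 4 powr p"
  have le: "level_bound p X c l \<le> ?D * X / (1 - \<tau>) * \<tau> ^ l" for l
  proof -
    have "\<tau> * \<tau> = 2 powr (- (2 - p) / 2 + - (2 - p) / 2)" unfolding \<tau>_def by (rule powr_add[symmetric])
    also have "- (2 - p) / 2 + - (2 - p) / 2 = p - 2" by (subst field_sum_of_halves) simp
    also have "2 powr (p - 2) = 2 powr p / 4" by (simp add: powr_diff)
    finally have "(2 powr p) = 4 * (\<tau> * \<tau>)" by simp
    then have e: "(2 powr p) ^ l = 4 ^ l * (\<tau> ^ l * \<tau> ^ l)" by (simp add: power_mult_distrib)
    have "level_bound p X c l \<le> (2 powr p) ^ l * (?D * X / (4 ^ l * c l) * 1)"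
      unfolding level_bound_eq using X c0[of l] by (intro mult_left_mono) auto
    also have "\<dots> = ?D * X / (1 - \<tau>) * \<tau> ^ l"
      using \<tau> by (simp add: e c_def)
    finally show ?thesis .
  qed
  show "(\<Sum>l<n. level_bound p X c l) \<le> ?D / (1 - \<tau>)^2 * X" for n
  proof -
    have "(\<Sum>l<n. level_bound p X c l) \<le> ?D * X / (1 - \<tau>) * (\<Sum>l<n. \<tau> ^ l)"
      unfolding sum_distrib_left by (rule sum_mono[OF le])
    also have "\<dots> \<le> ?D * X / (1 - \<tau>) * (1 / (1 - \<tau>))"
      using sum_power_inj_le[of \<tau> "{..<n}" id] \<tau> X by (intro mult_left_mono) auto
    finally show ?thesis by (simp add: power2_eq_square mult_ac)
  qed
qed

text \<open>Interpolates between the first moment, a = 1, and the second, a = 2.\<close>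

lemma mult_min_le_powr:
  fixes y a :: real
  assumes "0 < y" "1 \<le> a" "a \<le> 2"
  shows "y * min 1 y \<le> y powr a"
proof (cases "y \<le> 1")
  case True
  have "y * min 1 y = y powr 2" using True assms by (simp add: power2_eq_square)
  also have "\<dots> \<le> y powr a" using True assms by (intro powr_mono') auto
  finally show ?thesis .
next
  case False
  then have "y * min 1 y = y powr 1" using assms by simp
  also have "\<dots> \<le> y powr a" using False assms by (intro powr_mono) auto
  finally show ?thesis .
qed

text \<open>Up to level L every level costs the same, so c is constant there. Above L the second
  moment gains 2^((p - 4) l): the first L of these factors turn X^2 into X^(p/2), the others pay for
  the decay of c and sum the series.\<close>

lemma thresholds_supercritical:
  fixes p X :: real
  assumes p: "2 \<le> p" "p < 3" and X: "1 \<le> X"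
  defines "\<rho> \<equiv> 2 powr (- 1 / 4)" and "\<eta> \<equiv> 2 powr (- 1 / 2)"
  shows "\<exists>c. (\<forall>l. 0 < c l) \<and> (\<forall>F. finite F \<longrightarrow> sum c F \<le> 1) \<and>
    (\<forall>n. (\<Sum>l<n. level_bound p X c l) \<le>
      ((4 * 4 powr p) powr (p / 2) * 2 powr p + 4 * (2 * 4 powr p)^2 / (1 - \<rho>)^2 / (1 - \<eta>))
        * X powr (p / 2) * (1 + ln X) powr p)"
proof (intro exI conjI allI impI)
  have \<rho>: "0 < \<rho>" "\<rho> < 1" and \<eta>: "0 < \<eta>" "\<eta> < 1" by (auto simp: \<rho>_def \<eta>_def powr_less_one)
  define L where "L = nat \<lceil>ln X\<rceil>"
  define \<Lambda> where "\<Lambda> = real L + 1"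
  have lnX: "0 \<le> ln X" using X by simp
  have L1: "ln X \<le> real L" and L2: "real L \<le> ln X + 1"
    using lnX unfolding L_def by linarith+
  have \<Lambda>: "1 \<le> \<Lambda>" "\<Lambda> \<le> 2 * (1 + ln X)" using L2 lnX by (auto simp: \<Lambda>_def)
  \<comment> \<open>A number of levels given by the natural logarithm is enough because e \<le>
    4.\<close>
  have XL: "X \<le> 4 ^ L"
  proof -
    have "X = exp (ln X)" using X by simp
    also have "\<dots> \<le> exp (real L)" using L1 by simp
    also have "\<dots> = exp 1 ^ L" by (simp add: exp_of_nat_mult[symmetric])
    also have "\<dots> \<le> 4 ^ L" using exp_le by (intro power_mono) auto
    finally show ?thesis .
  qed
  let ?D = "2 * 4 powr p :: real"
  have D: "?D > 0" by simp
  \<comment> \<open>Each range gets total mass at most 1/2: the first has L + 1 = \<Lambda> levels,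
    the second is a geometric tail.\<close>
  define c where "c l = (if l \<le> L then 1 / (2 * \<Lambda>) else (1 - \<rho>) / 2 * \<rho> ^ (l - L))" for l :: nat
  show c0: "0 < c l" for l using \<rho> \<Lambda> by (simp add: c_def)
  show "sum c F \<le> 1" if F: "finite F" for F
  proof -
    have "sum c F = sum c (F \<inter> {..L}) + sum c (F - {..L})"
      using F by (simp add: sum.Int_Diff)
    also have "sum c (F \<inter> {..L}) \<le> (\<Sum>l\<in>{..L}. 1 / (2 * \<Lambda>))"
    proof -
      have "sum c (F \<inter> {..L}) = (\<Sum>l\<in>F \<inter> {..L}. 1 / (2 * \<Lambda>))" by (intro sum.cong) (auto simp: c_def)
      also have "\<dots> \<le> (\<Sum>l\<in>{..L}. 1 / (2 * \<Lambda>))" using \<Lambda> by (intro sum_mono2) auto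
      finally show ?thesis .
    qed
    also have "(\<Sum>l\<in>{..L}. 1 / (2 * \<Lambda>)) = 1 / 2" using \<Lambda> by (simp add: \<Lambda>_def field_simps)
    also have "sum c (F - {..L}) \<le> 1 / 2"
    proof -
      have "sum c (F - {..L}) = (1 - \<rho>) / 2 * (\<Sum>l\<in>F - {..L}. \<rho> ^ (l - L))"
        unfolding sum_distrib_left by (intro sum.cong) (auto simp: c_def)
      also have "\<dots> \<le> (1 - \<rho>) / 2 * (1 / (1 - \<rho>))"
        using \<rho> F by (intro mult_left_mono sum_power_inj_le) (auto simp: inj_on_def)
      also have "\<dots> = 1 / 2" using \<rho> by simp
      finally show ?thesis .
    qed
    finally show ?thesis by simp
  qed
  let ?A = "(2 * ?D * \<Lambda> * X) powr (p / 2)"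
  let ?K = "4 * ?D^2 / (1 - \<rho>)^2"
  have low: "level_bound p X c l \<le> ?A" if l: "l \<le> L" for l
  proof -
    let ?y = "?D * X / (4 ^ l * c l)"
    have y: "?y > 0" using X c0[of l] by simp
    have "level_bound p X c l \<le> (2 powr p) ^ l * ?y powr (p / 2)"
      unfolding level_bound_eq using p by (intro mult_left_mono mult_min_le_powr y) auto
    also have "?y = (2 * ?D * \<Lambda> * X) / 4 ^ l" using l \<Lambda> by (simp add: c_def)
    also have "((2 * ?D * \<Lambda> * X) / 4 ^ l) powr (p / 2) = ?A / (2 powr p) ^ l"
    proof -
      have "(4 ^ l :: real) powr (p / 2) = (2 powr p) ^ l"
      proof -
        have "(4 ^ l :: real) = 2 powr (2 * real l)"
          using two_powr_mult[of 2 l] by simp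
        then show ?thesis using two_powr_mult[of p l] by (simp add: powr_powr mult.commute)
      qed
      then show ?thesis by (simp only: powr_divide)
    qed
    also have "(2 powr p) ^ l * (?A / (2 powr p) ^ l) = ?A" by simp
    finally show ?thesis .
  qed
  have high: "level_bound p X c l \<le> ?K * X powr (p / 2) * \<eta> ^ (l - L)" if l: "L < l" for l
  proof -
    define d where "d = l - L"
    have ld: "l = L + d" using l by (simp add: d_def)
    let ?y = "?D * X / (4 ^ l * c l)"
    have y: "?y > 0" using X c0[of l] by simp
    have cl: "c l = (1 - \<rho>) / 2 * \<rho> ^ d" using l by (simp add: c_def d_def)
    have rr: "\<rho>^2 = \<eta>" by (simp add: \<rho>_def \<eta>_def power2_eq_square powr_add[symmetric])
    have ee: "\<eta> * \<eta> = 1 / 2"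
    proof -
      have "\<eta> * \<eta> = 2 powr (- 1 / 2 + - 1 / 2)" unfolding \<eta>_def by (rule powr_add[symmetric])
      then show ?thesis by (simp add: powr_minus)
    qed
    \<comment> \<open>The net factor 2^p / 16 per level of the second moment bound. From p < 3 one
      gets q \<le> 1/2 = \<eta>^2, and c_l^2 takes away one \<eta> per level, so one \<eta> is
      left.\<close>
    define q where "q = (2 powr (p - 4) :: real)"
    have q: "2 powr p = 16 * q" by (simp add: q_def powr_diff)
    have q0: "0 < q" by (simp add: q_def)
    have qh: "q \<le> 1 / 2"
    proof -
      have "q \<le> 2 powr (- 1)" unfolding q_def using p by (intro powr_mono) auto
      then show ?thesis by (simp add: powr_minus)
    qed
    have qL: "q ^ L \<le> X powr ((p - 4) / 2)"
    proof -
      have "q ^ L = (4 ^ L) powr ((p - 4) / 2)"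
      proof -
        have "(4 ^ L :: real) = 2 powr (2 * real L)"
          using two_powr_mult[of 2 L] by simp
        then show ?thesis using two_powr_mult[of "p - 4" L] by (simp add: q_def powr_powr mult.commute)
      qed
      also have "\<dots> \<le> X powr ((p - 4) / 2)" using XL X p by (intro powr_mono2') auto
      finally show ?thesis .
    qed
    have "level_bound p X c l \<le> (2 powr p) ^ l * (?y * ?y)"
      unfolding level_bound_eq using y by (intro mult_left_mono) auto
    also have "\<dots> = (2 powr p) ^ l * (?D^2 * X^2 / (16 ^ l * (c l)^2))"
    proof -
      have "(16 ^ l :: real) = 4 ^ l * 4 ^ l" by (simp add: power_mult_distrib[symmetric])
      then show ?thesis by (simp add: power2_eq_square mult_ac)
    qed
    also have "\<dots> = q ^ l * (?D^2 * X^2 / (c l)^2)"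
      by (simp add: q power_mult_distrib)
    also have "(c l)^2 = (1 - \<rho>)^2 / 4 * \<eta> ^ d"
      unfolding cl rr[symmetric] by (simp add: power_mult_distrib power_divide power_mult[symmetric] mult.commute)
    also have "q ^ l * (?D^2 * X^2 / ((1 - \<rho>)^2 / 4 * \<eta> ^ d)) = ?K * (X^2 * q ^ L) * (q ^ d / \<eta> ^ d)"
      by (simp add: ld power_add field_simps)
    also have "\<dots> \<le> ?K * (X^2 * X powr ((p - 4) / 2)) * \<eta> ^ d"
    proof (intro mult_mono mult_left_mono qL)
      have "q ^ d / \<eta> ^ d = (q / \<eta>) ^ d" by (simp add: power_divide)
      also have "\<dots> \<le> \<eta> ^ d"
        using q0 \<eta> qh ee by (intro power_mono) (auto simp: field_simps)
      finally show "q ^ d / \<eta> ^ d \<le> \<eta> ^ d" .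
    qed (use q0 \<eta> in auto)
    also have "X^2 * X powr ((p - 4) / 2) = X powr (p / 2)"
    proof -
      have "X^2 = X powr 2" using X by simp
      moreover have "2 + (p - 4) / 2 = p / 2" by (simp add: field_simps)
      ultimately show ?thesis by (simp only: powr_add[symmetric])
    qed
    finally show ?thesis by (simp add: d_def)
  qed
  have nn: "0 \<le> ?K" using \<rho> by simp
  have lnp: "1 \<le> (1 + ln X) powr p" using lnX p by (intro ge_one_powr_ge_zero) auto
  fix n
  have "(\<Sum>l<n. level_bound p X c l) = (\<Sum>l\<in>{..<n} \<inter> {..L}. level_bound p X c l) + (\<Sum>l\<in>{..<n} - {..L}. level_bound p X c l)"
    by (rule sum.Int_Diff) simp
  also have "\<dots> \<le> (\<Sum>l\<in>{..<n} \<inter> {..L}. ?A) + (\<Sum>l\<in>{..<n} - {..L}. ?K * X powr (p / 2) * \<eta> ^ (l - L))"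
    by (intro add_mono sum_mono low high) auto
  also have "\<dots> \<le> (\<Sum>l\<in>{..L}. ?A) + ?K * X powr (p / 2) * (1 / (1 - \<eta>))"
    unfolding sum_distrib_left[symmetric] using \<eta> nn
    by (intro add_mono sum_mono2 mult_left_mono sum_power_inj_le) (auto simp: inj_on_def)
  also have "(\<Sum>l\<in>{..L}. ?A) = \<Lambda> * ?A" by (simp add: \<Lambda>_def)
  also have "\<Lambda> * ?A = (2 * ?D) powr (p / 2) * X powr (p / 2) * (\<Lambda> powr 1 * \<Lambda> powr (p / 2))"
    using \<Lambda> X by (simp add: powr_mult)
  also have "\<Lambda> powr 1 * \<Lambda> powr (p / 2) = \<Lambda> powr (1 + p / 2)" by (rule powr_add[symmetric])
  also have "(2 * ?D) powr (p / 2) * X powr (p / 2) * \<Lambda> powr (1 + p / 2) \<le> (2 * ?D) powr (p / 2) * X powr (p / 2) * (2 powr p * (1 + ln X) powr p)"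
  proof (intro mult_left_mono)
    have "\<Lambda> powr (1 + p / 2) \<le> \<Lambda> powr p" using \<Lambda> p by (intro powr_mono) auto
    also have "\<dots> \<le> (2 * (1 + ln X)) powr p" using \<Lambda> p by (intro powr_mono2) auto
    also have "\<dots> = 2 powr p * (1 + ln X) powr p" by (rule powr_mult)
    finally show "\<Lambda> powr (1 + p / 2) \<le> 2 powr p * (1 + ln X) powr p" .
  qed auto
  also have "?K * X powr (p / 2) * (1 / (1 - \<eta>)) \<le> ?K * X powr (p / 2) * (1 / (1 - \<eta>)) * (1 + ln X) powr p"
    using nn \<eta> lnp mult_left_mono[OF lnp, of "?K * X powr (p / 2) * (1 / (1 - \<eta>))"] by simp
  finally show "(\<Sum>l<n. level_bound p X c l) \<le>
      ((4 * 4 powr p) powr (p / 2) * 2 powr p + 4 * (2 * 4 powr p)^2 / (1 - \<rho>)^2 / (1 - \<eta>))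
        * X powr (p / 2) * (1 + ln X) powr p"
    by (simp add: algebra_simps)
qed

lemma thresholds:
  fixes p :: real
  assumes p: "1 < p" "p < 3"
  shows "\<exists>C\<ge>0. \<forall>X\<ge>1. \<exists>c. (\<forall>l. 0 < c l) \<and> (\<forall>F. finite F \<longrightarrow> sum c F \<le> 1) \<and>
    (\<forall>n. (\<Sum>l<n. level_bound p X c l) \<le> C * X powr (max (p / 2) 1) * phi_p p X powr p)"
proof (cases "p < 2")
  case True
  then have m: "max (p / 2) 1 = 1" by simp
  show ?thesis
    unfolding m using thresholds_subcritical[OF p(1) True] True
    by (intro exI[of _ "2 * 4 powr p / (1 - 2 powr (- (2 - p) / 2))^2"]) (auto simp: phi_p_def)
next
  case False
  then have m: "max (p / 2) 1 = p / 2" by simp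
  have nn: "0 \<le> 1 - 2 powr (- 1 / 2 :: real)" using powr_less_one[of 2 "- 1 / 2"] by simp
  show ?thesis
    unfolding m using thresholds_supercritical[OF _ p(2)] False nn
    by (intro exI[of _ "(4 * 4 powr p) powr (p / 2) * 2 powr p + 4 * (2 * 4 powr p)^2 / (1 - 2 powr (- 1 / 4))^2 / (1 - 2 powr (- 1 / 2))"])
       (auto simp: phi_p_def)
qed

section \<open>Weak-type bound for sparse square functions\<close>

lemma dyadic_level_exists:
  fixes m :: real
  assumes "0 < m" "m \<le> 1"
  shows "\<exists>l. 1 / 2 ^ l / 2 < m \<and> m \<le> 1 / 2 ^ l"
proof -
  obtain n where n: "(1 / 2) ^ n < m" using real_arch_pow_inv[OF assms(1), of "1 / 2"] by auto
  define t where "t = (LEAST n. (1 / 2) ^ n < m)"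
  have t: "(1 / 2) ^ t < m" unfolding t_def by (rule LeastI[of _ n]) (rule n)
  have "t \<noteq> 0" using t assms(2) by (cases t) auto
  then obtain l where l: "t = Suc l" by (cases t) auto
  have "\<not> (1 / 2) ^ l < m"
    using not_less_Least[of l "\<lambda>n. (1 / 2) ^ n < m"] l unfolding t_def by simp
  then show ?thesis using t l by (intro exI[of _ l]) (auto simp: power_divide)
qed

lemma wmeas_countable_subadditive:
  fixes E :: "nat \<Rightarrow> 'a::euclidean_space set"
  assumes v: "v \<in> borel_measurable borel" and E: "\<And>l. E l \<in> sets borel"
  shows "wmeas v (\<Union>l. E l) \<le> (\<Sum>l. wmeas v (E l))"
proof -
  let ?M = "density lborel (\<lambda>x. ennreal (v x))"
  have "wmeas v (\<Union>l. E l) = emeasure ?M (\<Union>l. E l)"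
    using E by (intro wmeas_emeasure v) auto
  also have "\<dots> \<le> (\<Sum>l. emeasure ?M (E l))"
    by (rule emeasure_subadditive_countably) (use E in auto)
  also have "\<dots> = (\<Sum>l. wmeas v (E l))" by (simp only: wmeas_emeasure[OF v E])
  finally show ?thesis .
qed

lemma wmeas_Un_le:
  assumes v: "v \<in> borel_measurable borel" and E: "E \<in> sets borel" "F \<in> sets borel"
  shows "wmeas v (E \<union> F) \<le> wmeas v E + wmeas v F"
  using emeasure_subadditive[of E "density lborel (\<lambda>x. ennreal (v x))" F] E
  by (simp add: wmeas_emeasure[OF v])

context weighted_grid
begin

text \<open>Split by the first level at which the average exceeds 1. The pieces are disjoint unions
  of cells, so \<open>Ap_stopping_le\<close> sums without loss.\<close>

lemma maximal_weak:
  assumes h: "cellint h" and h0: "\<And>y. 0 \<le> h y"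
  shows "wmeas w {x. \<exists>i\<le>N. 1 < avg i h x} \<le> ennreal X * hw h UNIV"
proof -
  define U where "U i x \<longleftrightarrow> 1 < avg i h x \<and> (\<forall>k<i. \<not> 1 < avg k h x)" for i x
  have [measurable]: "h \<in> borel_measurable borel" by (rule cellint_measurable[OF h])
  have U_ad: "adapted i (U i)" for i
  proof -
    have "avg k h y = avg k h x" if "k \<le> i" "y \<in> cell i x" for k x y
      using adaptedD[OF adapted_mono[OF adapted_avg that(1)] that(2)] .
    then show ?thesis unfolding adapted_def U_def by auto
  qed
  have [measurable]: "Measurable.pred borel (U i)" for i by (rule adapted_pred[OF U_ad])
  have one: "wmeas w {x. U i x} \<le> ennreal X * hw h {x. U i x}" for i
  proof -
    have "ennreal (1 powr p) * wmeas w {x. U i x} \<le> ennreal X * hw h {x. U i x}"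
    proof (rule Ap_stopping_le[OF _ h0 _ U_ad])
      show "ennreal 1 \<le> En i (\<lambda>y. ennreal (h y)) x" if "U i x" for x
        unfolding En_eq_avg[OF h h0] using that by (intro ennreal_leI) (simp add: U_def)
    qed auto
    then show ?thesis by simp
  qed
  have "{x. \<exists>i\<le>N. 1 < avg i h x} \<subseteq> (\<Union>i\<le>N. {x. U i x})"
  proof
    fix x assume "x \<in> {x. \<exists>i\<le>N. 1 < avg i h x}"
    then obtain i where i: "i \<le> N" "1 < avg i h x" by auto
    define t where "t = (LEAST i. 1 < avg i h x)"
    have "1 < avg t h x" unfolding t_def by (rule LeastI[of _ i]) (rule i)
    moreover have "\<forall>k<t. \<not> 1 < avg k h x" using not_less_Least unfolding t_def by blast
    moreover have "t \<le> N" using Least_le[of "\<lambda>i. 1 < avg i h x" i] i unfolding t_def by simp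
    ultimately show "x \<in> (\<Union>i\<le>N. {x. U i x})" unfolding U_def by blast
  qed
  then have "wmeas w {x. \<exists>i\<le>N. 1 < avg i h x} \<le> wmeas w (\<Union>i\<le>N. {x. U i x})" by (rule wmeas_mono)
  also have "\<dots> \<le> (\<Sum>i\<le>N. wmeas w {x. U i x})"
  proof -
    have E: "{x. U i x} \<in> sets borel" for i by auto
    then have "(\<Union>i\<le>N. {x. U i x}) \<in> sets borel" by (intro sets.finite_UN) auto
    with E show ?thesis
      using emeasure_subadditive_finite[of "{..N}" "\<lambda>i. {x. U i x}" "density lborel (\<lambda>x. ennreal (w x))"]
      by (simp add: wmeas_emeasure image_subset_iff)
  qed
  also have "\<dots> \<le> ennreal X * (\<Sum>i\<le>N. hw h {x. U i x})"
    unfolding sum_distrib_left by (rule sum_mono[OF one])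
  also have "\<dots> \<le> ennreal X * hw h UNIV"
  proof (intro mult_left_mono wmeas_disjoint_sum)
    have "m = n" if "U m x" "U n x" for m n x
      using that unfolding U_def by (metis linorder_neqE_nat)
    then show "disjoint_family_on (\<lambda>i. {x. U i x}) {..N}"
      unfolding disjoint_family_on_def by auto
  qed auto
  finally show ?thesis .
qed

text \<open>If all averages are at most 1 and no count exceeds its threshold, the sum is at most
  \<Sum> 4^(-l) 4^l c_l \<le> 1. The level set is therefore covered by the exceptional
  events.\<close>

lemma sparse_weak:
  assumes h: "cellint h" and h0: "\<And>y. 0 \<le> h y" and S_ad: "\<And>i. adapted i (S i)"
    and S_sparse: "\<And>j x. S j x \<Longrightarrow> (LBINT y:cell j x. of_bool (\<exists>k. j < k \<and> k \<le> N \<and> S k y)) \<le> vol j / 4"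
    and c: "\<And>l. 0 < c l" "\<And>F. finite F \<Longrightarrow> sum c F \<le> 1"
    and B: "\<And>n. (\<Sum>l<n. level_bound p X c l) \<le> B"
  shows "wmeas w {x. 1 < (\<Sum>i\<le>N. of_bool (S i x) * (avg i h x)^2)} \<le> ennreal (X + B) * hw h UNIV"
proof -
  let ?I = "hw h UNIV"
  define L where "L l i x \<longleftrightarrow> S i x \<and> 1 / 2 ^ l / 2 < avg i h x \<and> avg i h x \<le> 1 / 2 ^ l" for l i x
  have [measurable]: "h \<in> borel_measurable borel" by (rule cellint_measurable[OF h])
  have [measurable]: "Measurable.pred borel (S i)" for i by (rule adapted_pred[OF S_ad])
  have [measurable]: "Measurable.pred borel (L l i)" for l i unfolding L_def by measurable
  have fam: "sparse_family cell r p w X h (L l) N (1 / 2 ^ l)" for l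
  proof unfold_locales
    show "adapted i (L l i)" for i
      unfolding L_def adapted_def using adaptedD[OF S_ad] adaptedD[OF adapted_avg] by metis
    fix j x assume L: "L l j x"
    have "(LBINT y:cell j x. of_bool (\<exists>k. j < k \<and> k \<le> N \<and> L l k y) :: real)
       \<le> (LBINT y:cell j x. of_bool (\<exists>k. j < k \<and> k \<le> N \<and> S k y))"
      by (intro set_integral_mono bounded_set_integrable[where B = 1]) (auto simp: L_def)
    also have "\<dots> \<le> vol j / 4" by (rule S_sparse) (use L in \<open>simp add: L_def\<close>)
    finally show "(LBINT y:cell j x. of_bool (\<exists>k. j < k \<and> k \<le> N \<and> L l k y) :: real) \<le> vol j / 4" .
  qed (use h h0 in \<open>auto simp: L_def\<close>)
  define cnt where "cnt l x = (\<Sum>i\<le>N. of_bool (L l i x) :: real)" for l x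
  have [measurable]: "cnt l \<in> borel_measurable borel" for l unfolding cnt_def by measurable
  have lev: "wmeas w {x. 4 ^ l * c l < cnt l x} \<le> ennreal (level_bound p X c l) * ?I" for l
    using sparse_family.count_weak[OF fam, of "4 ^ l * c l" l] c(1)[of l]
    unfolding level_bound_def cnt_def sparse_family.count_def[OF fam] by simp
  have sub: "{x. 1 < (\<Sum>i\<le>N. of_bool (S i x) * (avg i h x)^2)} \<subseteq> {x. \<exists>i\<le>N. 1 < avg i h x} \<union> (\<Union>l. {x. 4 ^ l * c l < cnt l x})"
  proof (rule subsetI, rule ccontr)
    fix x assume x: "x \<in> {x. 1 < (\<Sum>i\<le>N. of_bool (S i x) * (avg i h x)^2)}"
      and "x \<notin> {x. \<exists>i\<le>N. 1 < avg i h x} \<union> (\<Union>l. {x. 4 ^ l * c l < cnt l x})"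
    then have a: "\<And>i. i \<le> N \<Longrightarrow> avg i h x \<le> 1" and b: "\<And>l. cnt l x \<le> 4 ^ l * c l" by (auto simp: not_less)
    have "\<exists>l. \<forall>i. i \<le> N \<and> 0 < avg i h x \<longrightarrow> 1 / 2 ^ (l i) / 2 < avg i h x \<and> avg i h x \<le> 1 / 2 ^ (l i)"
      using dyadic_level_exists a by (intro choice allI) metis
    then obtain lv where lv: "\<And>i. i \<le> N \<Longrightarrow> 0 < avg i h x \<Longrightarrow> 1 / 2 ^ (lv i) / 2 < avg i h x \<and> avg i h x \<le> 1 / 2 ^ (lv i)"
      by blast
    \<comment> \<open>Only finitely many groups occur at x, so the bound on finite sums of c
      applies.\<close>
    let ?F = "lv ` {..N}"
    have "(\<Sum>i\<le>N. of_bool (S i x) * (avg i h x)^2) \<le> (\<Sum>i\<le>N. \<Sum>l\<in>?F. of_bool (L l i x) / 4 ^ l)"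
    proof (rule sum_mono)
      fix i assume i: "i \<in> {..N}"
      have nn: "0 \<le> (\<Sum>l\<in>?F. of_bool (L l i x) / 4 ^ l :: real)" by (intro sum_nonneg) auto
      show "of_bool (S i x) * (avg i h x)^2 \<le> (\<Sum>l\<in>?F. of_bool (L l i x) / 4 ^ l)"
      proof (cases "S i x \<and> 0 < avg i h x")
        case True
        have l: "L (lv i) i x" using lv[of i] i True by (simp add: L_def)
        have "(avg i h x)^2 \<le> (1 / 2 ^ lv i)^2" using l True by (intro power_mono) (auto simp: L_def)
        also have "\<dots> = of_bool (L (lv i) i x) / 4 ^ lv i"
          using l by (simp add: power_divide power_mult[symmetric] mult.commute[of _ 2]) (simp add: power_mult)
        also have "\<dots> \<le> (\<Sum>l\<in>?F. of_bool (L l i x) / 4 ^ l)"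
          by (rule member_le_sum) (use i in auto)
        finally show ?thesis using True by simp
      next
        case False
        then have "of_bool (S i x) * (avg i h x)^2 = 0" using avg_nonneg[of h i x] h0 by auto
        then show ?thesis using nn by simp
      qed
    qed
    also have "\<dots> = (\<Sum>l\<in>?F. cnt l x / 4 ^ l)"
      by (subst sum.swap) (simp only: cnt_def sum_divide_distrib)
    also have "\<dots> \<le> sum c ?F"
      using b by (intro sum_mono) (simp add: field_simps)
    also have "\<dots> \<le> 1" by (rule c(2)) simp
    finally show False using x by simp
  qed
  have lb0: "0 \<le> level_bound p X c l" for l
    unfolding level_bound_def using X_ge_1 c(1)[of l] by (intro mult_nonneg_nonneg divide_nonneg_nonneg) auto
  have B0: "0 \<le> B" using B[of 0] by simp
  have "wmeas w {x. 1 < (\<Sum>i\<le>N. of_bool (S i x) * (avg i h x)^2)}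
     \<le> wmeas w ({x. \<exists>i\<le>N. 1 < avg i h x} \<union> (\<Union>l. {x. 4 ^ l * c l < cnt l x}))"
    by (rule wmeas_mono[OF sub])
  also have "\<dots> \<le> wmeas w {x. \<exists>i\<le>N. 1 < avg i h x} + wmeas w (\<Union>l. {x. 4 ^ l * c l < cnt l x})"
    by (rule wmeas_Un_le) auto
  also have "\<dots> \<le> ennreal X * ?I + (\<Sum>l. wmeas w {x. 4 ^ l * c l < cnt l x})"
    by (intro add_mono maximal_weak h h0 wmeas_countable_subadditive) auto
  also have "(\<Sum>l. wmeas w {x. 4 ^ l * c l < cnt l x}) \<le> ennreal B * ?I"
  proof (rule suminf_le_const)
    show "summable (\<lambda>l. wmeas w {x. 4 ^ l * c l < cnt l x})" by simp
    fix n
    have "(\<Sum>l<n. wmeas w {x. 4 ^ l * c l < cnt l x}) \<le> (\<Sum>l<n. ennreal (level_bound p X c l) * ?I)"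
      by (rule sum_mono[OF lev])
    also have "\<dots> = ennreal (\<Sum>l<n. level_bound p X c l) * ?I"
      unfolding sum_distrib_right[symmetric] by (subst sum_ennreal) (auto simp: lb0)
    also have "\<dots> \<le> ennreal B * ?I" by (intro mult_right_mono ennreal_leI B) simp
    finally show "(\<Sum>l<n. wmeas w {x. 4 ^ l * c l < cnt l x}) \<le> ennreal B * ?I" .
  qed
  finally show ?thesis
    using X_ge_1 B0 by (simp add: ennreal_plus distrib_right)
qed

end

section \<open>Weak-type bound for the pairings on one grid\<close>

locale weighted_pairing = grid_pairing cell r f \<alpha> H + weighted_grid cell r p w X
  for cell :: "nat \<Rightarrow> 'a::euclidean_space \<Rightarrow> 'a set" and r f \<alpha> H p w X
begin

text \<open>Multiplying |f| by \<mu> moves the level s to the height 1 of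
  \<open>sparse_weak\<close>; homogeneity returns the factor \<mu>^p.\<close>

lemma pairing_square_weak:
  assumes c: "\<And>l. 0 < c l" "\<And>F. finite F \<Longrightarrow> sum c F \<le> 1"
    and B: "\<And>n. (\<Sum>l<n. level_bound p X c l) \<le> B" and s: "0 < s"
  shows "wmeas w {x. s^2 < (\<Sum>i\<le>N. (psup i x)^2)}
    \<le> ennreal ((X + B) * (sqrt (c1^2 + 8 * Kc) / s) powr p) * wmeas (\<lambda>y. \<bar>f y\<bar> powr p * w y) UNIV"
proof -
  define K where "K = c1^2 + 8 * Kc"
  have K: "K > 0" using constants_pos Kc_pos by (simp add: K_def add_pos_pos)
  define \<mu> where "\<mu> = sqrt K / s"
  have \<mu>: "\<mu> > 0" using K s by (simp add: \<mu>_def)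
  define h where "h y = \<mu> * \<bar>f y\<bar>" for y
  have h: "cellint h" using cellint_abs[OF f] unfolding h_def cellint_def by auto
  have avg_h: "avg i h x = \<mu> * mean i x" for i x
    unfolding avg_def h_def by simp
  have [measurable]: "f \<in> borel_measurable borel" by (rule cellint_measurable[OF f])
  have "wmeas w {x. s^2 < (\<Sum>i\<le>N. (psup i x)^2)} \<le> wmeas w {x. 1 < (\<Sum>i\<le>N. of_bool (stop i x) * (avg i h x)^2)}"
  proof (rule wmeas_mono, intro subsetI CollectI)
    fix x assume "x \<in> {x. s^2 < (\<Sum>i\<le>N. (psup i x)^2)}"
    then have "s^2 < K * (\<Sum>i\<le>N. of_bool (stop i x) * (mean i x)^2)"
      using square_sum_le_stops[where n = N and x = x] unfolding K_def by simp
    then have "1 < K / s^2 * (\<Sum>i\<le>N. of_bool (stop i x) * (mean i x)^2)"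
      using s by (simp add: field_simps)
    also have "K / s^2 = \<mu>^2" using K by (simp add: \<mu>_def power_divide)
    also have "\<mu>^2 * (\<Sum>i\<le>N. of_bool (stop i x) * (mean i x)^2) = (\<Sum>i\<le>N. of_bool (stop i x) * (avg i h x)^2)"
      unfolding sum_distrib_left avg_h by (intro sum.cong refl) (simp add: power_mult_distrib)
    finally show "1 < (\<Sum>i\<le>N. of_bool (stop i x) * (avg i h x)^2)" .
  qed
  also have "\<dots> \<le> ennreal (X + B) * hw h UNIV"
    by (rule sparse_weak[OF h _ adapted_stop sparse c B]) (use \<mu> in \<open>auto simp: h_def\<close>)
  also have "hw h UNIV = ennreal (\<mu> powr p) * wmeas (\<lambda>y. \<bar>f y\<bar> powr p * w y) UNIV"
    unfolding wmeas_def h_def using \<mu>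
    by (subst nn_integral_cmult[symmetric]) (auto simp: powr_mult ennreal_mult' mult.assoc)
  finally show ?thesis
    using X_ge_1 B[of 0] by (simp add: \<mu>_def K_def ennreal_mult mult.assoc)
qed

end

section \<open>Shifted dyadic grids\<close>

text \<open>
  The sign of the shift alternates because consecutive levels are nested only if
  2 shift(k) - shift(k + 1) is an integer.
\<close>
definition shift :: "'a::euclidean_space set \<Rightarrow> int \<Rightarrow> 'a \<Rightarrow> real" where
  "shift u k b = (if b \<in> u then (if even k then 1 / 3 else - 1 / 3) else 0)"

definition coord :: "'a::euclidean_space set \<Rightarrow> int \<Rightarrow> 'a \<Rightarrow> 'a \<Rightarrow> int" where
  "coord u k b y = \<lfloor>2 powi k * (y \<bullet> b) + shift u k b\<rfloor>"

definition dcube :: "'a::euclidean_space set \<Rightarrow> int \<Rightarrow> 'a \<Rightarrow> 'a set" where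
  "dcube u k x = {y. \<forall>b\<in>Basis. coord u k b y = coord u k b x}"

text \<open>Doubling the shift of level k and subtracting that of level k + 1 leaves 0, 1 or -1, so
  the coarse coordinate is a function of the fine one. This is the nesting of the grid.\<close>

lemma coord_Suc: "coord u k b y = (coord u (k + 1) b y + (if b \<in> u then (if even k then 1 else - 1) else 0)) div 2"
proof -
  define m :: int where "m = (if b \<in> u then (if even k then 1 else - 1) else 0)"
  define z where "z = 2 powi k * (y \<bullet> b) + shift u k b"
  have "2 powi (k + 1) * (y \<bullet> b) + shift u (k + 1) b = 2 * z - real_of_int m"
    by (simp add: z_def m_def shift_def power_int_add algebra_simps)
  then have c: "coord u (k + 1) b y = \<lfloor>2 * z\<rfloor> - m" by (simp add: coord_def)
  have "coord u k b y = \<lfloor>z\<rfloor>" by (simp only: coord_def z_def)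
  also have "\<lfloor>z\<rfloor> = \<lfloor>2 * z / real_of_int 2\<rfloor>" by simp
  also have "\<dots> = \<lfloor>2 * z\<rfloor> div 2" by (rule floor_divide_real_eq_div) simp
  finally show ?thesis unfolding m_def[symmetric] c by simp
qed

lemma dcube_subset_Suc: "dcube u (k + 1) x \<subseteq> dcube u k x"
  unfolding dcube_def using coord_Suc[of u k] by auto

lemma mem_dcube_iff:
  "y \<in> dcube u k x \<longleftrightarrow> (\<forall>b\<in>Basis.
     (of_int (coord u k b x) - shift u k b) / 2 powi k \<le> y \<bullet> b \<and>
     y \<bullet> b < (of_int (coord u k b x) - shift u k b) / 2 powi k + 2 powi (- k))"
proof -
  have "coord u k b y = c \<longleftrightarrow> (of_int c - shift u k b) / 2 powi k \<le> y \<bullet> b \<and>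
     y \<bullet> b < (of_int c - shift u k b) / 2 powi k + 2 powi (- k)" for b c
  proof -
    have pos: "(0::real) < 2 powi k" by simp
    have "coord u k b y = c \<longleftrightarrow> of_int c \<le> 2 powi k * (y \<bullet> b) + shift u k b \<and> 2 powi k * (y \<bullet> b) + shift u k b < of_int c + 1"
      unfolding coord_def by (rule floor_eq_iff)
    also have "\<dots> \<longleftrightarrow> (of_int c - shift u k b) / 2 powi k \<le> y \<bullet> b \<and> y \<bullet> b < (of_int c - shift u k b) / 2 powi k + 2 powi (- k)"
      using pos by (simp add: power_int_minus field_simps)
    finally show ?thesis .
  qed
  then show ?thesis unfolding dcube_def by blast
qed

lemma dcube_box:
  fixes x :: "'a::euclidean_space"
  shows "\<exists>c. box c (c + (2 powi (- k)) *\<^sub>R One) \<subseteq> dcube u k x \<and> dcube u k x \<subseteq> cbox c (c + (2 powi (- k)) *\<^sub>R One)"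
proof -
  define c where "c = (\<Sum>b\<in>Basis. ((of_int (coord u k b x) - shift u k b) / 2 powi k) *\<^sub>R b)"
  have c: "c \<bullet> b = (of_int (coord u k b x) - shift u k b) / 2 powi k" if "b \<in> Basis" for b
    unfolding c_def using that by simp
  have e: "(c + (2 powi (- k)) *\<^sub>R One) \<bullet> b = c \<bullet> b + 2 powi (- k)" if "b \<in> Basis" for b
    using that by (simp add: inner_simps)
  show ?thesis
    by (intro exI[of _ c] conjI subsetI) (auto simp: mem_dcube_iff mem_box c e less_imp_le)
qed

lemma dcube_sets: "dcube u k (x::'a::euclidean_space) \<in> sets borel"
proof -
  have "dcube u k x = (\<Inter>b\<in>Basis. {y. (of_int (coord u k b x) - shift u k b) / 2 powi k \<le> y \<bullet> b} \<inter>
     {y. y \<bullet> b < (of_int (coord u k b x) - shift u k b) / 2 powi k + 2 powi (- k)})"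
    by (auto simp: mem_dcube_iff)
  also have "\<dots> \<in> sets borel"
    by (intro sets.countable_INT'' sets.Int) (auto intro!: countable_finite)
  finally show ?thesis .
qed

text \<open>A cube is determined by its integer coordinates on the finite set
  \<open>Basis\<close>.\<close>

lemma countable_dcubes: "countable (range (dcube u k :: 'a::euclidean_space \<Rightarrow> 'a set))"
proof -
  define D where "D m = {y::'a. \<forall>b\<in>Basis. coord u k b y = m b}" for m
  have "dcube u k x = D (restrict (\<lambda>b. coord u k b x) Basis)" for x :: 'a
    by (auto simp: dcube_def D_def)
  then have "range (dcube u k) \<subseteq> D ` (Basis \<rightarrow>\<^sub>E UNIV)"
    by (auto simp: PiE_iff intro!: image_eqI)
  moreover have "countable (Basis \<rightarrow>\<^sub>E (UNIV :: int set) :: ('a \<Rightarrow> int) set)"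
    by (intro countable_PiE) auto
  ultimately show ?thesis by (meson countable_image countable_subset)
qed

section \<open>The shifted grids as instances of the abstract grid\<close>

abbreviation dgrid :: "'a::euclidean_space set \<Rightarrow> int \<Rightarrow> nat \<Rightarrow> 'a \<Rightarrow> 'a set" where
  "dgrid u K \<equiv> \<lambda>i. dcube u (K + int i)"

lemma grid_dcube: "grid (dgrid u K) (2 powi (- K))"
proof
  show "(0::real) < 2 powi (- K)" by simp
  show "x \<in> dcube u (K + int i) x" for i and x :: 'a by (simp add: dcube_def)
  show "dcube u (K + int i) y = dcube u (K + int i) x" if "y \<in> dcube u (K + int i) x" for i and x y :: 'a
    using that by (auto simp: dcube_def)
  show "dcube u (K + int (Suc i)) x \<subseteq> dcube u (K + int i) x" for i and x :: 'a
  proof -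
    have "K + int (Suc i) = K + int i + 1" by simp
    then show ?thesis using dcube_subset_Suc[of u "K + int i" x] by presburger
  qed
  have "(2 powi (- K) / 2 ^ i :: real) = 2 powi (- (K + int i))" for i
  proof -
    have "(2 powi (- (K + int i)) :: real) = 2 powi (- K) * 2 powi (- int i)"
      by (simp add: power_int_add[symmetric])
    then show ?thesis by (simp add: power_int_minus divide_inverse)
  qed
  then show "\<exists>c. box c (c + (2 powi (- K) / 2 ^ i) *\<^sub>R One) \<subseteq> dcube u (K + int i) x \<and>
      dcube u (K + int i) x \<subseteq> cbox c (c + (2 powi (- K) / 2 ^ i) *\<^sub>R One)" for i and x :: 'a
    using dcube_box[of "K + int i" u x] by simp
qed (rule countable_dcubes dcube_sets)+

text \<open>u collects the coordinates in which the projection of the ball, rescaled to an interval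
  of length below 1/3, crosses an integer. All its points are within less than 1/3 of that integer,
  so a shift by 1/3 in either direction puts the whole interval between integers.\<close>

lemma one_third_trick:
  fixes x :: "'a::euclidean_space"
  assumes \<rho>: "0 < \<rho>" "6 * \<rho> < 2 powi (- k)"
  shows "\<exists>u\<subseteq>Basis. cball x \<rho> \<subseteq> dcube u k x"
proof -
  define \<delta> where "\<delta> = 2 powi k * \<rho>"
  have pk: "(0::real) < 2 powi k" by simp
  have \<delta>: "0 < \<delta>" "6 * \<delta> < 1"
  proof -
    show "0 < \<delta>" using \<rho> by (simp add: \<delta>_def)
    have "2 powi k * (6 * \<rho>) < 2 powi k * 2 powi (- k)" using \<rho> by (intro mult_strict_left_mono) auto
    then show "6 * \<delta> < 1" by (simp add: \<delta>_def power_int_minus)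
  qed
  define z where "z b = 2 powi k * (x \<bullet> b)" for b
  define u where "u = {b \<in> Basis. \<lfloor>z b - \<delta>\<rfloor> \<noteq> \<lfloor>z b + \<delta>\<rfloor>}"
  have same: "\<lfloor>t + shift u k b\<rfloor> = \<lfloor>z b + shift u k b\<rfloor>" if b: "b \<in> Basis" and t: "\<bar>t - z b\<bar> \<le> \<delta>" for b t
  proof (cases "b \<in> u")
    case False
    then have eq: "\<lfloor>z b - \<delta>\<rfloor> = \<lfloor>z b + \<delta>\<rfloor>" using b by (simp add: u_def)
    have "\<lfloor>s\<rfloor> = \<lfloor>z b + \<delta>\<rfloor>" if "\<bar>s - z b\<bar> \<le> \<delta>" for s
    proof (rule antisym)
      show "\<lfloor>s\<rfloor> \<le> \<lfloor>z b + \<delta>\<rfloor>" using that by (intro floor_mono) linarith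
      show "\<lfloor>z b + \<delta>\<rfloor> \<le> \<lfloor>s\<rfloor>" unfolding eq[symmetric] using that by (intro floor_mono) linarith
    qed
    from this[OF t] this[of "z b"] False \<delta> show ?thesis by (simp add: shift_def)
  next
    case True
    define n where "n = \<lfloor>z b + \<delta>\<rfloor>"
    have "\<lfloor>z b - \<delta>\<rfloor> < n"
      using True floor_mono[of "z b - \<delta>" "z b + \<delta>"] \<delta> unfolding u_def n_def by auto
    then have n1: "z b - \<delta> < of_int n" by (simp add: floor_less_iff)
    have n2: "of_int n \<le> z b + \<delta>" unfolding n_def by linarith
    have "\<lfloor>s + 1 / 3\<rfloor> = n" if "\<bar>s - z b\<bar> \<le> \<delta>" for s
      using that n1 n2 \<delta> by (intro floor_unique) linarith+
    moreover have "\<lfloor>s - 1 / 3\<rfloor> = n - 1" if "\<bar>s - z b\<bar> \<le> \<delta>" for s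
      using that n1 n2 \<delta> by (intro floor_unique; unfold of_int_diff of_int_1; linarith)
    ultimately show ?thesis
      using t \<delta> True by (simp add: shift_def)
  qed
  have "cball x \<rho> \<subseteq> dcube u k x"
  proof
    fix y assume y: "y \<in> cball x \<rho>"
    have "\<bar>2 powi k * (y \<bullet> b) - z b\<bar> \<le> \<delta>" if b: "b \<in> Basis" for b
    proof -
      have "\<bar>y \<bullet> b - x \<bullet> b\<bar> \<le> norm (y - x)" using Basis_le_norm[OF b, of "y - x"] by (simp add: inner_simps)
      also have "\<dots> \<le> \<rho>" using y by (simp add: dist_norm norm_minus_commute)
      finally have "2 powi k * \<bar>y \<bullet> b - x \<bullet> b\<bar> \<le> \<delta>" unfolding \<delta>_def by (intro mult_left_mono) auto
      moreover have "2 powi k * (y \<bullet> b) - z b = 2 powi k * (y \<bullet> b - x \<bullet> b)"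
        by (simp add: z_def right_diff_distrib)
      ultimately show ?thesis by (simp add: abs_mult)
    qed
    then show "y \<in> dcube u k x"
      unfolding dcube_def coord_def using same by (simp add: z_def)
  qed
  moreover have "u \<subseteq> Basis" by (auto simp: u_def)
  ultimately show ?thesis by blast
qed

text \<open>The A_p supremum runs over closed cubes and the cells are half-open; each cell lies in a
  closed cube of the same volume.\<close>

lemma weighted_grid_dcube:
  fixes w :: "'a::euclidean_space \<Rightarrow> real"
  assumes p: "1 < p" and w: "Ap_weight p w"
  shows "weighted_grid (dgrid u K) (2 powi (- K)) p w (Ap_const p w)"
proof -
  interpret grid "dgrid u K :: nat \<Rightarrow> 'a \<Rightarrow> 'a set" "2 powi (- K)" by (rule grid_dcube)
  let ?cell = "dgrid u K :: nat \<Rightarrow> 'a \<Rightarrow> 'a set"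
  have cube: "\<exists>Q\<in>cubes. ?cell i x \<subseteq> Q \<and> measure lborel Q = vol i" for i x
  proof -
    from cell_box[of i x] obtain c where c: "?cell i x \<subseteq> cbox c (c + (2 powi (- K) / 2 ^ i) *\<^sub>R One)" by blast
    have m: "measure lborel (cbox c (c + (2 powi (- K) / 2 ^ i) *\<^sub>R One)) = vol i"
      unfolding vol_def by (subst measure_lborel_cbox) (auto simp: inner_simps)
    have "cbox c (c + (2 powi (- K) / 2 ^ i) *\<^sub>R One) \<in> cubes"
      unfolding cubes_def using r_pos
      by (intro CollectI exI[of _ c] exI[of _ "2 powi (- K) / 2 ^ i"]) auto
    then show ?thesis using c m by blast
  qed
  show ?thesis
  proof unfold_locales
    show "1 < p" by (rule p)
    show "w \<in> borel_measurable borel" "AE x in lborel. 0 < w x" using w by (auto simp: Ap_weight_def)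
    fix i x
    obtain Q where Q: "Q \<in> cubes" "?cell i x \<subseteq> Q" "measure lborel Q = vol i" using cube by blast
    have fin: "wmeas w Q < top" "wmeas (dual_weight p w) Q < top" using w Q by (auto simp: Ap_weight_def)
    show "wmeas w (?cell i x) < top" "wmeas (dual_weight p w) (?cell i x) < top"
      using wmeas_mono[OF Q(2)] fin by (meson order.strict_trans1)+
    have "enn2real (wmeas w (?cell i x)) / vol i * (enn2real (wmeas (dual_weight p w) (?cell i x)) / vol i) powr (p - 1)
        \<le> Ap_quot p w Q"
      unfolding Ap_quot_def Q(3) using vol_pos[of i] p
      by (intro mult_mono divide_right_mono powr_mono2 enn2real_mono wmeas_mono[OF Q(2)] fin) auto
    also have "\<dots> \<le> Ap_const p w"
      unfolding Ap_const_def using w Q(1) by (intro cSUP_upper) (auto simp: Ap_weight_def)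
    finally show "enn2real (wmeas w (?cell i x)) / vol i * (enn2real (wmeas (dual_weight p w) (?cell i x)) / vol i) powr (p - 1)
        \<le> Ap_const p w" .
  qed
qed

lemma in_Lp_w_cellint:
  fixes w f :: "'a::euclidean_space \<Rightarrow> real"
  assumes p: "1 < p" and w: "Ap_weight p w" and f: "in_Lp_w p w f"
  shows "grid.cellint (dgrid u K) f"
proof -
  interpret weighted_grid "dgrid u K" "2 powi (- K)" p w "Ap_const p w"
    by (rule weighted_grid_dcube[OF p w])
  have [measurable]: "f \<in> borel_measurable borel" using f by (simp add: in_Lp_w_def)
  let ?v = "\<lambda>y. \<bar>f y\<bar> powr p * w y"
  have "wmeas ?v UNIV < top"
    using f unfolding in_Lp_w_def Lp_w_norm_def enn_powr_def wmeas_def by (auto split: if_splits simp: top.not_eq_extremum)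
  then have fin: "wmeas ?v E < top" for E
    using wmeas_mono[of E UNIV ?v] by (simp add: order.strict_trans1)
  have "set_integrable lborel (dcube u (K + int 0) x) f" for x
    unfolding set_integrable_def
  proof (rule integrableI_bounded)
    let ?Q = "dcube u (K + int 0) x"
    have [measurable]: "?Q \<in> sets borel" by (rule dcube_sets)
    show "(\<lambda>y. indicator ?Q y *\<^sub>R f y) \<in> borel_measurable lborel" by measurable
    have "(\<integral>\<^sup>+y. ennreal (norm (indicator ?Q y *\<^sub>R f y)) \<partial>lborel) = (\<integral>\<^sup>+y. ennreal \<bar>f y\<bar> * indicator ?Q y \<partial>lborel)"
      by (intro nn_integral_cong) (simp add: indicator_def)
    also have "\<dots> \<le> ennreal (enn2real (wmeas ?v ?Q) powr (1 / p) * enn2real (wmeas (dual_weight p w) ?Q) powr ((p - 1) / p))"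
      using fin[of ?Q] dual_fin[of 0 x]
      by (intro nn_Hoelder_dual_weight[OF p _ _ _ _ w_pos]) (auto simp: dcube_sets)
    also have "\<dots> < \<infinity>" by simp
    finally show "(\<integral>\<^sup>+y. ennreal (norm (indicator ?Q y *\<^sub>R f y)) \<partial>lborel) < \<infinity>" .
  qed
  then show ?thesis unfolding cellint_def by simp
qed

section \<open>The intrinsic square function\<close>

text \<open>The class \<open>Phi\<close> indexed by the absolute scale k, free of the starting level
  K, so that different truncations of one grid can be compared. The factor 32 accounts for dilations
  by t > 2^(-k) / 32.\<close>

definition pairing_class :: "real \<Rightarrow> 'a::euclidean_space set \<Rightarrow> int \<Rightarrow> 'a \<Rightarrow> ('a \<Rightarrow> real) set" where
  "pairing_class \<alpha> u k x = {\<phi>. (\<forall>y. \<phi> y \<noteq> 0 \<longrightarrow> y \<in> dcube u k x) \<and> (\<integral>y. \<phi> y \<partial>lborel) = 0 \<and>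
     (\<forall>y z. \<bar>\<phi> y - \<phi> z\<bar> \<le> 32 powr (real DIM('a) + \<alpha>) * (2 powi k) powr (real DIM('a) + \<alpha>) * dist y z powr \<alpha>)}"

definition pairing_sup :: "real \<Rightarrow> ('a::euclidean_space \<Rightarrow> real) \<Rightarrow> 'a set \<Rightarrow> int \<Rightarrow> 'a \<Rightarrow> real" where
  "pairing_sup \<alpha> f u k x = (SUP \<phi>\<in>pairing_class \<alpha> u k x. \<bar>\<integral>y. f y * \<phi> y \<partial>lborel\<bar>)"

lemma grid_pairing_dcube:
  fixes f :: "'a::euclidean_space \<Rightarrow> real"
  assumes "0 < \<alpha>" "grid.cellint (dgrid u K) f"
  shows "grid_pairing (dgrid u K) (2 powi (- K)) f \<alpha> (32 powr (real DIM('a) + \<alpha>))"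
  using assms grid_dcube by (simp add: grid_pairing_def grid_pairing_axioms_def)

lemma Phi_dcube:
  fixes f :: "'a::euclidean_space \<Rightarrow> real"
  assumes "grid_pairing (dgrid u K) (2 powi (- K)) f \<alpha> (32 powr (real DIM('a) + \<alpha>))"
  shows "grid_pairing.Phi (dgrid u K) (2 powi (- K)) \<alpha> (32 powr (real DIM('a) + \<alpha>)) i x = pairing_class \<alpha> u (K + int i) x"
proof -
  have "(2 ^ i / 2 powi (- K) :: real) = 2 powi (K + int i)"
    by (simp add: power_int_minus power_int_add divide_inverse mult.commute)
  then show ?thesis
    unfolding grid_pairing.Phi_def[OF assms] pairing_class_def by simp
qed

lemma psup_dcube:
  fixes f :: "'a::euclidean_space \<Rightarrow> real"
  assumes "grid_pairing (dgrid u K) (2 powi (- K)) f \<alpha> (32 powr (real DIM('a) + \<alpha>))"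
  shows "grid_pairing.psup (dgrid u K) (2 powi (- K)) f \<alpha> (32 powr (real DIM('a) + \<alpha>)) i x = pairing_sup \<alpha> f u (K + int i) x"
  unfolding grid_pairing.psup_def[OF assms] pairing_sup_def Phi_dcube[OF assms] ..

lemma integral_dilate_reflect:
  fixes \<gamma> :: "'a::euclidean_space \<Rightarrow> real"
  assumes [measurable]: "\<gamma> \<in> borel_measurable borel" and t: "t > 0"
  shows "(\<integral>z. dilate \<gamma> t (y - z) \<partial>lborel) = (\<integral>z. \<gamma> z \<partial>lborel)"
proof -
  let ?T = "\<lambda>x::'a. y + (- t) *\<^sub>R x"
  let ?\<phi> = "\<lambda>z. dilate \<gamma> t (y - z)"
  have [measurable]: "?\<phi> \<in> borel_measurable borel" unfolding dilate_def by measurable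
  have "(\<integral>z. ?\<phi> z \<partial>lborel) = integral\<^sup>L (density (distr lborel borel ?T) (\<lambda>_. ennreal (\<bar>- t\<bar> ^ DIM('a)))) ?\<phi>"
    using lborel_affine[of "- t" y] t by simp
  also have "\<dots> = (\<integral>z. \<bar>- t\<bar> ^ DIM('a) * ?\<phi> z \<partial>(distr lborel borel ?T))"
    by (subst integral_density) auto
  also have "\<dots> = (\<integral>x. \<bar>- t\<bar> ^ DIM('a) * ?\<phi> (?T x) \<partial>lborel)"
    by (rule integral_distr) auto
  also have "\<dots> = (\<integral>x. \<gamma> x \<partial>lborel)"
    using t by (intro Bochner_Integration.integral_cong refl) (simp add: dilate_def powr_minus powr_realpow)
  finally show ?thesis .
qed

text \<open>The dilate lives within distance t of y, hence within 2t of x, and rescaling multiplies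
  its Hoelder constant by t^(-n - \<alpha>).\<close>

lemma dilate_in_pairing_class:
  fixes \<gamma> :: "'a::euclidean_space \<Rightarrow> real"
  assumes \<alpha>: "0 < \<alpha>" and \<gamma>: "\<gamma> \<in> C_alpha \<alpha>" and xy: "dist x y < t" and t: "2 powi (- k - 5) < t"
    and sub: "cball x (2 * t) \<subseteq> dcube u k x"
  shows "(\<lambda>z. dilate \<gamma> t (y - z)) \<in> pairing_class \<alpha> u k x"
proof -
  have t0: "0 < t" using xy by (smt (verit) zero_le_dist)
  have hold: "\<bar>\<gamma> y - \<gamma> z\<bar> \<le> 1 * dist y z powr \<alpha>" for y z using \<gamma> by (simp add: C_alpha_def)
  have m: "\<gamma> \<in> borel_measurable borel" by (rule Hoelder_borel_measurable[OF hold \<alpha>])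
  have int: "(\<integral>z. dilate \<gamma> t (y - z) \<partial>lborel) = 0"
    unfolding integral_dilate_reflect[OF m t0] using \<gamma> by (simp add: C_alpha_def)
  have supp: "z \<in> dcube u k x" if "dilate \<gamma> t (y - z) \<noteq> 0" for z
  proof -
    have n: "norm ((1 / t) *\<^sub>R (y - z)) \<le> 1" using that \<gamma> by (auto simp: dilate_def C_alpha_def)
    have "norm ((1 / t) *\<^sub>R (y - z)) = dist y z / t"
      using t0 by (simp only: norm_scaleR dist_norm) simp
    with n have "dist y z / t \<le> 1" by (simp only:)
    then have "dist y z \<le> t" using t0 by (simp add: field_simps)
    then have "dist x z \<le> 2 * t" using xy dist_triangle[of x z y] by linarith
    then show ?thesis using sub by auto
  qed
  have it: "1 / t \<le> 32 * 2 powi k"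
  proof -
    have "(2 powi (- k - 5) :: real) = 1 / (32 * 2 powi k)"
      by (simp add: power_int_diff power_int_minus field_simps)
    then have "1 / (32 * 2 powi k) < t" using t by simp
    then have "1 < t * (32 * 2 powi k)" by (simp add: divide_less_eq)
    then show ?thesis using t0 by (simp add: divide_le_eq mult.commute)
  qed
  have "\<bar>dilate \<gamma> t (y - z) - dilate \<gamma> t (y - z')\<bar> \<le> 32 powr (real DIM('a) + \<alpha>) * (2 powi k) powr (real DIM('a) + \<alpha>) * dist z z' powr \<alpha>" for z z'
  proof -
    let ?n = "real DIM('a)"
    have e: "dist ((1 / t) *\<^sub>R (y - z)) ((1 / t) *\<^sub>R (y - z')) = (1 / t) * dist z z'"
    proof -
      have "(1 / t) *\<^sub>R (y - z) - (1 / t) *\<^sub>R (y - z') = (1 / t) *\<^sub>R (z' - z)"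
        by (simp add: algebra_simps)
      then show ?thesis using t0 by (simp add: dist_norm norm_minus_commute)
    qed
    have "\<bar>dilate \<gamma> t (y - z) - dilate \<gamma> t (y - z')\<bar> = t powr (- ?n) * \<bar>\<gamma> ((1 / t) *\<^sub>R (y - z)) - \<gamma> ((1 / t) *\<^sub>R (y - z'))\<bar>"
      by (simp add: dilate_def right_diff_distrib[symmetric] abs_mult)
    also have "\<dots> \<le> t powr (- ?n) * ((1 / t) * dist z z') powr \<alpha>"
      using hold[of "(1 / t) *\<^sub>R (y - z)" "(1 / t) *\<^sub>R (y - z')"] unfolding e by (intro mult_left_mono) auto
    also have "\<dots> = (1 / t) powr (?n + \<alpha>) * dist z z' powr \<alpha>"
    proof -
      have "t powr (- ?n) = (1 / t) powr ?n" using powr_divide[of 1 t ?n] by (simp add: powr_minus divide_inverse)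
      moreover have "((1 / t) * dist z z') powr \<alpha> = (1 / t) powr \<alpha> * dist z z' powr \<alpha>" by (rule powr_mult)
      ultimately show ?thesis by (simp only: powr_add mult.assoc)
    qed
    also have "\<dots> \<le> (32 * 2 powi k) powr (?n + \<alpha>) * dist z z' powr \<alpha>"
      using it t0 \<alpha> by (intro mult_right_mono powr_mono2) auto
    finally show ?thesis by (simp add: powr_mult)
  qed
  then show ?thesis using int supp by (auto simp: pairing_class_def)
qed

lemma A_alpha_le_pairing_sup:
  fixes f :: "'a::euclidean_space \<Rightarrow> real"
  assumes \<alpha>: "0 < \<alpha>" and f: "grid.cellint (dgrid u k) f"
    and xy: "dist x y < t" and t: "2 powi (- k - 5) < t" and sub: "cball x (2 * t) \<subseteq> dcube u k x"
  shows "A_alpha \<alpha> f y t \<le> ennreal (pairing_sup \<alpha> f u k x)"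
  unfolding A_alpha_def
proof (rule SUP_least)
  fix \<gamma> :: "'a \<Rightarrow> real" assume \<gamma>: "\<gamma> \<in> C_alpha \<alpha>"
  note gp = grid_pairing_dcube[OF \<alpha> f]
  have "(\<lambda>z. dilate \<gamma> t (y - z)) \<in> pairing_class \<alpha> u k x"
    by (rule dilate_in_pairing_class[OF \<alpha> \<gamma> xy t sub])
  then have "\<bar>conv f (dilate \<gamma> t) y\<bar> \<le> pairing_sup \<alpha> f u k x"
    using grid_pairing.pairing_le_psup[OF gp, of _ 0 x] unfolding Phi_dcube[OF gp] psup_dcube[OF gp]
    by (simp add: conv_def)
  then show "ennreal \<bar>conv f (dilate \<gamma> t) y\<bar> \<le> ennreal (pairing_sup \<alpha> f u k x)" by (rule ennreal_leI)
qed

text \<open>The 4 leaves room for \<open>one_third_trick\<close> at radius 2t, which asks for 12 t <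
  2^(-k), while here 16 t \<le> 2^(-k).\<close>

lemma dyadic_scale_exists:
  fixes t :: real
  assumes "0 < t"
  shows "\<exists>k::int. 2 powi (- k - 5) < t \<and> t \<le> 2 powi (- k - 4)"
proof -
  define m where "m = \<lfloor>- log 2 t\<rfloor>"
  have m: "of_int m \<le> - log 2 t" "- log 2 t < of_int m + 1" unfolding m_def by linarith+
  have powi: "2 powr real_of_int j = 2 powi j" for j :: int
    by (rule powr_real_of_int') auto
  have "t = 2 powr (log 2 t)" using assms by simp
  moreover have "2 powr (log 2 t) \<le> 2 powr real_of_int (- (m - 4) - 4)" using m by (intro powr_mono) auto
  moreover have "2 powr real_of_int (- (m - 4) - 5) < 2 powr (log 2 t)" using m by (intro powr_less_mono) auto
  ultimately have "2 powi (- (m - 4) - 5) < t" "t \<le> 2 powi (- (m - 4) - 4)" unfolding powi by linarith+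
  then show ?thesis by blast
qed

text \<open>The volume of a ball of radius \<rho> times \<rho>, multiplied by the bound (2 /
  \<rho>)^(n + 1) for the kernel at t > \<rho> / 2; the powers of \<rho> cancel.\<close>

definition cone_const :: "'a::euclidean_space itself \<Rightarrow> real" where
  "cone_const _ = 2 ^ (DIM('a) + 1) * unit_ball_vol (real DIM('a))"

text \<open>The cone is cut into dyadic slabs in t, enumerated by \<open>int_decode\<close>. The
  comparison is pointwise, because \<open>A_alpha\<close> is not shown to be measurable and only
  monotonicity of its integral is available.\<close>

lemma cone_integral_le:
  fixes f :: "'a::euclidean_space \<Rightarrow> real"
  assumes \<alpha>: "0 < \<alpha>" and f: "\<And>u k. grid.cellint (dgrid u k) f"
  shows "(\<integral>\<^sup>+ yt. (A_alpha \<alpha> f (fst yt) (snd yt))^2 * ennreal (1 / snd yt ^ (DIM('a) + 1))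
               * indicator (cone x) yt \<partial>(lborel \<Otimes>\<^sub>M lborel))
    \<le> ennreal (cone_const TYPE('a)) * (\<Sum>m. \<Sum>u\<in>Pow Basis. ennreal ((pairing_sup \<alpha> f u (int_decode m) x)^2))"
proof -
  define H where "H m = (\<Sum>u\<in>Pow Basis. ennreal ((pairing_sup \<alpha> f u (int_decode m) x)^2))" for m
  define \<rho> where "\<rho> m = (2 powi (- int_decode m - 4) :: real)" for m
  \<comment> \<open>The slab \<rho> / 2 < t \<le> \<rho> of the cone, enlarged to a product so that
    its measure is immediate.\<close>
  define R where "R m = ball x (\<rho> m) \<times> {0..\<rho> m}" for m
  define c where "c m = ((2 / \<rho> m) ^ (DIM('a) + 1))" for m
  have \<rho>: "0 < \<rho> m" for m by (simp add: \<rho>_def)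
  have [measurable]: "R m \<in> sets (lborel \<Otimes>\<^sub>M lborel)" for m unfolding R_def by measurable
  have "(\<integral>\<^sup>+ yt. (A_alpha \<alpha> f (fst yt) (snd yt))^2 * ennreal (1 / snd yt ^ (DIM('a) + 1))
               * indicator (cone x) yt \<partial>(lborel \<Otimes>\<^sub>M lborel))
    \<le> (\<integral>\<^sup>+ yt. (\<Sum>m. (H m * ennreal (c m)) * indicator (R m) yt) \<partial>(lborel \<Otimes>\<^sub>M lborel))"
  proof (rule nn_integral_mono)
    fix yt :: "'a \<times> real"
    obtain y t where yt: "yt = (y, t)" by (cases yt)
    show "(A_alpha \<alpha> f (fst yt) (snd yt))^2 * ennreal (1 / snd yt ^ (DIM('a) + 1)) * indicator (cone x) yt
       \<le> (\<Sum>m. (H m * ennreal (c m)) * indicator (R m) yt)"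
    proof (cases "yt \<in> cone x")
      case True
      then have t: "0 < t" "dist x y < t" by (auto simp: yt cone_def)
      obtain k where k: "2 powi (- k - 5) < t" "t \<le> 2 powi (- k - 4)" using dyadic_scale_exists[OF t(1)] by blast
      define m where "m = int_encode k"
      have \<rho>k: "\<rho> m = 2 powi (- k - 4)" by (simp add: \<rho>_def m_def)
      have "(2 powi (- k - 4) :: real) = 2 powi (- k) / 16" by (simp add: power_int_diff)
      moreover have "(0::real) < 2 powi (- k)" by simp
      ultimately have "6 * (2 * t) < 2 powi (- k)" using k(2) by linarith
      then obtain u where u: "u \<subseteq> Basis" "cball x (2 * t) \<subseteq> dcube u k x"
        using one_third_trick[of "2 * t" k x] t by auto
      have A: "A_alpha \<alpha> f y t \<le> ennreal (pairing_sup \<alpha> f u k x)"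
        by (rule A_alpha_le_pairing_sup[OF \<alpha> f t(2) k(1) u(2)])
      have ps: "0 \<le> pairing_sup \<alpha> f u k x"
        using grid_pairing.psup_nonneg[OF grid_pairing_dcube[OF \<alpha> f], of u k 0 x]
        unfolding psup_dcube[OF grid_pairing_dcube[OF \<alpha> f]] by simp
      have "(A_alpha \<alpha> f y t)^2 \<le> (ennreal (pairing_sup \<alpha> f u k x))^2" by (rule power_mono[OF A]) simp
      also have "\<dots> = ennreal ((pairing_sup \<alpha> f u (int_decode m) x)^2)" using ps by (simp add: ennreal_power m_def)
      also have "\<dots> \<le> H m" unfolding H_def by (rule member_le_sum) (use u in auto)
      finally have 1: "(A_alpha \<alpha> f y t)^2 \<le> H m" .
      have "(1 / t) ^ (DIM('a) + 1) \<le> c m"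
      proof -
        have "2 / \<rho> m = 1 / 2 powi (- k - 5)"
          unfolding \<rho>k by (simp add: power_int_diff field_simps)
        also have "\<dots> \<ge> 1 / t" using k t by (intro divide_left_mono) auto
        finally show ?thesis unfolding c_def using t by (intro power_mono) auto
      qed
      then have 2: "ennreal (1 / t ^ (DIM('a) + 1)) \<le> ennreal (c m)" by (intro ennreal_leI) (simp add: power_divide)
      have 3: "yt \<in> R m" using k t by (auto simp: R_def yt \<rho>k)
      have "(A_alpha \<alpha> f (fst yt) (snd yt))^2 * ennreal (1 / snd yt ^ (DIM('a) + 1)) * indicator (cone x) yt \<le> (H m * ennreal (c m)) * indicator (R m) yt"
        using mult_mono[OF 1 2] 3 True by (simp add: yt)
      also have "\<dots> \<le> (\<Sum>m. (H m * ennreal (c m)) * indicator (R m) yt)"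
      proof -
        have "g m \<le> (\<Sum>m. g m)" for g :: "nat \<Rightarrow> ennreal"
          using sum_le_suminf[of g "{m}"] by simp
        then show ?thesis .
      qed
      finally show ?thesis .
    qed simp
  qed
  also have "\<dots> = (\<Sum>m. (H m * ennreal (c m)) * emeasure (lborel \<Otimes>\<^sub>M lborel) (R m))"
  proof -
    have "(\<integral>\<^sup>+ yt. (H m * ennreal (c m)) * indicator (R m) yt \<partial>(lborel \<Otimes>\<^sub>M lborel)) = (H m * ennreal (c m)) * emeasure (lborel \<Otimes>\<^sub>M lborel) (R m)" for m
      by (rule nn_integral_cmult_indicator) measurable
    then show ?thesis by (subst nn_integral_suminf) auto
  qed
  also have "\<dots> = (\<Sum>m. ennreal (cone_const TYPE('a)) * H m)"
  proof (intro suminf_cong)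
    fix m
    have "emeasure (lborel \<Otimes>\<^sub>M lborel) (R m) = emeasure lborel (ball x (\<rho> m)) * emeasure lborel {0..\<rho> m}"
      unfolding R_def by (rule lborel.emeasure_pair_measure_Times) auto
    also have "\<dots> = ennreal (unit_ball_vol (real DIM('a)) * \<rho> m ^ DIM('a)) * ennreal (\<rho> m)"
      using \<rho>[of m] by (simp add: emeasure_ball)
    also have "\<dots> = ennreal (unit_ball_vol (real DIM('a)) * \<rho> m ^ DIM('a) * \<rho> m)"
      using \<rho>[of m] by (intro ennreal_mult[symmetric]) auto
    finally have "ennreal (c m) * emeasure (lborel \<Otimes>\<^sub>M lborel) (R m)
        = ennreal (c m * (unit_ball_vol (real DIM('a)) * \<rho> m ^ DIM('a) * \<rho> m))"
      using \<rho>[of m] by (simp only:) (intro ennreal_mult[symmetric], auto simp: c_def)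
    also have "c m * (unit_ball_vol (real DIM('a)) * \<rho> m ^ DIM('a) * \<rho> m) = cone_const TYPE('a)"
      using \<rho>[of m] by (simp add: c_def cone_const_def power_divide field_simps)
    finally show "(H m * ennreal (c m)) * emeasure (lborel \<Otimes>\<^sub>M lborel) (R m) = ennreal (cone_const TYPE('a)) * H m"
      by (simp add: mult.assoc mult.commute)
  qed
  also have "\<dots> = ennreal (cone_const TYPE('a)) * (\<Sum>m. H m)" by (rule ennreal_suminf_cmult)
  finally show ?thesis by (simp add: H_def)
qed

text \<open>The value of \<open>c1^2 + 8 * Kc\<close> common to all shifted grids, written out to
  exhibit that it depends on the dimension and \<alpha> alone.\<close>

definition pairing_const :: "'a::euclidean_space itself \<Rightarrow> real \<Rightarrow> real" where
  "pairing_const _ \<alpha> = (let n = real DIM('a); H = 32 powr (n + \<alpha>); \<theta> = 2 powr (- \<alpha>) in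
     (H * (2 * n) powr \<alpha>)^2 + 8 * ((H * n powr \<alpha> / \<theta>)^2 / (1 - \<theta>)^2 * (10 * (8 * 2 ^ DIM('a))^2)))"

text \<open>The bound involves neither u nor the window of scales from K to K + N, which is what
  permits the window to grow.\<close>

lemma pairing_sup_weak:
  fixes w f :: "'a::euclidean_space \<Rightarrow> real"
  assumes p: "1 < p" and \<alpha>: "0 < \<alpha>" and w: "Ap_weight p w" and f: "in_Lp_w p w f"
    and c: "\<And>l. 0 < c l" "\<And>F. finite F \<Longrightarrow> sum c F \<le> 1"
    and B: "\<And>n. (\<Sum>l<n. level_bound p (Ap_const p w) c l) \<le> B" and s: "0 < s"
  shows "wmeas w {x. s^2 < (\<Sum>i\<le>N. (pairing_sup \<alpha> f u (K + int i) x)^2)}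
    \<le> ennreal ((Ap_const p w + B) * (sqrt (pairing_const TYPE('a) \<alpha>) / s) powr p) * wmeas (\<lambda>y. \<bar>f y\<bar> powr p * w y) UNIV"
proof -
  note fc = in_Lp_w_cellint[OF p w f, of u K]
  note gp = grid_pairing_dcube[OF \<alpha> fc]
  interpret weighted_pairing "dgrid u K" "2 powi (- K)" f \<alpha> "32 powr (real DIM('a) + \<alpha>)" p w "Ap_const p w"
    using gp weighted_grid_dcube[OF p w] by (simp add: weighted_pairing_def)
  have "c1^2 + 8 * Kc = pairing_const TYPE('a) \<alpha>"
    by (simp add: pairing_const_def Let_def c1_def Kc_def c0_def \<theta>_def)
  then show ?thesis
    using pairing_square_weak[OF c B s, of N] unfolding psup_dcube[OF gp] by simp
qed

lemma pairing_sup_measurable: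
  fixes f :: "'a::euclidean_space \<Rightarrow> real"
  assumes \<alpha>: "0 < \<alpha>" and f: "grid.cellint (dgrid u k) f"
  shows "pairing_sup \<alpha> f u k \<in> borel_measurable borel"
proof -
  note gp = grid_pairing_dcube[OF \<alpha> f]
  interpret grid_pairing "dgrid u k" "2 powi (- k)" f \<alpha> "32 powr (real DIM('a) + \<alpha>)" by (rule gp)
  have "pairing_sup \<alpha> f u k = psup 0" using psup_dcube[OF gp, of 0] by auto
  then show ?thesis using psup_measurable[of 0] by simp
qed

section \<open>From the pairings to the square function\<close>

lemma cone_const_pos: "0 < cone_const TYPE('a::euclidean_space)"
  by (simp add: cone_const_def)

text \<open>If no window of scales exceeds s^2 in any of the 2^n grids, then neither do the full
  sums, and \<open>cone_integral_le\<close> bounds the square of \<open>G_alpha\<close> by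
  lam^2.\<close>

lemma G_alpha_level_set:
  fixes f :: "'a::euclidean_space \<Rightarrow> real"
  assumes \<alpha>: "0 < \<alpha>" and f: "\<And>u k. grid.cellint (dgrid u k) f"
    and lam: "0 < lam" and s: "cone_const TYPE('a) * 2 ^ DIM('a) * s^2 = lam^2"
    and G: "ennreal lam < G_alpha \<alpha> f x"
  shows "\<exists>u\<in>Pow Basis. \<exists>N. s^2 < (\<Sum>i\<le>2 * N. (pairing_sup \<alpha> f u (- int N + int i) x)^2)"
proof (rule ccontr)
  assume "\<not> ?thesis"
  then have le: "(\<Sum>i\<le>2 * N. (pairing_sup \<alpha> f u (- int N + int i) x)^2) \<le> s^2" if "u \<in> Pow Basis" for u N
    using that by (auto simp: not_less)
  define V where "V = (\<integral>\<^sup>+ yt. (A_alpha \<alpha> f (fst yt) (snd yt))^2 * ennreal (1 / snd yt ^ (DIM('a) + 1))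
               * indicator (cone x) yt \<partial>(lborel \<Otimes>\<^sub>M lborel))"
  have each: "(\<Sum>m. ennreal ((pairing_sup \<alpha> f u (int_decode m) x)^2)) \<le> ennreal (s^2)" if u: "u \<in> Pow Basis" for u
  proof (rule suminf_le_const)
    let ?q = "\<lambda>k. (pairing_sup \<alpha> f u k x)^2"
    fix M
    \<comment> \<open>Any finite set of scales lies in a symmetric window.\<close>
    define N where "N = nat (Max (insert 0 ((\<lambda>m. \<bar>int_decode m\<bar>) ` {..<M})))"
    have N: "\<bar>int_decode m\<bar> \<le> int N" if "m < M" for m
    proof -
      have "\<bar>int_decode m\<bar> \<le> Max (insert 0 ((\<lambda>m. \<bar>int_decode m\<bar>) ` {..<M}))"
        using that by (intro Max_ge) auto
      then show ?thesis unfolding N_def by linarith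
    qed
    have "(\<Sum>m<M. ?q (int_decode m)) = (\<Sum>k\<in>int_decode ` {..<M}. ?q k)"
      by (subst sum.reindex) (auto intro: inj_on_subset[OF inj_int_decode])
    also have "\<dots> \<le> (\<Sum>k\<in>{- int N..int N}. ?q k)"
      using N by (intro sum_mono2) (auto simp: abs_le_iff minus_le_iff)
    also have "\<dots> = (\<Sum>i\<le>2 * N. ?q (- int N + int i))"
      by (rule sum.reindex_bij_witness[where i = "\<lambda>i. - int N + int i" and j = "\<lambda>k. nat (k + int N)"]) auto
    also have "\<dots> \<le> s^2" by (rule le[OF u])
    finally show "(\<Sum>m<M. ennreal (?q (int_decode m))) \<le> ennreal (s^2)"
      by (subst sum_ennreal) (auto intro: ennreal_leI)
  qed simp
  have "V \<le> ennreal (cone_const TYPE('a)) * (\<Sum>m. \<Sum>u\<in>Pow Basis. ennreal ((pairing_sup \<alpha> f u (int_decode m) x)^2))"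
    unfolding V_def by (rule cone_integral_le[OF \<alpha> f])
  also have "(\<Sum>m. \<Sum>u\<in>Pow Basis. ennreal ((pairing_sup \<alpha> f u (int_decode m) x)^2))
      = (\<Sum>u\<in>Pow Basis. \<Sum>m. ennreal ((pairing_sup \<alpha> f u (int_decode m) x)^2))"
    by (rule suminf_sum) simp
  also have "ennreal (cone_const TYPE('a)) * \<dots> \<le> ennreal (cone_const TYPE('a)) * (\<Sum>u\<in>Pow (Basis::'a set). ennreal (s^2))"
    by (intro mult_left_mono sum_mono each) auto
  also have "\<dots> = ennreal (lam^2)"
    unfolding s[symmetric] using cone_const_pos[where 'a = 'a]
    by (simp add: card_Pow ennreal_mult ennreal_power[symmetric] mult.assoc less_imp_le del: ennreal_power)
  finally have V: "V \<le> ennreal (lam^2)" .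
  then have Vtop: "V \<noteq> top" by (auto simp: top_unique)
  have "enn2real V \<le> lam^2" using V by (intro enn2real_leI) auto
  then have "enn2real V powr (1 / 2) \<le> (lam^2) powr (1 / 2)" by (intro powr_mono2) auto
  also have "\<dots> = lam" using lam by (simp add: powr_half_sqrt)
  finally have "G_alpha \<alpha> f x \<le> ennreal lam"
    unfolding G_alpha_def V_def[symmetric] enn_powr_def using Vtop by (simp add: ennreal_leI)
  then show False using G by simp
qed

lemma enn_powr_root_le:
  assumes p: "0 < p" and a: "0 \<le> a" and I: "I < top" and le: "m \<le> ennreal (a powr p) * I"
  shows "enn_powr m (1 / p) \<le> ennreal a * enn_powr I (1 / p)"
proof -
  obtain i where i: "I = ennreal i" "0 \<le> i" using I by (cases I) auto
  have m: "m \<le> ennreal (a powr p * i)" using le i by (simp add: ennreal_mult)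
  then have mtop: "m \<noteq> top" by (auto simp: top_unique)
  have "enn2real m \<le> a powr p * i" using m i by (intro enn2real_leI) auto
  then have "enn2real m powr (1 / p) \<le> (a powr p * i) powr (1 / p)"
    using p by (intro powr_mono2) auto
  also have "\<dots> = a * i powr (1 / p)" using p a by (simp add: powr_mult powr_powr)
  finally show ?thesis
    using mtop i a by (simp add: enn_powr_def ennreal_mult[symmetric] ennreal_leI)
qed

lemma Ap_const_ge_1:
  assumes "1 < p" "Ap_weight p w"
  shows "1 \<le> Ap_const p w"
  using weighted_grid.X_ge_1[OF weighted_grid_dcube[OF assms, of "{}" 0]] .

text \<open>
  The level set of G_alpha is not shown to be measurable. On such sets wmeas is a lower integral, which
  is still monotone, and the union of level sets that covers it is measurable.
\<close>
lemma G_alpha_distribution: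
  fixes w f :: "'a::euclidean_space \<Rightarrow> real"
  assumes p: "1 < p" and \<alpha>: "0 < \<alpha>" and w: "Ap_weight p w" and f: "in_Lp_w p w f"
    and c: "\<And>l. 0 < c l" "\<And>F. finite F \<Longrightarrow> sum c F \<le> 1"
    and B: "\<And>n. (\<Sum>l<n. level_bound p (Ap_const p w) c l) \<le> B"
    and lam: "0 < lam" and s: "0 < s" "cone_const TYPE('a) * 2 ^ DIM('a) * s^2 = lam^2"
  shows "wmeas w {x. ennreal lam < G_alpha \<alpha> f x}
    \<le> ennreal (2 ^ DIM('a) * ((Ap_const p w + B) * (sqrt (pairing_const TYPE('a) \<alpha>) / s) powr p)) * wmeas (\<lambda>y. \<bar>f y\<bar> powr p * w y) UNIV"
proof -
  let ?I = "wmeas (\<lambda>y. \<bar>f y\<bar> powr p * w y) UNIV"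
  let ?b = "(Ap_const p w + B) * (sqrt (pairing_const TYPE('a) \<alpha>) / s) powr p"
  note fc = in_Lp_w_cellint[OF p w f]
  have [measurable]: "w \<in> borel_measurable borel" using w by (simp add: Ap_weight_def)
  have [measurable]: "pairing_sup \<alpha> f u k \<in> borel_measurable borel" for u k
    by (rule pairing_sup_measurable[OF \<alpha> fc])
  have b0: "0 \<le> ?b" using Ap_const_ge_1[OF p w] B[of 0] by (intro mult_nonneg_nonneg) auto
  define E where "E u N = {x. s^2 < (\<Sum>i\<le>2 * N. (pairing_sup \<alpha> f u (- int N + int i) x)^2)}" for u N
  have E_sets: "E u N \<in> sets borel" for u N unfolding E_def by measurable
  have E_eq: "(\<Sum>i\<le>2 * N. (pairing_sup \<alpha> f u (- int N + int i) x)^2) = (\<Sum>k\<in>{- int N..int N}. (pairing_sup \<alpha> f u k x)^2)" for u N x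
    by (rule sum.reindex_bij_witness[where j = "\<lambda>i. - int N + int i" and i = "\<lambda>k. nat (k + int N)"]) auto
  \<comment> \<open>The windows grow with N, so continuity from below passes the uniform bound on to
    all scales.\<close>
  have "incseq (E u)" for u
  proof (rule incseq_SucI, rule subsetI)
    fix N x assume "x \<in> E u N"
    moreover have "(\<Sum>k\<in>{- int N..int N}. (pairing_sup \<alpha> f u k x)^2) \<le> (\<Sum>k\<in>{- int (Suc N)..int (Suc N)}. (pairing_sup \<alpha> f u k x)^2)"
      by (intro sum_mono2) auto
    ultimately show "x \<in> E u (Suc N)" unfolding E_def E_eq by simp
  qed
  then have EU: "wmeas w (\<Union>N. E u N) \<le> ennreal ?b * ?I" for u
  proof -
    assume inc: "\<And>u. incseq (E u)"
    let ?M = "density lborel (\<lambda>x. ennreal (w x))"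
    have "wmeas w (\<Union>N. E u N) = emeasure ?M (\<Union>N. E u N)"
      using E_sets by (intro wmeas_emeasure) auto
    also have "\<dots> = (SUP N. emeasure ?M (E u N))"
      using inc E_sets by (intro SUP_emeasure_incseq[symmetric]) auto
    also have "\<dots> \<le> ennreal ?b * ?I"
    proof (rule SUP_least)
      fix N
      have "emeasure ?M (E u N) = wmeas w (E u N)" by (simp add: wmeas_emeasure E_sets)
      also have "\<dots> \<le> ennreal ?b * ?I"
        unfolding E_def by (rule pairing_sup_weak[OF p \<alpha> w f c B s(1)])
      finally show "emeasure ?M (E u N) \<le> ennreal ?b * ?I" .
    qed
    finally show ?thesis .
  qed
  have "wmeas w {x. ennreal lam < G_alpha \<alpha> f x} \<le> wmeas w (\<Union>u\<in>Pow Basis. \<Union>N. E u N)"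
    by (rule wmeas_mono) (use G_alpha_level_set[OF \<alpha> fc lam s(2)] in \<open>auto simp: E_def\<close>)
  also have "\<dots> \<le> (\<Sum>u\<in>Pow Basis. wmeas w (\<Union>N. E u N))"
  proof -
    have U: "(\<Union>N. E u N) \<in> sets borel" for u using E_sets by auto
    then have "(\<Union>u\<in>Pow Basis. \<Union>N. E u N) \<in> sets borel" by (intro sets.finite_UN[OF _ U]) simp
    with U show ?thesis
      using emeasure_subadditive_finite[of "Pow Basis" "\<lambda>u. \<Union>N. E u N" "density lborel (\<lambda>x. ennreal (w x))"]
      by (simp add: wmeas_emeasure image_subset_iff)
  qed
  also have "\<dots> \<le> (\<Sum>u\<in>Pow (Basis::'a set). ennreal ?b * ?I)" by (rule sum_mono[OF EU])
  also have "\<dots> = ennreal (2 ^ DIM('a) * ?b) * ?I"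
    using b0 by (simp add: card_Pow ennreal_mult ennreal_power[symmetric] mult.assoc del: ennreal_power)
  finally show ?thesis .
qed

theorem theorem1p3:
  fixes p \<alpha> :: real
  assumes "1 < p" "p < 3" "0 < \<alpha>" "\<alpha> \<le> 1"
  shows "\<exists>C::real. \<forall>(w::'a::euclidean_space \<Rightarrow> real) (f::'a \<Rightarrow> real).
           Ap_weight p w \<longrightarrow> in_Lp_w p w f \<longrightarrow>
           weak_Lp_w_norm p w (G_alpha \<alpha> f)
             \<le> ennreal (C * Ap_const p w powr (max (1/2) (1/p)) * phi_p p (Ap_const p w))
               * Lp_w_norm p w f"
proof -
  obtain C1 where C1: "0 \<le> C1" "\<And>X. 1 \<le> X \<Longrightarrow> \<exists>c. (\<forall>l. 0 < c l) \<and> (\<forall>F. finite F \<longrightarrow> sum c F \<le> 1) \<and>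
    (\<forall>n. (\<Sum>l<n. level_bound p X c l) \<le> C1 * X powr (max (p / 2) 1) * phi_p p X powr p)"
    using thresholds[OF assms(1,2)] by blast
  define \<kappa> where "\<kappa> = cone_const TYPE('a) * 2 ^ DIM('a)"
  have \<kappa>: "0 < \<kappa>" using cone_const_pos[where 'a = 'a] by (simp add: \<kappa>_def)
  define K where "K = pairing_const TYPE('a) \<alpha>"
  have K: "0 \<le> K" unfolding K_def pairing_const_def Let_def by simp
  \<comment> \<open>2^n counts the grids, 1 the maximal function and \<open>C1\<close> the levels;
    \<open>sqrt (K * \<kappa>)\<close> combines the pairing constant with the conversion of lam into
    s.\<close>
  define C where "C = (2 ^ DIM('a) * (1 + C1)) powr (1 / p) * sqrt (K * \<kappa>)"
  have C: "0 \<le> C" using K \<kappa> by (simp add: C_def)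
  show ?thesis
  proof (intro exI[of _ C] allI impI)
    fix w f :: "'a \<Rightarrow> real"
    assume w: "Ap_weight p w" and f: "in_Lp_w p w f"
    define X where "X = Ap_const p w"
    have X: "1 \<le> X" unfolding X_def by (rule Ap_const_ge_1[OF assms(1) w])
    let ?I = "wmeas (\<lambda>y. \<bar>f y\<bar> powr p * w y) UNIV"
    have I: "Lp_w_norm p w f = enn_powr ?I (1 / p)" by (simp add: Lp_w_norm_def wmeas_def)
    have I_fin: "?I < top"
      using f unfolding in_Lp_w_def I enn_powr_def by (auto split: if_splits simp: top.not_eq_extremum)
    define \<Phi> where "\<Phi> = phi_p p X"
    have \<Phi>: "1 \<le> \<Phi>" using X by (simp add: \<Phi>_def phi_p_def)
    define Z where "Z = X powr (max (1 / 2) (1 / p)) * \<Phi>"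
    have Z: "0 \<le> Z" using \<Phi> by (simp add: Z_def)
    have Zp: "Z powr p = X powr (max (p / 2) 1) * \<Phi> powr p"
    proof -
      have "max (1 / 2) (1 / p) * p = max (p / 2) 1"
        using assms(1) by (simp add: max_def field_simps)
      then show ?thesis using \<Phi> by (simp add: Z_def powr_mult powr_powr)
    qed
    obtain c where c: "\<And>l. 0 < c l" "\<And>F. finite F \<Longrightarrow> sum c F \<le> 1"
      "\<And>n. (\<Sum>l<n. level_bound p X c l) \<le> C1 * X powr (max (p / 2) 1) * \<Phi> powr p"
      using C1(2)[OF X] unfolding \<Phi>_def by blast
    \<comment> \<open>The bare X from the maximal function is absorbed, as the exponent of X in
      \<open>Zp\<close> is at least 1 and \<Phi> \<ge> 1.\<close>
    have XZ: "X \<le> Z powr p"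
    proof -
      have "X = X powr 1 * 1" using X by simp
      also have "\<dots> \<le> X powr (max (p / 2) 1) * \<Phi> powr p"
        using X \<Phi> assms(1) by (intro mult_mono powr_mono ge_one_powr_ge_zero) auto
      finally show ?thesis by (simp add: Zp)
    qed
    show "weak_Lp_w_norm p w (G_alpha \<alpha> f)
             \<le> ennreal (C * Ap_const p w powr (max (1/2) (1/p)) * phi_p p (Ap_const p w)) * Lp_w_norm p w f"
      unfolding weak_Lp_w_norm_def
    proof (rule SUP_least)
      fix lam :: real assume "lam \<in> {0<..}"
      then have lam: "0 < lam" by simp
      define s where "s = lam / sqrt \<kappa>"
      have s: "0 < s" "cone_const TYPE('a) * 2 ^ DIM('a) * s^2 = lam^2"
        using lam \<kappa> unfolding \<kappa>_def[symmetric] by (auto simp: s_def power_divide)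
      have "wmeas w {x. ennreal lam < G_alpha \<alpha> f x}
        \<le> ennreal (2 ^ DIM('a) * ((X + C1 * X powr (max (p / 2) 1) * \<Phi> powr p) * (sqrt K / s) powr p)) * ?I"
        using G_alpha_distribution[OF assms(1,3) w f c[unfolded X_def] lam s] unfolding X_def K_def .
      also have "\<dots> \<le> ennreal ((C * Z / lam) powr p) * ?I"
      proof (intro mult_right_mono ennreal_leI)
        have K_s: "sqrt K / s = sqrt (K * \<kappa>) / lam" by (simp add: s_def real_sqrt_mult)
        have "2 ^ DIM('a) * ((X + C1 * X powr (max (p / 2) 1) * \<Phi> powr p) * (sqrt K / s) powr p)
          \<le> 2 ^ DIM('a) * (((1 + C1) * Z powr p) * (sqrt K / s) powr p)"
          using XZ by (intro mult_left_mono mult_right_mono) (auto simp: Zp algebra_simps)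
        also have "2 ^ DIM('a) * (((1 + C1) * Z powr p) * (sqrt K / s) powr p) = (C * Z / lam) powr p"
          unfolding K_s using C1(1) assms(1) by (simp add: C_def powr_mult powr_divide powr_powr)
        finally show "2 ^ DIM('a) * ((X + C1 * X powr (max (p / 2) 1) * \<Phi> powr p) * (sqrt K / s) powr p) \<le> (C * Z / lam) powr p" .
      qed simp
      finally have "enn_powr (wmeas w {x. ennreal lam < G_alpha \<alpha> f x}) (1 / p) \<le> ennreal (C * Z / lam) * enn_powr ?I (1 / p)"
        using assms(1) C Z lam by (intro enn_powr_root_le I_fin) auto
      then have "ennreal lam * enn_powr (wmeas w {x. ennreal lam < G_alpha \<alpha> f x}) (1 / p) \<le> ennreal lam * (ennreal (C * Z / lam) * enn_powr ?I (1 / p))"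
        by (rule mult_left_mono) simp
      also have "\<dots> = ennreal (lam * (C * Z / lam)) * enn_powr ?I (1 / p)"
        by (simp only: ennreal_mult'[OF less_imp_le[OF lam]] mult.assoc)
      also have "lam * (C * Z / lam) = C * Ap_const p w powr (max (1/2) (1/p)) * phi_p p (Ap_const p w)"
        using lam by (simp add: Z_def X_def \<Phi>_def)
      finally show "ennreal lam * enn_powr (wmeas w {x. ennreal lam < G_alpha \<alpha> f x}) (1 / p)
        \<le> ennreal (C * Ap_const p w powr (max (1/2) (1/p)) * phi_p p (Ap_const p w)) * Lp_w_norm p w f"
        unfolding I .
    qed
  qed
qed

end
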